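(* Let $k$ be a field and let $H\to G_1$ and $H\to G_2$ be morphisms of $k$-groups. If $G_1$ and $G_2$ are geometrically reduced, then $G_1 *_H G_2$ is geometrically reduced.
   Context: A $k$-group is an affine group scheme over $k$ (not necessarily of finite type). The amalgamated free product $G_1 *_H G_2$ is the push-out of $H\to G_1$ and $H\to G_2$ in the category of $k$-groups (it always exists). A $k$-group $G$ is geometrically reduced if $k[G]\otimes_k\overline{k}$ is reduced, where $k[G]$ is the ring of global sections of $G$ and $\overline{k}$ an algebraic closure of $k$. *)

theory Defs
  imports "HOL-Algebra.Algebraic_Closure"
begin

text \<open>
  The category of affine schemes over a field \<open>K\<close> is the opposite of the category of commutative
  \<open>K\<close>-algebras, with \<open>Spec A \<times> Spec B = Spec (A \<otimes>\<^sub>K B)\<close>.  An affine group scheme over \<open>K\<close>, i.e. a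
  group object of this category, is therefore stored as its ring of global sections together with
  the comorphisms of multiplication, unit and inversion.
\<close>


section \<open>Commutative algebras over a field\<close>

definition alg_hom ::
  "'k ring \<Rightarrow> ('k, 'a) module \<Rightarrow> ('k, 'b) module \<Rightarrow> ('a \<Rightarrow> 'b) set"
  where "alg_hom K A B =
    {h \<in> ring_hom A B.
       \<forall>c\<in>carrier K. \<forall>x\<in>carrier A. h (c \<odot>\<^bsub>A\<^esub> x) = c \<odot>\<^bsub>B\<^esub> h x}"

definition alg_via :: "('k \<Rightarrow> 'a) \<Rightarrow> 'a ring \<Rightarrow> ('k, 'a) module"
  where "alg_via h L =
    \<lparr>carrier = carrier L, monoid.mult = (\<otimes>\<^bsub>L\<^esub>), one = \<one>\<^bsub>L\<^esub>, zero = \<zero>\<^bsub>L\<^esub>, add = (\<oplus>\<^bsub>L\<^esub>),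
     smult = (\<lambda>c x. h c \<otimes>\<^bsub>L\<^esub> x)\<rparr>"

abbreviation base_alg :: "'k ring \<Rightarrow> ('k, 'k) module"
  where "base_alg K \<equiv> alg_via (\<lambda>c. c) K"

abbreviation alg_closure_alg :: "'k ring \<Rightarrow> ('k, ('k list \<times> nat) multiset \<Rightarrow> 'k) module"
  where "alg_closure_alg K \<equiv> alg_via (ring.indexed_const K) (field.alg_closure K)"

definition structure_map :: "('k, 'a) module \<Rightarrow> 'k \<Rightarrow> 'a"
  where "structure_map A c = c \<odot>\<^bsub>A\<^esub> \<one>\<^bsub>A\<^esub>"

definition reduced_ring :: "('a, 'm) ring_scheme \<Rightarrow> bool"
  where "reduced_ring R \<longleftrightarrow>
    (\<forall>x\<in>carrier R. \<forall>n::nat. x [^]\<^bsub>R\<^esub> n = \<zero>\<^bsub>R\<^esub> \<longrightarrow> x = \<zero>\<^bsub>R\<^esub>)"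


section \<open>Tensor products\<close>

text \<open>
  A list \<open>[(a\<^sub>1, b\<^sub>1), \<dots>, (a\<^sub>n, b\<^sub>n)]\<close> stands for the formal sum \<open>a\<^sub>1 \<otimes> b\<^sub>1 + \<dots> + a\<^sub>n \<otimes> b\<^sub>n\<close>, and
  \<open>A \<otimes>\<^sub>K B\<close> is the set of formal sums modulo the congruence generated by \<open>K\<close>-bilinearity.
  No integer or scalar coefficients are needed, since \<open>c (a \<otimes> b) = (c a) \<otimes> b\<close>.
\<close>

definition formal_sums :: "('k, 'a) module \<Rightarrow> ('k, 'b) module \<Rightarrow> ('a \<times> 'b) list set"
  where "formal_sums A B = lists (carrier A \<times> carrier B)"

inductive_set tensor_rel ::
  "'k ring \<Rightarrow> ('k, 'a) module \<Rightarrow> ('k, 'b) module \<Rightarrow> (('a \<times> 'b) list \<times> ('a \<times> 'b) list) set"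
  for K A B
  where
    perm: "\<lbrakk>xs \<in> formal_sums A B; mset xs = mset ys\<rbrakk> \<Longrightarrow> (xs, ys) \<in> tensor_rel K A B"
  | sym: "(xs, ys) \<in> tensor_rel K A B \<Longrightarrow> (ys, xs) \<in> tensor_rel K A B"
  | trans: "\<lbrakk>(xs, ys) \<in> tensor_rel K A B; (ys, zs) \<in> tensor_rel K A B\<rbrakk>
      \<Longrightarrow> (xs, zs) \<in> tensor_rel K A B"
  | append: "\<lbrakk>(xs, ys) \<in> tensor_rel K A B; zs \<in> formal_sums A B\<rbrakk>
      \<Longrightarrow> (xs @ zs, ys @ zs) \<in> tensor_rel K A B"
  | add_left: "\<lbrakk>a \<in> carrier A; a' \<in> carrier A; b \<in> carrier B\<rbrakk>
      \<Longrightarrow> ([(a \<oplus>\<^bsub>A\<^esub> a', b)], [(a, b), (a', b)]) \<in> tensor_rel K A B"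
  | add_right: "\<lbrakk>a \<in> carrier A; b \<in> carrier B; b' \<in> carrier B\<rbrakk>
      \<Longrightarrow> ([(a, b \<oplus>\<^bsub>B\<^esub> b')], [(a, b), (a, b')]) \<in> tensor_rel K A B"
  | scalar: "\<lbrakk>c \<in> carrier K; a \<in> carrier A; b \<in> carrier B\<rbrakk>
      \<Longrightarrow> ([(c \<odot>\<^bsub>A\<^esub> a, b)], [(a, c \<odot>\<^bsub>B\<^esub> b)]) \<in> tensor_rel K A B"
  | zero: "b \<in> carrier B \<Longrightarrow> ([(\<zero>\<^bsub>A\<^esub>, b)], []) \<in> tensor_rel K A B"

definition tensor_class ::
  "'k ring \<Rightarrow> ('k, 'a) module \<Rightarrow> ('k, 'b) module \<Rightarrow> ('a \<times> 'b) list \<Rightarrow> ('a \<times> 'b) list set"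
  where "tensor_class K A B xs = tensor_rel K A B `` {xs}"

definition tensor ::
  "'k ring \<Rightarrow> ('k, 'a) module \<Rightarrow> ('k, 'b) module \<Rightarrow> ('k, ('a \<times> 'b) list set) module"
  where "tensor K A B =
    \<lparr>carrier = formal_sums A B // tensor_rel K A B,
     monoid.mult = (\<lambda>U V. \<Union>xs\<in>U. \<Union>ys\<in>V.
       tensor_class K A B [(a \<otimes>\<^bsub>A\<^esub> a', b \<otimes>\<^bsub>B\<^esub> b'). (a, b) \<leftarrow> xs, (a', b') \<leftarrow> ys]),
     one = tensor_class K A B [(\<one>\<^bsub>A\<^esub>, \<one>\<^bsub>B\<^esub>)],
     zero = tensor_class K A B [],
     add = (\<lambda>U V. \<Union>xs\<in>U. \<Union>ys\<in>V. tensor_class K A B (xs @ ys)),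
     smult = (\<lambda>c U. \<Union>xs\<in>U. tensor_class K A B (map (\<lambda>(a, b). (c \<odot>\<^bsub>A\<^esub> a, b)) xs))\<rparr>"

definition tensor_inl ::
  "'k ring \<Rightarrow> ('k, 'a) module \<Rightarrow> ('k, 'b) module \<Rightarrow> 'a \<Rightarrow> ('a \<times> 'b) list set"
  where "tensor_inl K A B a = tensor_class K A B [(a, \<one>\<^bsub>B\<^esub>)]"

definition tensor_inr ::
  "'k ring \<Rightarrow> ('k, 'a) module \<Rightarrow> ('k, 'b) module \<Rightarrow> 'b \<Rightarrow> ('a \<times> 'b) list set"
  where "tensor_inr K A B b = tensor_class K A B [(\<one>\<^bsub>A\<^esub>, b)]"

text \<open>
  The algebra homomorphism \<open>A \<otimes>\<^sub>K B \<rightarrow> R\<close>, \<open>a \<otimes> b \<mapsto> f a g b\<close>, induced by algebra homomorphisms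
  \<open>f : A \<rightarrow> R\<close> and \<open>g : B \<rightarrow> R\<close> (for which the choice of representative is irrelevant).
  On spectra, this is the morphism \<open>Spec R \<rightarrow> Spec A \<times> Spec B\<close> with components \<open>f\<close> and \<open>g\<close>.
\<close>

definition tensor_lift ::
  "('k, 'r) module \<Rightarrow> ('a \<Rightarrow> 'r) \<Rightarrow> ('b \<Rightarrow> 'r) \<Rightarrow> ('a \<times> 'b) list set \<Rightarrow> 'r"
  where "tensor_lift R f g U =
    foldr (\<lambda>(a, b) s. (f a \<otimes>\<^bsub>R\<^esub> g b) \<oplus>\<^bsub>R\<^esub> s) (SOME xs. xs \<in> U) \<zero>\<^bsub>R\<^esub>"

definition tensor_map ::
  "'k ring \<Rightarrow> ('k, 'c) module \<Rightarrow> ('k, 'd) module \<Rightarrow> ('a \<Rightarrow> 'c) \<Rightarrow> ('b \<Rightarrow> 'd)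
    \<Rightarrow> ('a \<times> 'b) list set \<Rightarrow> ('c \<times> 'd) list set"
  where "tensor_map K C D f g =
    tensor_lift (tensor K C D) (tensor_inl K C D \<circ> f) (tensor_inr K C D \<circ> g)"

text \<open>The isomorphism \<open>(A \<otimes> B) \<otimes> C \<rightarrow> A \<otimes> (B \<otimes> C)\<close>.\<close>

definition tensor_assoc ::
  "'k ring \<Rightarrow> ('k, 'a) module \<Rightarrow> ('k, 'b) module \<Rightarrow> ('k, 'c) module
    \<Rightarrow> (('a \<times> 'b) list set \<times> 'c) list set \<Rightarrow> ('a \<times> ('b \<times> 'c) list set) list set"
  where "tensor_assoc K A B C =
    (let BC = tensor K B C; T = tensor K A BC
     in tensor_lift T
          (tensor_lift T (tensor_inl K A BC) (tensor_inr K A BC \<circ> tensor_inl K B C))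
          (tensor_inr K A BC \<circ> tensor_inr K B C))"


section \<open>Affine group schemes\<close>

record ('k, 'a) kgroup =
  sections :: "('k, 'a) module"
  comult :: "'a \<Rightarrow> ('a \<times> 'a) list set"
  counit :: "'a \<Rightarrow> 'k"
  antipode :: "'a \<Rightarrow> 'a"

locale k_group =
  fixes K :: "'k ring" and G :: "('k, 'a) kgroup"
  assumes field: "field K"
    and algebra: "algebra K (sections G)"
    and comult_hom:
      "comult G \<in> alg_hom K (sections G) (tensor K (sections G) (sections G))"
    and counit_hom: "counit G \<in> alg_hom K (sections G) (base_alg K)"
    and antipode_hom: "antipode G \<in> alg_hom K (sections G) (sections G)"
    and coassoc: "x \<in> carrier (sections G) \<Longrightarrow>
      tensor_assoc K (sections G) (sections G) (sections G)
        (tensor_map K (tensor K (sections G) (sections G)) (sections G)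
          (comult G) (\<lambda>y. y) (comult G x))
      = tensor_map K (sections G) (tensor K (sections G) (sections G))
          (\<lambda>y. y) (comult G) (comult G x)"
    and counit_left: "x \<in> carrier (sections G) \<Longrightarrow>
      tensor_lift (sections G) (structure_map (sections G) \<circ> counit G) (\<lambda>y. y) (comult G x) = x"
    and counit_right: "x \<in> carrier (sections G) \<Longrightarrow>
      tensor_lift (sections G) (\<lambda>y. y) (structure_map (sections G) \<circ> counit G) (comult G x) = x"
    and antipode_left: "x \<in> carrier (sections G) \<Longrightarrow>
      tensor_lift (sections G) (antipode G) (\<lambda>y. y) (comult G x)
      = structure_map (sections G) (counit G x)"
    and antipode_right: "x \<in> carrier (sections G) \<Longrightarrow>
      tensor_lift (sections G) (\<lambda>y. y) (antipode G) (comult G x)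
      = structure_map (sections G) (counit G x)"

text \<open>
  A morphism \<open>G \<rightarrow> H\<close> is represented by its comorphism, a map from the sections of \<open>H\<close> to those of
  \<open>G\<close>.  As for abstract groups, compatibility with unit and inversion follows.
\<close>

definition kgroup_mor ::
  "'k ring \<Rightarrow> ('k, 'a) kgroup \<Rightarrow> ('k, 'b) kgroup \<Rightarrow> ('b \<Rightarrow> 'a) set"
  where "kgroup_mor K G H =
    {f \<in> alg_hom K (sections H) (sections G).
       \<forall>x\<in>carrier (sections H).
         comult G (f x) = tensor_map K (sections G) (sections G) f f (comult H x)}"

definition geometrically_reduced :: "'k ring \<Rightarrow> ('k, 'a) kgroup \<Rightarrow> bool"
  where "geometrically_reduced K G \<longleftrightarrow>
    reduced_ring (tensor K (sections G) (alg_closure_alg K))"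

text \<open>
  \<open>P\<close>, with \<open>i1 : G1 \<rightarrow> P\<close> and \<open>i2 : G2 \<rightarrow> P\<close>, is a push-out of \<open>f1 : H \<rightarrow> G1\<close> and \<open>f2 : H \<rightarrow> G2\<close>.
  Composites are reversed, as all maps are comorphisms.  The type \<open>'u\<close> plays the role of the
  universe: the category is that of all \<open>K\<close>-groups whose sections are carried by a subset of \<open>'u\<close>.
  As soon as \<open>'u\<close> is infinite and at least as large as \<open>K\<close>, a push-out in this category is a
  push-out among \<open>K\<close>-groups of any size, because every Hopf algebra is the directed union of its
  Hopf subalgebras that are finitely generated as algebras.
\<close>

definition is_pushout ::
  "'k ring \<Rightarrow> ('k, 'u) kgroup \<Rightarrow> ('k, 'u) kgroup \<Rightarrow> ('k, 'u) kgroup \<Rightarrow> ('u \<Rightarrow> 'u) \<Rightarrow> ('u \<Rightarrow> 'u)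
    \<Rightarrow> ('k, 'u) kgroup \<Rightarrow> ('u \<Rightarrow> 'u) \<Rightarrow> ('u \<Rightarrow> 'u) \<Rightarrow> bool"
  where "is_pushout K H G1 G2 f1 f2 P i1 i2 \<longleftrightarrow>
    k_group K P \<and> i1 \<in> kgroup_mor K G1 P \<and> i2 \<in> kgroup_mor K G2 P \<and>
    (\<forall>x\<in>carrier (sections P). f1 (i1 x) = f2 (i2 x)) \<and>
    (\<forall>Q :: ('k, 'u) kgroup. k_group K Q \<longrightarrow>
      (\<forall>j1\<in>kgroup_mor K G1 Q. \<forall>j2\<in>kgroup_mor K G2 Q.
        (\<forall>x\<in>carrier (sections Q). f1 (j1 x) = f2 (j2 x)) \<longrightarrow>
        (\<exists>u\<in>kgroup_mor K P Q.
          (\<forall>x\<in>carrier (sections Q). i1 (u x) = j1 x \<and> i2 (u x) = j2 x) \<and>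
          (\<forall>v\<in>kgroup_mor K P Q.
            (\<forall>x\<in>carrier (sections Q). i1 (v x) = j1 x \<and> i2 (v x) = j2 x) \<longrightarrow>
            (\<forall>x\<in>carrier (sections Q). v x = u x)))))"

end

theory Submission
  imports Defs
begin

text \<open>
  Write \<open>A\<close> for the coordinate ring of the push-out \<open>P\<close>, \<open>L\<close> for the algebraic closure of \<open>K\<close>, and
  call an algebra \<open>B\<close> geometrically reduced if \<open>B \<otimes> L\<close> is reduced.  Among all ideals of \<open>A\<close> with
  geometrically reduced quotient there is a smallest one, their intersection \<open>N\<close>: if an element of
  \<open>A/N \<otimes> L\<close> is nilpotent, all its coefficients on a basis of \<open>L\<close> die in each of these quotients.
  Moreover every homomorphism from \<open>A\<close> to a geometrically reduced algebra kills \<open>N\<close>, because its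
  image is a geometrically reduced quotient of \<open>A\<close>.

  The point is that \<open>N\<close> is a Hopf ideal, so that \<open>A/N\<close> is the coordinate ring of a subgroup of \<open>P\<close>,
  the largest geometrically reduced one.  Indeed the counit \<open>A \<rightarrow> K\<close>, the antipode followed by
  \<open>A \<rightarrow> A/N\<close>, and the comultiplication followed by \<open>A \<otimes> A \<rightarrow> A/N \<otimes> A/N\<close> all have geometrically
  reduced targets, hence kill \<open>N\<close>.  For the last one this needs that a tensor product of
  geometrically reduced algebras is geometrically reduced (\<open>geom_reduced_tensor\<close>).

  Since \<open>G1\<close> and \<open>G2\<close> are geometrically reduced, \<open>N\<close> also lies in the kernels of \<open>i1\<close> and \<open>i2\<close>, so both
  morphisms factor through the subgroup \<open>Spec (A/N)\<close>.  The universal property gives a morphism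
  \<open>P \<rightarrow> Spec (A/N)\<close>, and its composite with the inclusion into \<open>P\<close> agrees with the identity on \<open>G1\<close>
  and \<open>G2\<close>, hence is the identity.  So \<open>A \<rightarrow> A/N\<close> is injective and \<open>A\<close> is geometrically reduced.

  The statement on tensor products rests on two facts.  Over a field, an element of \<open>A \<otimes> B\<close> is zero
  as soon as all its contractions with linear forms on \<open>B\<close> are zero (\<open>zero_if_contractions_zero\<close>).
  And a form of Hilbert's Nullstellensatz holds: for finitely many elements of a reduced algebra
  over \<open>L\<close>, some subalgebra containing them has an \<open>L\<close>-valued point at which a prescribed nonzero one
  among them does not vanish (\<open>reduced_ring_point\<close>).  Now let \<open>R\<close> be a reduced \<open>L\<close>-algebra, \<open>C\<close>
  geometrically reduced and \<open>x \<in> R \<otimes> C\<close> nilpotent.  An \<open>L\<close>-valued point of a subalgebra over which \<open>x\<close>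
  is defined sends \<open>x\<close> to a nilpotent element of \<open>L \<otimes> C\<close>, that is to zero, so it kills the
  contractions of \<open>x\<close>.  Therefore all contractions are zero, and so is \<open>x\<close>.  Taking \<open>R = B \<otimes> L\<close> shows
  that \<open>(B \<otimes> L) \<otimes> C\<close>, which is \<open>(B \<otimes> C) \<otimes> L\<close>, is reduced.
\<close>

section \<open>Bilinear maps on formal sums\<close>

text \<open>
  Every map out of a tensor product that occurs below is such a sum over some formal sum that
  represents the given element, for a suitable \<open>\<phi>\<close>.
\<close>

definition bilinear_sum :: "('r, 'm) ring_scheme \<Rightarrow> ('a \<Rightarrow> 'b \<Rightarrow> 'r) \<Rightarrow> ('a \<times> 'b) list \<Rightarrow> 'r"
  where "bilinear_sum R \<phi> xs = foldr (\<lambda>(a, b) s. \<phi> a b \<oplus>\<^bsub>R\<^esub> s) xs \<zero>\<^bsub>R\<^esub>"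

lemma bilinear_sum_simps [simp]:
  "bilinear_sum R \<phi> [] = \<zero>\<^bsub>R\<^esub>"
  "bilinear_sum R \<phi> ((a, b) # xs) = \<phi> a b \<oplus>\<^bsub>R\<^esub> bilinear_sum R \<phi> xs"
  by (simp_all add: bilinear_sum_def)

lemma bilinear_sum_cong:
  assumes "\<And>a b. (a, b) \<in> set xs \<Longrightarrow> \<phi> a b = \<psi> a b"
  shows "bilinear_sum R \<phi> xs = bilinear_sum R \<psi> xs"
  using assms by (induction xs) auto

lemma bilinear_sum_map:
  "bilinear_sum R \<phi> (map (\<lambda>(a, b). (f a b, g a b)) xs) = bilinear_sum R (\<lambda>a b. \<phi> (f a b) (g a b)) xs"
  by (induction xs) auto

context abelian_group
begin

lemma bilinear_sum_closed:
  assumes "\<And>a b. (a, b) \<in> set xs \<Longrightarrow> \<phi> a b \<in> carrier G"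
  shows "bilinear_sum G \<phi> xs \<in> carrier G"
  using assms by (induction xs) auto

lemma bilinear_sum_append:
  assumes "\<And>a b. (a, b) \<in> set xs \<union> set ys \<Longrightarrow> \<phi> a b \<in> carrier G"
  shows "bilinear_sum G \<phi> (xs @ ys) = bilinear_sum G \<phi> xs \<oplus> bilinear_sum G \<phi> ys"
  using assms
proof (induction xs)
  case Nil
  then show ?case by (simp add: bilinear_sum_closed)
next
  case (Cons p xs)
  obtain a b where "p = (a, b)" by (cases p)
  with Cons show ?case by (simp add: bilinear_sum_closed a_assoc)
qed

lemma bilinear_sum_perm:
  assumes "mset xs = mset ys" "\<And>a b. (a, b) \<in> set xs \<Longrightarrow> \<phi> a b \<in> carrier G"
  shows "bilinear_sum G \<phi> xs = bilinear_sum G \<phi> ys"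
  using assms
proof (induction xs arbitrary: ys)
  case Nil
  then show ?case by simp
next
  case (Cons p xs)
  obtain a b where p: "p = (a, b)" by (cases p)
  from Cons.prems(1) have "p \<in> set ys"
    by (metis list.set_intros(1) set_mset_mset)
  then obtain us vs where ys: "ys = us @ p # vs" by (meson split_list)
  have sets: "set (p # xs) = set ys"
    using Cons.prems(1) by (metis set_mset_mset)
  have cl: "\<And>a b. (a, b) \<in> set us \<union> set vs \<Longrightarrow> \<phi> a b \<in> carrier G" "\<phi> a b \<in> carrier G"
  proof -
    have "set us \<union> set vs \<subseteq> set (p # xs)" unfolding sets ys by auto
    then show "\<And>a b. (a, b) \<in> set us \<union> set vs \<Longrightarrow> \<phi> a b \<in> carrier G"
      using Cons.prems(2) by blast
    show "\<phi> a b \<in> carrier G" using Cons.prems(2) p by simp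
  qed
  have "bilinear_sum G \<phi> xs = bilinear_sum G \<phi> (us @ vs)"
    using Cons.prems ys by (intro Cons.IH) auto
  also have "\<dots> = bilinear_sum G \<phi> us \<oplus> bilinear_sum G \<phi> vs"
    using cl by (intro bilinear_sum_append)
  finally have *: "bilinear_sum G \<phi> xs = bilinear_sum G \<phi> us \<oplus> bilinear_sum G \<phi> vs" .
  have "bilinear_sum G \<phi> ys = bilinear_sum G \<phi> us \<oplus> bilinear_sum G \<phi> (p # vs)"
    unfolding ys using cl by (intro bilinear_sum_append) (auto simp: p)
  also have "\<dots> = bilinear_sum G \<phi> us \<oplus> (\<phi> a b \<oplus> bilinear_sum G \<phi> vs)"
    by (simp add: p)
  also have "\<dots> = \<phi> a b \<oplus> (bilinear_sum G \<phi> us \<oplus> bilinear_sum G \<phi> vs)"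
    using cl bilinear_sum_closed[of us \<phi>] bilinear_sum_closed[of vs \<phi>] by (simp add: a_lcomm)
  finally show ?case using * p by simp
qed

lemma bilinear_sum_add:
  assumes "\<And>a b. (a, b) \<in> set xs \<Longrightarrow> \<phi> a b \<in> carrier G" "\<And>a b. (a, b) \<in> set xs \<Longrightarrow> \<psi> a b \<in> carrier G"
  shows "bilinear_sum G (\<lambda>a b. \<phi> a b \<oplus> \<psi> a b) xs = bilinear_sum G \<phi> xs \<oplus> bilinear_sum G \<psi> xs"
  using assms
proof (induction xs)
  case (Cons p xs)
  obtain a b where p: "p = (a, b)" by (cases p)
  have "\<phi> a b \<in> carrier G" "\<psi> a b \<in> carrier G" "bilinear_sum G \<phi> xs \<in> carrier G" "bilinear_sum G \<psi> xs \<in> carrier G"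
    using Cons.prems p by (auto intro: bilinear_sum_closed)
  moreover have "bilinear_sum G (\<lambda>a b. \<phi> a b \<oplus> \<psi> a b) xs = bilinear_sum G \<phi> xs \<oplus> bilinear_sum G \<psi> xs"
    using Cons by simp
  ultimately show ?case by (simp add: p a_ac)
qed simp

end

lemma additive_zero:
  assumes "abelian_group R" "abelian_group S" "\<And>x. x \<in> carrier R \<Longrightarrow> h x \<in> carrier S"
    and "\<And>x y. x \<in> carrier R \<Longrightarrow> y \<in> carrier R \<Longrightarrow> h (x \<oplus>\<^bsub>R\<^esub> y) = h x \<oplus>\<^bsub>S\<^esub> h y"
  shows "h \<zero>\<^bsub>R\<^esub> = \<zero>\<^bsub>S\<^esub>"
proof -
  interpret R: abelian_group R by fact
  interpret S: abelian_group S by fact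
  show ?thesis using assms(3)[of "\<zero>\<^bsub>R\<^esub>"] assms(4)[of "\<zero>\<^bsub>R\<^esub>" "\<zero>\<^bsub>R\<^esub>"]
    by (metis R.r_zero R.zero_closed S.add.r_cancel_one')
qed

lemma additive_bilinear_sum:
  assumes "abelian_group R" "abelian_group S" "\<And>x. x \<in> carrier R \<Longrightarrow> h x \<in> carrier S"
    and "\<And>x y. x \<in> carrier R \<Longrightarrow> y \<in> carrier R \<Longrightarrow> h (x \<oplus>\<^bsub>R\<^esub> y) = h x \<oplus>\<^bsub>S\<^esub> h y"
    and "\<And>a b. (a, b) \<in> set xs \<Longrightarrow> \<phi> a b \<in> carrier R"
  shows "h (bilinear_sum R \<phi> xs) = bilinear_sum S (\<lambda>a b. h (\<phi> a b)) xs"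
proof -
  interpret R: abelian_group R by fact
  show ?thesis using assms(5)
  proof (induction xs)
    case Nil
    then show ?case using additive_zero[OF assms(1-4)] by simp
  next
    case (Cons p xs)
    obtain a b where p: "p = (a, b)" by (cases p)
    have "\<phi> a b \<in> carrier R" "bilinear_sum R \<phi> xs \<in> carrier R"
      using Cons.prems p by (auto intro: R.bilinear_sum_closed)
    moreover have "h (bilinear_sum R \<phi> xs) = bilinear_sum S (\<lambda>a b. h (\<phi> a b)) xs"
      using Cons by simp
    ultimately show ?case by (simp add: p assms(4))
  qed
qed

section \<open>Tensor products of algebras\<close>

locale tensor_pair = A: algebra K A + B: algebra K B
  for K :: "'k ring" and A :: "('k, 'a) module" and B :: "('k, 'b) module"
begin

abbreviation T where "T \<equiv> tensor K A B"
abbreviation rel where "rel \<equiv> tensor_rel K A B"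
abbreviation cls where "cls \<equiv> tensor_class K A B"
abbreviation formal where "formal \<equiv> formal_sums A B"
abbreviation pure where "pure a b \<equiv> cls [(a, b)]"

text \<open>
  These are the \<open>K\<close>-bilinear maps to an abelian group on which \<open>K\<close> need not act.
\<close>

definition balanced :: "('r, 'm) ring_scheme \<Rightarrow> ('a \<Rightarrow> 'b \<Rightarrow> 'r) \<Rightarrow> bool"
  where "balanced R \<phi> \<longleftrightarrow>
    (\<forall>a\<in>carrier A. \<forall>b\<in>carrier B. \<phi> a b \<in> carrier R) \<and>
    (\<forall>a\<in>carrier A. \<forall>a'\<in>carrier A. \<forall>b\<in>carrier B. \<phi> (a \<oplus>\<^bsub>A\<^esub> a') b = \<phi> a b \<oplus>\<^bsub>R\<^esub> \<phi> a' b) \<and>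
    (\<forall>a\<in>carrier A. \<forall>b\<in>carrier B. \<forall>b'\<in>carrier B. \<phi> a (b \<oplus>\<^bsub>B\<^esub> b') = \<phi> a b \<oplus>\<^bsub>R\<^esub> \<phi> a b') \<and>
    (\<forall>c\<in>carrier K. \<forall>a\<in>carrier A. \<forall>b\<in>carrier B. \<phi> (c \<odot>\<^bsub>A\<^esub> a) b = \<phi> a (c \<odot>\<^bsub>B\<^esub> b))"

lemma formal_simps [simp]:
  "[] \<in> formal"
  "(a, b) # xs \<in> formal \<longleftrightarrow> a \<in> carrier A \<and> b \<in> carrier B \<and> xs \<in> formal"
  "xs @ ys \<in> formal \<longleftrightarrow> xs \<in> formal \<and> ys \<in> formal"
  by (auto simp: formal_sums_def)

lemma formalD: "xs \<in> formal \<Longrightarrow> (a, b) \<in> set xs \<Longrightarrow> a \<in> carrier A \<and> b \<in> carrier B"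
  by (auto simp: formal_sums_def)

lemma formal_map:
  assumes "xs \<in> formal" "\<And>a b. a \<in> carrier A \<Longrightarrow> b \<in> carrier B \<Longrightarrow> f a b \<in> carrier A \<and> g a b \<in> carrier B"
  shows "map (\<lambda>(a, b). (f a b, g a b)) xs \<in> formal"
  using assms by (induction xs) auto

lemma formal_mset: "mset xs = mset ys \<Longrightarrow> xs \<in> formal \<longleftrightarrow> ys \<in> formal"
  unfolding formal_sums_def lists_eq_set by (metis mem_Collect_eq set_mset_mset)

lemma rel_formal: "(xs, ys) \<in> rel \<Longrightarrow> xs \<in> formal \<and> ys \<in> formal"
proof (induction rule: tensor_rel.induct)
  case (perm xs ys)
  then show ?case using formal_mset by blast
qed auto

lemma rel_refl: "xs \<in> formal \<Longrightarrow> (xs, xs) \<in> rel"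
  by (rule tensor_rel.perm) auto

lemma rel_equiv: "equiv formal rel"
proof (rule equivI)
  show "rel \<subseteq> formal \<times> formal" using rel_formal by auto
  show "refl_on formal rel" using rel_formal rel_refl by (auto simp: refl_on_def)
  show "sym rel" by (auto simp: sym_on_def intro: tensor_rel.sym)
  show "trans rel" by (auto simp: trans_on_def intro: tensor_rel.trans)
qed

lemma rel_append:
  assumes "(xs, xs') \<in> rel" "(ys, ys') \<in> rel"
  shows "(xs @ ys, xs' @ ys') \<in> rel"
proof -
  note f = rel_formal[OF assms(1)] rel_formal[OF assms(2)]
  have "(xs @ ys, xs' @ ys) \<in> rel" using assms f by (intro tensor_rel.append) auto
  moreover have "(xs' @ ys, ys @ xs') \<in> rel" using f by (intro tensor_rel.perm) auto
  moreover have "(ys @ xs', ys' @ xs') \<in> rel" using assms f by (intro tensor_rel.append) auto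
  moreover have "(ys' @ xs', xs' @ ys') \<in> rel" using f by (intro tensor_rel.perm) auto
  ultimately show ?thesis by (meson tensor_rel.trans)
qed

lemma cls_eq_iff: "xs \<in> formal \<Longrightarrow> ys \<in> formal \<Longrightarrow> cls xs = cls ys \<longleftrightarrow> (xs, ys) \<in> rel"
  unfolding tensor_class_def by (rule eq_equiv_class_iff[OF rel_equiv])

lemma cls_memI: "xs \<in> formal \<Longrightarrow> xs \<in> cls xs"
  by (simp add: tensor_class_def rel_refl)

lemma cls_memD: "ys \<in> cls xs \<Longrightarrow> (xs, ys) \<in> rel"
  by (simp add: tensor_class_def)

lemma cls_carrier [simp]: "xs \<in> formal \<Longrightarrow> cls xs \<in> carrier T"
  by (auto simp: tensor_def tensor_class_def intro: quotientI)

lemma carrierE: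
  assumes "U \<in> carrier T"
  obtains xs where "xs \<in> formal" "U = cls xs"
  using assms by (auto simp: tensor_def tensor_class_def elim!: quotientE)

lemma cls_perm: "xs \<in> formal \<Longrightarrow> mset xs = mset ys \<Longrightarrow> cls xs = cls ys"
  by (metis cls_eq_iff formal_mset tensor_rel.perm)

lemma T_zero: "\<zero>\<^bsub>T\<^esub> = cls []"
  and T_one: "\<one>\<^bsub>T\<^esub> = pure \<one>\<^bsub>A\<^esub> \<one>\<^bsub>B\<^esub>"
  by (simp_all add: tensor_def)

lemma T_add:
  assumes "xs \<in> formal" "ys \<in> formal"
  shows "cls xs \<oplus>\<^bsub>T\<^esub> cls ys = cls (xs @ ys)"
proof -
  have "cls (us @ vs) = cls (xs @ ys)" if "us \<in> cls xs" "vs \<in> cls ys" for us vs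
  proof -
    have "(xs @ ys, us @ vs) \<in> rel"
      using that by (intro rel_append cls_memD)
    then show ?thesis by (metis cls_eq_iff rel_formal)
  qed
  then have "(\<Union>us\<in>cls xs. \<Union>vs\<in>cls ys. cls (us @ vs)) = cls (xs @ ys)"
    using cls_memI[OF assms(1)] cls_memI[OF assms(2)] by blast
  then show ?thesis by (simp add: tensor_def)
qed

lemma pure_add_left: "a \<in> carrier A \<Longrightarrow> a' \<in> carrier A \<Longrightarrow> b \<in> carrier B \<Longrightarrow>
    pure (a \<oplus>\<^bsub>A\<^esub> a') b = pure a b \<oplus>\<^bsub>T\<^esub> pure a' b"
  by (simp add: T_add cls_eq_iff tensor_rel.add_left)

lemma pure_add_right: "a \<in> carrier A \<Longrightarrow> b \<in> carrier B \<Longrightarrow> b' \<in> carrier B \<Longrightarrow>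
    pure a (b \<oplus>\<^bsub>B\<^esub> b') = pure a b \<oplus>\<^bsub>T\<^esub> pure a b'"
  by (simp add: T_add cls_eq_iff tensor_rel.add_right)

lemma pure_scalar: "c \<in> carrier K \<Longrightarrow> a \<in> carrier A \<Longrightarrow> b \<in> carrier B \<Longrightarrow>
    pure (c \<odot>\<^bsub>A\<^esub> a) b = pure a (c \<odot>\<^bsub>B\<^esub> b)"
  by (simp add: cls_eq_iff tensor_rel.scalar)

lemma pure_zero_left: "b \<in> carrier B \<Longrightarrow> pure \<zero>\<^bsub>A\<^esub> b = \<zero>\<^bsub>T\<^esub>"
  by (simp add: T_zero cls_eq_iff tensor_rel.zero)

text \<open>
  Formal sums carry no coefficients; the identity \<open>-(a \<otimes> b) = (-a) \<otimes> b\<close> supplies negatives.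
\<close>

lemma T_neg: "xs \<in> formal \<Longrightarrow> cls (map (\<lambda>(a, b). (\<ominus>\<^bsub>A\<^esub> a, b)) xs @ xs) = cls []"
proof (induction xs)
  case (Cons p xs)
  obtain a b where p: "p = (a, b)" by (cases p)
  let ?n = "map (\<lambda>(a, b). (\<ominus>\<^bsub>A\<^esub> a, b))"
  from Cons.prems p have f: "a \<in> carrier A" "b \<in> carrier B" "xs \<in> formal" by auto
  then have n: "?n xs \<in> formal" by (intro formal_map) auto
  have "cls (?n (p # xs) @ p # xs) = cls ([(\<ominus>\<^bsub>A\<^esub> a, b), (a, b)] @ (?n xs @ xs))"
    using f n by (intro cls_perm) (auto simp: p)
  also have "\<dots> = cls [(\<ominus>\<^bsub>A\<^esub> a, b), (a, b)] \<oplus>\<^bsub>T\<^esub> cls (?n xs @ xs)"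
    using f n by (subst T_add) auto
  also have "cls [(\<ominus>\<^bsub>A\<^esub> a, b), (a, b)] = pure (\<ominus>\<^bsub>A\<^esub> a \<oplus>\<^bsub>A\<^esub> a) b"
    using f by (subst pure_add_left) (auto simp: T_add)
  also have "\<dots> = cls []"
    using f by (simp add: A.M.l_neg pure_zero_left T_zero)
  also have "cls (?n xs @ xs) = cls []" using Cons f by simp
  finally show ?case by (simp add: T_add)
qed simp

lemma T_abelian_group: "abelian_group T"
proof (rule abelian_groupI)
  fix x y z assume "x \<in> carrier T" "y \<in> carrier T"
  then obtain xs ys where xy: "xs \<in> formal" "x = cls xs" "ys \<in> formal" "y = cls ys"
    by (metis carrierE)
  then show "x \<oplus>\<^bsub>T\<^esub> y \<in> carrier T" by (simp add: T_add)
  show "x \<oplus>\<^bsub>T\<^esub> y = y \<oplus>\<^bsub>T\<^esub> x" using xy cls_perm[of "xs @ ys" "ys @ xs"] by (simp add: T_add)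
  assume "z \<in> carrier T"
  then obtain zs where "zs \<in> formal" "z = cls zs" by (metis carrierE)
  with xy show "x \<oplus>\<^bsub>T\<^esub> y \<oplus>\<^bsub>T\<^esub> z = x \<oplus>\<^bsub>T\<^esub> (y \<oplus>\<^bsub>T\<^esub> z)" by (simp add: T_add)
next
  show "\<zero>\<^bsub>T\<^esub> \<in> carrier T" by (simp add: T_zero)
  fix x assume "x \<in> carrier T"
  then obtain xs where x: "xs \<in> formal" "x = cls xs" by (metis carrierE)
  then show "\<zero>\<^bsub>T\<^esub> \<oplus>\<^bsub>T\<^esub> x = x" by (simp add: T_zero T_add)
  let ?n = "map (\<lambda>(a, b). (\<ominus>\<^bsub>A\<^esub> a, b)) xs"
  have n: "?n \<in> formal" using x by (intro formal_map) auto
  with x have "cls ?n \<oplus>\<^bsub>T\<^esub> x = \<zero>\<^bsub>T\<^esub>" by (simp add: T_zero T_add T_neg)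
  then show "\<exists>y\<in>carrier T. y \<oplus>\<^bsub>T\<^esub> x = \<zero>\<^bsub>T\<^esub>" using n by (intro bexI[of _ "cls ?n"]) auto
qed

text \<open>
  This is the universal property of the tensor product as an abelian group: everything that is
  defined below on a tensor product by a formula on pure tensors is well defined by it.
\<close>

lemma rel_bilinear_sum:
  assumes R: "abelian_group R" and \<phi>: "balanced R \<phi>" and "(xs, ys) \<in> rel"
  shows "bilinear_sum R \<phi> xs = bilinear_sum R \<phi> ys"
proof -
  interpret R: abelian_group R by fact
  have cl: "\<phi> a b \<in> carrier R" if "(a, b) \<in> set xs" "xs \<in> formal" for xs a b
    using \<phi> formalD[OF that(2,1)] unfolding balanced_def by blast
  show ?thesis using assms(3)
  proof (induction rule: tensor_rel.induct)
    case (perm xs ys)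
    then show ?case using cl by (intro R.bilinear_sum_perm) auto
  next
    case (append xs ys zs)
    then have "xs \<in> formal" "ys \<in> formal" using rel_formal by auto
    then have "bilinear_sum R \<phi> (us @ zs) = bilinear_sum R \<phi> us \<oplus>\<^bsub>R\<^esub> bilinear_sum R \<phi> zs"
      if "us \<in> formal" for us
      using append(2) cl that by (intro R.bilinear_sum_append) auto
    with append show ?case using \<open>xs \<in> formal\<close> \<open>ys \<in> formal\<close> by simp
  next
    case (zero b)
    have "\<phi> \<zero>\<^bsub>A\<^esub> b = \<zero>\<^bsub>R\<^esub>"
      by (rule additive_zero[of A R "\<lambda>a. \<phi> a b"])
        (use \<phi> zero R in \<open>auto simp: balanced_def A.M.abelian_group_axioms\<close>)
    then show ?case by simp
  next
    case (add_left a a' b)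
    then have "\<phi> a b \<in> carrier R" "\<phi> a' b \<in> carrier R" "\<phi> (a \<oplus>\<^bsub>A\<^esub> a') b = \<phi> a b \<oplus>\<^bsub>R\<^esub> \<phi> a' b"
      using \<phi> unfolding balanced_def by blast+
    then show ?case by (simp add: R.a_assoc)
  next
    case (add_right a b b')
    then have "\<phi> a b \<in> carrier R" "\<phi> a b' \<in> carrier R" "\<phi> a (b \<oplus>\<^bsub>B\<^esub> b') = \<phi> a b \<oplus>\<^bsub>R\<^esub> \<phi> a b'"
      using \<phi> unfolding balanced_def by blast+
    then show ?case by (simp add: R.a_assoc)
  next
    case (scalar c a b)
    then have "\<phi> (c \<odot>\<^bsub>A\<^esub> a) b = \<phi> a (c \<odot>\<^bsub>B\<^esub> b)"
      using \<phi> unfolding balanced_def by blast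
    then show ?case by simp
  qed simp_all
qed

lemma cls_eq_bilinear_sum: "xs \<in> formal \<Longrightarrow> cls xs = bilinear_sum T pure xs"
proof (induction xs)
  case (Cons p xs)
  obtain a b where p: "p = (a, b)" by (cases p)
  with Cons.prems have "cls (p # xs) = pure a b \<oplus>\<^bsub>T\<^esub> cls xs"
    by (simp add: T_add)
  then show ?case using Cons p by simp
qed (simp add: T_zero)

end

definition formal_mult ::
  "('k, 'a) module \<Rightarrow> ('k, 'b) module \<Rightarrow> ('a \<times> 'b) list \<Rightarrow> ('a \<times> 'b) list \<Rightarrow> ('a \<times> 'b) list"
  where "formal_mult A B xs ys = [(a \<otimes>\<^bsub>A\<^esub> a', b \<otimes>\<^bsub>B\<^esub> b'). (a, b) \<leftarrow> xs, (a', b') \<leftarrow> ys]"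

lemma formal_mult_simps [simp]:
  "formal_mult A B [] ys = []"
  "formal_mult A B ((a, b) # xs) ys = map (\<lambda>(a', b'). (a \<otimes>\<^bsub>A\<^esub> a', b \<otimes>\<^bsub>B\<^esub> b')) ys @ formal_mult A B xs ys"
  "formal_mult A B (xs @ xs') ys = formal_mult A B xs ys @ formal_mult A B xs' ys"
  by (simp_all add: formal_mult_def)

context tensor_pair
begin

abbreviation fm where "fm \<equiv> formal_mult A B"

interpretation T: abelian_group T by (rule T_abelian_group)

lemma formal_map_mult [simp]:
  "a \<in> carrier A \<Longrightarrow> b \<in> carrier B \<Longrightarrow> ys \<in> formal \<Longrightarrow> map (\<lambda>(a', b'). (a \<otimes>\<^bsub>A\<^esub> a', b \<otimes>\<^bsub>B\<^esub> b')) ys \<in> formal"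
  by (intro formal_map) auto

lemma formal_map_smult [simp]:
  "c \<in> carrier K \<Longrightarrow> ys \<in> formal \<Longrightarrow> map (\<lambda>(a, b). (c \<odot>\<^bsub>A\<^esub> a, b)) ys \<in> formal"
  by (intro formal_map) auto

lemma fm_formal [simp]: "xs \<in> formal \<Longrightarrow> ys \<in> formal \<Longrightarrow> fm xs ys \<in> formal"
proof (induction xs)
  case (Cons p xs)
  then show ?case by (cases p) auto
qed simp

lemma fm_map:
  assumes "xs \<in> formal" "ys \<in> formal" "a \<in> carrier A" "b \<in> carrier B"
  shows "fm (map (\<lambda>(a', b'). (a \<otimes>\<^bsub>A\<^esub> a', b \<otimes>\<^bsub>B\<^esub> b')) xs) ys = map (\<lambda>(a', b'). (a \<otimes>\<^bsub>A\<^esub> a', b \<otimes>\<^bsub>B\<^esub> b')) (fm xs ys)"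
  using assms
proof (induction xs)
  case (Cons p xs)
  obtain a' b' where p: "p = (a', b')" by (cases p)
  have "map (\<lambda>(x, y). (a \<otimes>\<^bsub>A\<^esub> a' \<otimes>\<^bsub>A\<^esub> x, b \<otimes>\<^bsub>B\<^esub> b' \<otimes>\<^bsub>B\<^esub> y)) ys
    = map (\<lambda>(x, y). (a \<otimes>\<^bsub>A\<^esub> (a' \<otimes>\<^bsub>A\<^esub> x), b \<otimes>\<^bsub>B\<^esub> (b' \<otimes>\<^bsub>B\<^esub> y))) ys"
    using Cons.prems p by (auto simp: A.m_assoc B.m_assoc dest: formalD)
  then show ?case using Cons p by (simp add: comp_def case_prod_unfold)
qed simp

lemma fm_assoc:
  assumes "xs \<in> formal" "ys \<in> formal" "zs \<in> formal"
  shows "fm (fm xs ys) zs = fm xs (fm ys zs)"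
  using assms
proof (induction xs)
  case (Cons p xs)
  then show ?case by (cases p) (simp add: fm_map)
qed simp

lemma cls_fm_left:
  assumes "xs \<in> formal" "ys \<in> formal"
  shows "cls (fm xs ys) = bilinear_sum T (\<lambda>a b. cls (fm [(a, b)] ys)) xs"
  using assms
proof (induction xs)
  case (Cons p xs)
  obtain a b where p: "p = (a, b)" by (cases p)
  with Cons.prems have f: "a \<in> carrier A" "b \<in> carrier B" "xs \<in> formal" by auto
  then have IH: "cls (fm xs ys) = bilinear_sum T (\<lambda>a b. cls (fm [(a, b)] ys)) xs"
    using Cons by blast
  show ?case unfolding p bilinear_sum_simps IH[symmetric]
    using f Cons.prems by (simp add: T_add)
qed (simp add: T_zero)

lemma cls_fm_single:
  assumes "a \<in> carrier A" "b \<in> carrier B" "ys \<in> formal"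
  shows "cls (fm [(a, b)] ys) = bilinear_sum T (\<lambda>a' b'. pure (a \<otimes>\<^bsub>A\<^esub> a') (b \<otimes>\<^bsub>B\<^esub> b')) ys"
  using assms by (simp add: cls_eq_bilinear_sum bilinear_sum_map)

lemma bilinear_sum_pure_mult_add:
  assumes ys: "ys \<in> formal" and F: "\<And>a' b'. a' \<in> carrier A \<Longrightarrow> b' \<in> carrier B \<Longrightarrow> F a' b' = G a' b' \<oplus>\<^bsub>T\<^esub> H a' b'"
    and G: "\<And>a' b'. a' \<in> carrier A \<Longrightarrow> b' \<in> carrier B \<Longrightarrow> G a' b' \<in> carrier T"
    and H: "\<And>a' b'. a' \<in> carrier A \<Longrightarrow> b' \<in> carrier B \<Longrightarrow> H a' b' \<in> carrier T"
  shows "bilinear_sum T F ys = bilinear_sum T G ys \<oplus>\<^bsub>T\<^esub> bilinear_sum T H ys"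
proof -
  have "bilinear_sum T F ys = bilinear_sum T (\<lambda>a b. G a b \<oplus>\<^bsub>T\<^esub> H a b) ys"
    using ys F by (intro bilinear_sum_cong) (auto dest: formalD)
  also have "\<dots> = bilinear_sum T G ys \<oplus>\<^bsub>T\<^esub> bilinear_sum T H ys"
    using ys G H by (intro T.bilinear_sum_add) (auto dest: formalD)
  finally show ?thesis .
qed

text \<open>
  The product of formal sums is compatible with the tensor relation in its left argument, because it
  is a bilinear sum of a balanced map there.  Commutativity up to the relation then settles the
  right argument, and the multiplication of classes is well defined.
\<close>

lemma balanced_fm:
  assumes ys: "ys \<in> formal"
  shows "balanced T (\<lambda>a b. cls (fm [(a, b)] ys))"
  unfolding balanced_def
proof (intro conjI ballI)
  fix a b assume ab: "a \<in> carrier A" "b \<in> carrier B"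
  then show "cls (fm [(a, b)] ys) \<in> carrier T" using ys by simp
  fix a' assume a': "a' \<in> carrier A"
  show "cls (fm [(a \<oplus>\<^bsub>A\<^esub> a', b)] ys) = cls (fm [(a, b)] ys) \<oplus>\<^bsub>T\<^esub> cls (fm [(a', b)] ys)"
    unfolding cls_fm_single[OF A.M.a_closed[OF ab(1) a'] ab(2) ys] cls_fm_single[OF ab ys] cls_fm_single[OF a' ab(2) ys]
    using ab a' ys by (intro bilinear_sum_pure_mult_add) (auto simp: A.l_distr pure_add_left)
next
  fix a b assume ab: "a \<in> carrier A" "b \<in> carrier B"
  fix b' assume b': "b' \<in> carrier B"
  show "cls (fm [(a, b \<oplus>\<^bsub>B\<^esub> b')] ys) = cls (fm [(a, b)] ys) \<oplus>\<^bsub>T\<^esub> cls (fm [(a, b')] ys)"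
    unfolding cls_fm_single[OF ab(1) B.M.a_closed[OF ab(2) b'] ys] cls_fm_single[OF ab ys] cls_fm_single[OF ab(1) b' ys]
    using ab b' ys by (intro bilinear_sum_pure_mult_add) (auto simp: B.l_distr pure_add_right)
next
  fix c a b assume c: "c \<in> carrier K" and ab: "a \<in> carrier A" "b \<in> carrier B"
  show "cls (fm [(c \<odot>\<^bsub>A\<^esub> a, b)] ys) = cls (fm [(a, c \<odot>\<^bsub>B\<^esub> b)] ys)"
    unfolding cls_fm_single[OF A.smult_closed[OF c ab(1)] ab(2) ys] cls_fm_single[OF ab(1) B.smult_closed[OF c ab(2)] ys]
    using c ab ys by (intro bilinear_sum_cong) (auto simp: A.smult_assoc2 B.smult_assoc2 pure_scalar dest: formalD)
qed

lemma cls_fm_cong_left: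
  assumes "(xs, xs') \<in> rel" "ys \<in> formal"
  shows "cls (fm xs ys) = cls (fm xs' ys)"
proof -
  have "xs \<in> formal" "xs' \<in> formal" using rel_formal assms by auto
  then show ?thesis
    using rel_bilinear_sum[OF T_abelian_group balanced_fm[OF assms(2)] assms(1)] assms(2)
    by (simp add: cls_fm_left)
qed

lemma cls_fm_single_right:
  assumes "xs \<in> formal" "a \<in> carrier A" "b \<in> carrier B"
  shows "cls (fm xs [(a, b)]) = cls (fm [(a, b)] xs)"
proof -
  have "fm xs [(a, b)] = fm [(a, b)] xs"
    using assms
  proof (induction xs)
    case (Cons p xs)
    then show ?case by (cases p) (auto simp: A.m_comm B.m_comm)
  qed simp
  then show ?thesis by simp
qed

lemma cls_fm_append_right:
  assumes "xs \<in> formal" "ys \<in> formal" "zs \<in> formal"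
  shows "cls (fm xs (ys @ zs)) = cls (fm xs ys) \<oplus>\<^bsub>T\<^esub> cls (fm xs zs)"
  using assms
proof (induction xs)
  case (Cons p xs)
  obtain a b where p: "p = (a, b)" by (cases p)
  let ?m = "map (\<lambda>(a', b'). (a \<otimes>\<^bsub>A\<^esub> a', b \<otimes>\<^bsub>B\<^esub> b'))"
  have f: "?m ys \<in> formal" "?m zs \<in> formal" "fm xs ys \<in> formal" "fm xs zs \<in> formal" "fm xs (ys @ zs) \<in> formal"
    using Cons.prems p by auto
  have "cls (fm (p # xs) (ys @ zs)) = cls (?m ys) \<oplus>\<^bsub>T\<^esub> cls (?m zs) \<oplus>\<^bsub>T\<^esub> (cls (fm xs ys) \<oplus>\<^bsub>T\<^esub> cls (fm xs zs))"
    using Cons f p by (simp add: T_add del: T_add[symmetric] flip: append_assoc) (simp add: T_add[symmetric])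
  also have "\<dots> = (cls (?m ys) \<oplus>\<^bsub>T\<^esub> cls (fm xs ys)) \<oplus>\<^bsub>T\<^esub> (cls (?m zs) \<oplus>\<^bsub>T\<^esub> cls (fm xs zs))"
    using f by (simp add: T.a_ac)
  also have "\<dots> = cls (fm (p # xs) ys) \<oplus>\<^bsub>T\<^esub> cls (fm (p # xs) zs)"
    using f p by (simp add: T_add)
  finally show ?case .
qed (simp add: T_zero[symmetric])

lemma cls_fm_comm:
  assumes "xs \<in> formal" "ys \<in> formal"
  shows "cls (fm xs ys) = cls (fm ys xs)"
  using assms
proof (induction xs)
  case Nil
  then show ?case by (induction ys) auto
next
  case (Cons p xs)
  obtain a b where p: "p = (a, b)" by (cases p)
  with Cons.prems have f: "a \<in> carrier A" "b \<in> carrier B" "xs \<in> formal" by auto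
  have "cls (fm (p # xs) ys) = cls (fm [(a, b)] ys) \<oplus>\<^bsub>T\<^esub> cls (fm xs ys)"
    using f Cons.prems p by (simp add: T_add)
  also have "\<dots> = cls (fm ys [(a, b)]) \<oplus>\<^bsub>T\<^esub> cls (fm ys xs)"
    using f Cons by (simp only: cls_fm_single_right)
  also have "\<dots> = cls (fm ys ([(a, b)] @ xs))"
    using f Cons.prems by (intro cls_fm_append_right[symmetric]) auto
  finally show ?case using p by simp
qed

lemma T_mult:
  assumes "xs \<in> formal" "ys \<in> formal"
  shows "cls xs \<otimes>\<^bsub>T\<^esub> cls ys = cls (fm xs ys)"
proof -
  have "cls (fm us vs) = cls (fm xs ys)" if "us \<in> cls xs" "vs \<in> cls ys" for us vs
    using cls_memD[OF that(1)] cls_memD[OF that(2)] assms rel_formal cls_fm_cong_left cls_fm_comm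
    by metis
  then have "(\<Union>us\<in>cls xs. \<Union>vs\<in>cls ys. cls (fm us vs)) = cls (fm xs ys)"
    using cls_memI[OF assms(1)] cls_memI[OF assms(2)] by blast
  then show ?thesis by (simp add: tensor_def formal_mult_def)
qed

lemma T_smult:
  assumes c: "c \<in> carrier K" and xs: "xs \<in> formal"
  shows "c \<odot>\<^bsub>T\<^esub> cls xs = cls (map (\<lambda>(a, b). (c \<odot>\<^bsub>A\<^esub> a, b)) xs)"
proof -
  let ?m = "map (\<lambda>(a, b). (c \<odot>\<^bsub>A\<^esub> a, b))"
  have b: "balanced T (\<lambda>a b. pure (c \<odot>\<^bsub>A\<^esub> a) b)"
    using c by (simp add: balanced_def A.smult_r_distr pure_add_left pure_add_right
        pure_scalar[symmetric] A.smult_assoc1[symmetric] A.R.m_comm)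
  have *: "cls (?m us) = bilinear_sum T (\<lambda>a b. pure (c \<odot>\<^bsub>A\<^esub> a) b) us" if "us \<in> formal" for us
    using that c by (simp add: cls_eq_bilinear_sum bilinear_sum_map)
  have "cls (?m us) = cls (?m xs)" if "us \<in> cls xs" for us
    using * rel_bilinear_sum[OF T_abelian_group b cls_memD[OF that]] rel_formal[OF cls_memD[OF that]] by simp
  then have "(\<Union>us\<in>cls xs. cls (?m us)) = cls (?m xs)"
    using cls_memI[OF xs] by blast
  then show ?thesis by (simp add: tensor_def)
qed

lemma T_smult_sum:
  assumes "c \<in> carrier K" "xs \<in> formal"
  shows "c \<odot>\<^bsub>T\<^esub> cls xs = bilinear_sum T (\<lambda>a b. pure (c \<odot>\<^bsub>A\<^esub> a) b) xs"
  using assms by (simp add: T_smult) (simp add: cls_eq_bilinear_sum bilinear_sum_map)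

lemma T_cring: "cring T"
proof (rule cringI)
  show "abelian_group T" by (rule T_abelian_group)
  show "comm_monoid T"
  proof (rule comm_monoidI)
    fix x y z assume "x \<in> carrier T" "y \<in> carrier T"
    then obtain xs ys where xy: "xs \<in> formal" "x = cls xs" "ys \<in> formal" "y = cls ys"
      by (metis carrierE)
    then show "x \<otimes>\<^bsub>T\<^esub> y \<in> carrier T" by (simp add: T_mult)
    show "x \<otimes>\<^bsub>T\<^esub> y = y \<otimes>\<^bsub>T\<^esub> x" using xy by (simp add: T_mult cls_fm_comm)
    assume "z \<in> carrier T"
    then obtain zs where "zs \<in> formal" "z = cls zs" by (metis carrierE)
    with xy show "x \<otimes>\<^bsub>T\<^esub> y \<otimes>\<^bsub>T\<^esub> z = x \<otimes>\<^bsub>T\<^esub> (y \<otimes>\<^bsub>T\<^esub> z)" by (simp add: T_mult fm_assoc)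
  next
    show "\<one>\<^bsub>T\<^esub> \<in> carrier T" by (simp add: T_one)
    fix x assume "x \<in> carrier T"
    then obtain xs where xs: "xs \<in> formal" "x = cls xs" by (metis carrierE)
    have "map (\<lambda>(a, b). (\<one>\<^bsub>A\<^esub> \<otimes>\<^bsub>A\<^esub> a, \<one>\<^bsub>B\<^esub> \<otimes>\<^bsub>B\<^esub> b)) xs = xs"
      using xs formalD by (intro map_idI) auto
    then show "\<one>\<^bsub>T\<^esub> \<otimes>\<^bsub>T\<^esub> x = x" using xs by (simp add: T_one T_mult)
  qed
  fix x y z assume "x \<in> carrier T" "y \<in> carrier T" "z \<in> carrier T"
  then obtain xs ys zs where "xs \<in> formal" "x = cls xs" "ys \<in> formal" "y = cls ys" "zs \<in> formal" "z = cls zs"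
    by (metis carrierE)
  then show "(x \<oplus>\<^bsub>T\<^esub> y) \<otimes>\<^bsub>T\<^esub> z = x \<otimes>\<^bsub>T\<^esub> z \<oplus>\<^bsub>T\<^esub> y \<otimes>\<^bsub>T\<^esub> z"
    by (simp add: T_mult T_add)
qed

lemma T_algebra: "algebra K T"
proof (rule algebraI)
  show "cring K" by (rule A.R.is_cring)
  show "cring T" by (rule T_cring)
next
  fix c d x assume c: "c \<in> carrier K" and "x \<in> carrier T"
  then obtain xs where xs: "xs \<in> formal" "x = cls xs" by (metis carrierE)
  show "c \<odot>\<^bsub>T\<^esub> x \<in> carrier T" using c xs by (simp add: T_smult)
  assume d: "d \<in> carrier K"
  have "bilinear_sum T (\<lambda>a b. pure ((c \<oplus>\<^bsub>K\<^esub> d) \<odot>\<^bsub>A\<^esub> a) b) xs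
    = bilinear_sum T (\<lambda>a b. pure (c \<odot>\<^bsub>A\<^esub> a) b) xs \<oplus>\<^bsub>T\<^esub> bilinear_sum T (\<lambda>a b. pure (d \<odot>\<^bsub>A\<^esub> a) b) xs"
    using c d xs by (intro bilinear_sum_pure_mult_add) (auto simp: A.smult_l_distr pure_add_left)
  then show "(c \<oplus>\<^bsub>K\<^esub> d) \<odot>\<^bsub>T\<^esub> x = c \<odot>\<^bsub>T\<^esub> x \<oplus>\<^bsub>T\<^esub> d \<odot>\<^bsub>T\<^esub> x"
    using c d xs by (simp add: T_smult_sum)
  have "map (\<lambda>(a, b). ((c \<otimes>\<^bsub>K\<^esub> d) \<odot>\<^bsub>A\<^esub> a, b)) xs = map (\<lambda>(a, b). (c \<odot>\<^bsub>A\<^esub> (d \<odot>\<^bsub>A\<^esub> a), b)) xs"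
    using c d xs by (auto simp: A.smult_assoc1 dest: formalD)
  then show "(c \<otimes>\<^bsub>K\<^esub> d) \<odot>\<^bsub>T\<^esub> x = c \<odot>\<^bsub>T\<^esub> (d \<odot>\<^bsub>T\<^esub> x)"
    using c d xs by (simp add: T_smult) (simp add: comp_def case_prod_unfold cong: map_cong)
next
  fix c x y assume c: "c \<in> carrier K" and "x \<in> carrier T" "y \<in> carrier T"
  then obtain xs ys where xy: "xs \<in> formal" "x = cls xs" "ys \<in> formal" "y = cls ys"
    by (metis carrierE)
  then show "c \<odot>\<^bsub>T\<^esub> (x \<oplus>\<^bsub>T\<^esub> y) = c \<odot>\<^bsub>T\<^esub> x \<oplus>\<^bsub>T\<^esub> c \<odot>\<^bsub>T\<^esub> y"
    using c by (simp add: T_smult T_add)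
  have "fm (map (\<lambda>(a, b). (c \<odot>\<^bsub>A\<^esub> a, b)) us) ys = map (\<lambda>(a, b). (c \<odot>\<^bsub>A\<^esub> a, b)) (fm us ys)" if "us \<in> formal" for us
    using that
  proof (induction us)
    case (Cons p us)
    obtain a b where p: "p = (a, b)" by (cases p)
    have "map (\<lambda>(x, y). ((c \<odot>\<^bsub>A\<^esub> a) \<otimes>\<^bsub>A\<^esub> x, b \<otimes>\<^bsub>B\<^esub> y)) ys = map (\<lambda>(x, y). (c \<odot>\<^bsub>A\<^esub> (a \<otimes>\<^bsub>A\<^esub> x), b \<otimes>\<^bsub>B\<^esub> y)) ys"
      using Cons.prems p c xy by (auto simp: A.smult_assoc2 dest: formalD)
    then show ?case using Cons p by (simp add: comp_def case_prod_unfold)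
  qed simp
  then show "(c \<odot>\<^bsub>T\<^esub> x) \<otimes>\<^bsub>T\<^esub> y = c \<odot>\<^bsub>T\<^esub> (x \<otimes>\<^bsub>T\<^esub> y)"
    using c xy by (simp add: T_smult T_mult)
next
  fix x assume "x \<in> carrier T"
  then obtain xs where xs: "xs \<in> formal" "x = cls xs" by (metis carrierE)
  have "map (\<lambda>(a, b). (\<one>\<^bsub>K\<^esub> \<odot>\<^bsub>A\<^esub> a, b)) xs = xs"
    using xs formalD by (intro map_idI) auto
  then show "\<one>\<^bsub>K\<^esub> \<odot>\<^bsub>T\<^esub> x = x" using xs by (simp add: T_smult)
qed

end

section \<open>Homomorphisms of algebras\<close>

lemma alg_homI:
  assumes "\<And>x. x \<in> carrier A \<Longrightarrow> h x \<in> carrier B"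
    and "\<And>x y. x \<in> carrier A \<Longrightarrow> y \<in> carrier A \<Longrightarrow> h (x \<oplus>\<^bsub>A\<^esub> y) = h x \<oplus>\<^bsub>B\<^esub> h y"
    and "\<And>x y. x \<in> carrier A \<Longrightarrow> y \<in> carrier A \<Longrightarrow> h (x \<otimes>\<^bsub>A\<^esub> y) = h x \<otimes>\<^bsub>B\<^esub> h y"
    and "h \<one>\<^bsub>A\<^esub> = \<one>\<^bsub>B\<^esub>"
    and "\<And>c x. c \<in> carrier K \<Longrightarrow> x \<in> carrier A \<Longrightarrow> h (c \<odot>\<^bsub>A\<^esub> x) = c \<odot>\<^bsub>B\<^esub> h x"
  shows "h \<in> alg_hom K A B"
  using assms by (auto simp: alg_hom_def intro: ring_hom_memI)

lemma
  assumes "h \<in> alg_hom K A B"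
  shows alg_hom_closed: "x \<in> carrier A \<Longrightarrow> h x \<in> carrier B"
    and alg_hom_add: "x \<in> carrier A \<Longrightarrow> y \<in> carrier A \<Longrightarrow> h (x \<oplus>\<^bsub>A\<^esub> y) = h x \<oplus>\<^bsub>B\<^esub> h y"
    and alg_hom_mult: "x \<in> carrier A \<Longrightarrow> y \<in> carrier A \<Longrightarrow> h (x \<otimes>\<^bsub>A\<^esub> y) = h x \<otimes>\<^bsub>B\<^esub> h y"
    and alg_hom_one: "h \<one>\<^bsub>A\<^esub> = \<one>\<^bsub>B\<^esub>"
    and alg_hom_smult: "c \<in> carrier K \<Longrightarrow> x \<in> carrier A \<Longrightarrow> h (c \<odot>\<^bsub>A\<^esub> x) = c \<odot>\<^bsub>B\<^esub> h x"
  using assms by (auto simp: alg_hom_def ring_hom_memE)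

lemma alg_hom_id: "(\<lambda>x. x) \<in> alg_hom K A A"
  by (rule alg_homI) auto

lemma alg_hom_comp:
  assumes "f \<in> alg_hom K A B" "g \<in> alg_hom K B C"
  shows "g \<circ> f \<in> alg_hom K A C"
  using assms by (intro alg_homI) (simp_all add: alg_hom_closed alg_hom_add alg_hom_mult alg_hom_one alg_hom_smult)

lemma alg_hom_comp':
  assumes "f \<in> alg_hom K A B" "g \<in> alg_hom K B C"
  shows "(\<lambda>x. g (f x)) \<in> alg_hom K A C"
  using alg_hom_comp[OF assms] by (simp add: comp_def)

lemma algebra_abelian_group: "algebra K A \<Longrightarrow> abelian_group A"
  by (simp add: algebra_def cring_def ring_def)

lemma algebra_cring: "algebra K A \<Longrightarrow> cring A"
  by (simp add: algebra_def)

lemma alg_hom_zero: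
  assumes "algebra K A" "algebra K B" "h \<in> alg_hom K A B"
  shows "h \<zero>\<^bsub>A\<^esub> = \<zero>\<^bsub>B\<^esub>"
  using additive_zero[OF algebra_abelian_group[OF assms(1)] algebra_abelian_group[OF assms(2)], of h] assms(3)
  by (simp add: alg_hom_closed alg_hom_add)

lemma alg_hom_bilinear_sum:
  assumes "algebra K A" "algebra K B" "h \<in> alg_hom K A B"
    and "\<And>a b. (a, b) \<in> set xs \<Longrightarrow> \<phi> a b \<in> carrier A"
  shows "h (bilinear_sum A \<phi> xs) = bilinear_sum B (\<lambda>a b. h (\<phi> a b)) xs"
  by (rule additive_bilinear_sum[OF algebra_abelian_group[OF assms(1)] algebra_abelian_group[OF assms(2)]])
    (use assms in \<open>auto simp: alg_hom_closed alg_hom_add\<close>)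

lemma ring_hom_pow:
  assumes "cring R" "cring S" "h \<in> ring_hom R S" "x \<in> carrier R"
  shows "h (x [^]\<^bsub>R\<^esub> (n::nat)) = h x [^]\<^bsub>S\<^esub> n"
proof -
  interpret h: ring_hom_cring R S h
    using assms by (auto simp: ring_hom_cring_def ring_hom_cring_axioms_def)
  show ?thesis using assms(4) by simp
qed

lemma alg_hom_pow:
  assumes "algebra K A" "algebra K B" "h \<in> alg_hom K A B" "x \<in> carrier A"
  shows "h (x [^]\<^bsub>A\<^esub> (n::nat)) = h x [^]\<^bsub>B\<^esub> n"
  using ring_hom_pow[OF algebra_cring[OF assms(1)] algebra_cring[OF assms(2)]] assms(3,4)
  by (auto simp: alg_hom_def)

context tensor_pair
begin

interpretation T: algebra K T by (rule T_algebra)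

lemma pure_mult:
  "a \<in> carrier A \<Longrightarrow> b \<in> carrier B \<Longrightarrow> a' \<in> carrier A \<Longrightarrow> b' \<in> carrier B \<Longrightarrow>
    pure a b \<otimes>\<^bsub>T\<^esub> pure a' b' = pure (a \<otimes>\<^bsub>A\<^esub> a') (b \<otimes>\<^bsub>B\<^esub> b')"
  by (simp add: T_mult)

lemma pure_smult:
  "c \<in> carrier K \<Longrightarrow> a \<in> carrier A \<Longrightarrow> b \<in> carrier B \<Longrightarrow> c \<odot>\<^bsub>T\<^esub> pure a b = pure (c \<odot>\<^bsub>A\<^esub> a) b"
  by (simp add: T_smult)

lemma tensor_inl_hom: "tensor_inl K A B \<in> alg_hom K A T"
  unfolding tensor_inl_def
  by (rule alg_homI) (simp_all add: pure_add_left pure_mult pure_smult T_one)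

lemma tensor_inr_hom: "tensor_inr K A B \<in> alg_hom K B T"
  unfolding tensor_inr_def
  by (rule alg_homI) (simp_all add: pure_add_right pure_mult pure_smult pure_scalar T_one)

lemma inl_inr_pure:
  "a \<in> carrier A \<Longrightarrow> b \<in> carrier B \<Longrightarrow> tensor_inl K A B a \<otimes>\<^bsub>T\<^esub> tensor_inr K A B b = pure a b"
  by (simp add: tensor_inl_def tensor_inr_def pure_mult)

text \<open>
  The two factors generate the tensor product as an algebra.
\<close>

lemma tensor_hom_ext:
  assumes R: "algebra K R" and F: "F \<in> alg_hom K T R" and G: "G \<in> alg_hom K T R"
    and l: "\<And>a. a \<in> carrier A \<Longrightarrow> F (tensor_inl K A B a) = G (tensor_inl K A B a)"
    and r: "\<And>b. b \<in> carrier B \<Longrightarrow> F (tensor_inr K A B b) = G (tensor_inr K A B b)"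
    and x: "x \<in> carrier T"
  shows "F x = G x"
proof -
  obtain xs where xs: "xs \<in> formal" "x = cls xs" using x by (metis carrierE)
  have p: "F (pure a b) = G (pure a b)" if "a \<in> carrier A" "b \<in> carrier B" for a b
    using that l r unfolding inl_inr_pure[OF that, symmetric]
    by (simp add: alg_hom_mult[OF F] alg_hom_mult[OF G] alg_hom_closed[OF tensor_inl_hom] alg_hom_closed[OF tensor_inr_hom])
  have "H x = bilinear_sum R (\<lambda>a b. H (pure a b)) xs" if "H \<in> alg_hom K T R" for H
    unfolding xs(2) cls_eq_bilinear_sum[OF xs(1)]
    by (rule alg_hom_bilinear_sum[OF T_algebra R that]) (use xs formalD in auto)
  from this[OF F] this[OF G] show ?thesis
    using p xs bilinear_sum_cong[of xs "\<lambda>a b. F (pure a b)" "\<lambda>a b. G (pure a b)" R] formalD by auto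
qed

context
  fixes R :: "('k, 'r) module" and f g
  assumes R: "algebra K R" and f: "f \<in> alg_hom K A R" and g: "g \<in> alg_hom K B R"
begin

interpretation R: algebra K R by (rule R)

lemmas fg = alg_hom_closed[OF f] alg_hom_closed[OF g] alg_hom_add[OF f] alg_hom_add[OF g]
  alg_hom_mult[OF f] alg_hom_mult[OF g] alg_hom_one[OF f] alg_hom_one[OF g]
  alg_hom_smult[OF f] alg_hom_smult[OF g]

lemma R_smult_right: "c \<in> carrier K \<Longrightarrow> x \<in> carrier R \<Longrightarrow> y \<in> carrier R \<Longrightarrow> x \<otimes>\<^bsub>R\<^esub> (c \<odot>\<^bsub>R\<^esub> y) = c \<odot>\<^bsub>R\<^esub> (x \<otimes>\<^bsub>R\<^esub> y)"
  by (metis R.m_comm R.smult_assoc2 R.smult_closed)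

lemma balanced_hom_product: "balanced R (\<lambda>a b. f a \<otimes>\<^bsub>R\<^esub> g b)"
  by (simp add: balanced_def fg R.l_distr R.r_distr R.smult_assoc2 R_smult_right)

lemma tensor_lift_cls:
  assumes xs: "xs \<in> formal"
  shows "tensor_lift R f g (cls xs) = bilinear_sum R (\<lambda>a b. f a \<otimes>\<^bsub>R\<^esub> g b) xs"
proof -
  have "(xs, SOME us. us \<in> cls xs) \<in> rel"
    using cls_memI[OF xs] by (intro cls_memD someI)
  then show ?thesis
    using rel_bilinear_sum[OF R.M.abelian_group_axioms balanced_hom_product]
    by (simp add: tensor_lift_def flip: bilinear_sum_def)
qed

lemma lift_closed:
  assumes "xs \<in> formal"
  shows "bilinear_sum R (\<lambda>a b. f a \<otimes>\<^bsub>R\<^esub> g b) xs \<in> carrier R"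
  using assms formalD by (intro R.M.bilinear_sum_closed) (auto simp: fg)

lemma tensor_lift_pure:
  "a \<in> carrier A \<Longrightarrow> b \<in> carrier B \<Longrightarrow> tensor_lift R f g (pure a b) = f a \<otimes>\<^bsub>R\<^esub> g b"
  by (simp add: tensor_lift_cls fg)

lemma lift_append:
  assumes "xs \<in> formal" "ys \<in> formal"
  shows "bilinear_sum R (\<lambda>a b. f a \<otimes>\<^bsub>R\<^esub> g b) (xs @ ys)
    = bilinear_sum R (\<lambda>a b. f a \<otimes>\<^bsub>R\<^esub> g b) xs \<oplus>\<^bsub>R\<^esub> bilinear_sum R (\<lambda>a b. f a \<otimes>\<^bsub>R\<^esub> g b) ys"
  using assms formalD by (intro R.M.bilinear_sum_append) (auto simp: fg)

lemma lift_map_mult: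
  assumes "a \<in> carrier A" "b \<in> carrier B" "ys \<in> formal"
  shows "bilinear_sum R (\<lambda>a b. f a \<otimes>\<^bsub>R\<^esub> g b) (map (\<lambda>(a', b'). (a \<otimes>\<^bsub>A\<^esub> a', b \<otimes>\<^bsub>B\<^esub> b')) ys)
    = (f a \<otimes>\<^bsub>R\<^esub> g b) \<otimes>\<^bsub>R\<^esub> bilinear_sum R (\<lambda>a b. f a \<otimes>\<^bsub>R\<^esub> g b) ys"
  using assms
proof (induction ys)
  case (Cons p ys)
  obtain a' b' where p: "p = (a', b')" by (cases p)
  with Cons.prems have c: "f a \<in> carrier R" "g b \<in> carrier R" "f a' \<in> carrier R" "g b' \<in> carrier R"
    by (auto simp: fg)
  with Cons p show ?case
    by (simp add: fg R.r_distr lift_closed R.m_ac)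
qed (simp add: fg)

lemma tensor_lift_hom: "tensor_lift R f g \<in> alg_hom K T R"
proof (rule alg_homI)
  fix x y assume "x \<in> carrier T" "y \<in> carrier T"
  then obtain xs ys where xy: "xs \<in> formal" "x = cls xs" "ys \<in> formal" "y = cls ys"
    by (metis carrierE)
  then show "tensor_lift R f g x \<in> carrier R" by (simp add: tensor_lift_cls lift_closed)
  show "tensor_lift R f g (x \<oplus>\<^bsub>T\<^esub> y) = tensor_lift R f g x \<oplus>\<^bsub>R\<^esub> tensor_lift R f g y"
    using xy by (simp add: T_add tensor_lift_cls lift_append)
  have "bilinear_sum R (\<lambda>a b. f a \<otimes>\<^bsub>R\<^esub> g b) (fm us ys)
    = bilinear_sum R (\<lambda>a b. f a \<otimes>\<^bsub>R\<^esub> g b) us \<otimes>\<^bsub>R\<^esub> bilinear_sum R (\<lambda>a b. f a \<otimes>\<^bsub>R\<^esub> g b) ys"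
    if "us \<in> formal" for us
    using that
  proof (induction us)
    case Nil
    then show ?case using xy by (simp add: lift_closed)
  next
    case (Cons p us)
    obtain a b where p: "p = (a, b)" by (cases p)
    with Cons xy show ?case
      by (simp add: lift_append lift_map_mult R.l_distr lift_closed fg)
  qed
  then show "tensor_lift R f g (x \<otimes>\<^bsub>T\<^esub> y) = tensor_lift R f g x \<otimes>\<^bsub>R\<^esub> tensor_lift R f g y"
    using xy by (simp add: T_mult tensor_lift_cls)
next
  show "tensor_lift R f g \<one>\<^bsub>T\<^esub> = \<one>\<^bsub>R\<^esub>" by (simp add: T_one tensor_lift_pure fg)
next
  fix c x assume c: "c \<in> carrier K" and "x \<in> carrier T"
  then obtain xs where xs: "xs \<in> formal" "x = cls xs" by (metis carrierE)
  have "bilinear_sum R (\<lambda>a b. f a \<otimes>\<^bsub>R\<^esub> g b) (map (\<lambda>(a, b). (c \<odot>\<^bsub>A\<^esub> a, b)) us)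
      = c \<odot>\<^bsub>R\<^esub> bilinear_sum R (\<lambda>a b. f a \<otimes>\<^bsub>R\<^esub> g b) us" if "us \<in> formal" for us
    using that
  proof (induction us)
    case (Cons p us)
    obtain a b where p: "p = (a, b)" by (cases p)
    with Cons c show ?case
      by (simp add: fg R.smult_assoc2 R.smult_r_distr lift_closed)
  qed (use c in simp)
  then show "tensor_lift R f g (c \<odot>\<^bsub>T\<^esub> x) = c \<odot>\<^bsub>R\<^esub> tensor_lift R f g x"
    using c xs by (simp add: T_smult tensor_lift_cls)
qed

lemma tensor_lift_inl: "a \<in> carrier A \<Longrightarrow> tensor_lift R f g (tensor_inl K A B a) = f a"
  and tensor_lift_inr: "b \<in> carrier B \<Longrightarrow> tensor_lift R f g (tensor_inr K A B b) = g b"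
  by (simp_all add: tensor_inl_def tensor_inr_def tensor_lift_pure fg)

end
end

lemma tensor_algebra: "algebra K A \<Longrightarrow> algebra K B \<Longrightarrow> algebra K (tensor K A B)"
  by (simp add: tensor_pair.T_algebra tensor_pair.intro)

lemma
  assumes A: "algebra K A" and B: "algebra K B" and C: "algebra K C" and D: "algebra K D"
    and f: "f \<in> alg_hom K A C" and g: "g \<in> alg_hom K B D"
  shows tensor_map_hom: "tensor_map K C D f g \<in> alg_hom K (tensor K A B) (tensor K C D)"
    and tensor_map_inl: "a \<in> carrier A \<Longrightarrow>
      tensor_map K C D f g (tensor_inl K A B a) = tensor_inl K C D (f a)"
    and tensor_map_inr: "b \<in> carrier B \<Longrightarrow>
      tensor_map K C D f g (tensor_inr K A B b) = tensor_inr K C D (g b)"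
proof -
  interpret AB: tensor_pair K A B by (intro tensor_pair.intro A B)
  interpret CD: tensor_pair K C D by (intro tensor_pair.intro C D)
  note h = alg_hom_comp[OF f CD.tensor_inl_hom] alg_hom_comp[OF g CD.tensor_inr_hom]
  note l = AB.tensor_lift_hom[OF CD.T_algebra h] AB.tensor_lift_inl[OF CD.T_algebra h] AB.tensor_lift_inr[OF CD.T_algebra h]
  show "tensor_map K C D f g \<in> alg_hom K (tensor K A B) (tensor K C D)"
    and "a \<in> carrier A \<Longrightarrow> tensor_map K C D f g (tensor_inl K A B a) = tensor_inl K C D (f a)"
    and "b \<in> carrier B \<Longrightarrow> tensor_map K C D f g (tensor_inr K A B b) = tensor_inr K C D (g b)"
    unfolding tensor_map_def using l by auto
qed

section \<open>Linear forms and vanishing in a tensor product\<close>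

definition linear_forms :: "'k ring \<Rightarrow> ('k, 'a) module \<Rightarrow> ('a \<Rightarrow> 'k) set"
  where "linear_forms K V = {l. (\<forall>x\<in>carrier V. l x \<in> carrier K) \<and>
    (\<forall>x\<in>carrier V. \<forall>y\<in>carrier V. l (x \<oplus>\<^bsub>V\<^esub> y) = l x \<oplus>\<^bsub>K\<^esub> l y) \<and>
    (\<forall>c\<in>carrier K. \<forall>x\<in>carrier V. l (c \<odot>\<^bsub>V\<^esub> x) = c \<otimes>\<^bsub>K\<^esub> l x)}"

definition vector_subspace :: "'k ring \<Rightarrow> ('k, 'a) module \<Rightarrow> 'a set \<Rightarrow> bool"
  where "vector_subspace K V W \<longleftrightarrow> W \<subseteq> carrier V \<and> \<zero>\<^bsub>V\<^esub> \<in> W \<and>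
    (\<forall>x\<in>W. \<forall>y\<in>W. x \<oplus>\<^bsub>V\<^esub> y \<in> W) \<and> (\<forall>c\<in>carrier K. \<forall>x\<in>W. c \<odot>\<^bsub>V\<^esub> x \<in> W)"

text \<open>
  A subspace that contains \<open>W\<close> and is maximal among those missing \<open>v\<close> is a hyperplane complementary
  to the line through \<open>v\<close>.  The linear form sought is the coordinate along that line.
\<close>

lemma exists_separating_linear_form:
  assumes "field K" "module K V" and W: "vector_subspace K V W" and v: "v \<in> carrier V" "v \<notin> W"
  obtains l where "l \<in> linear_forms K V" "l v = \<one>\<^bsub>K\<^esub>" "\<And>w. w \<in> W \<Longrightarrow> l w = \<zero>\<^bsub>K\<^esub>"
proof -
  interpret K: field K by fact
  interpret V: module K V by fact
  define S where "S = {M. vector_subspace K V M \<and> W \<subseteq> M \<and> v \<notin> M}"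
  have "\<exists>M\<in>S. \<forall>Y\<in>S. M \<subseteq> Y \<longrightarrow> Y = M"
  proof (rule subset_Zorn_nonempty)
    show "S \<noteq> {}" using W v by (auto simp: S_def)
    fix C assume C: "C \<noteq> {}" "subset.chain S C"
    then have sub: "vector_subspace K V M" "W \<subseteq> M" "v \<notin> M" if "M \<in> C" for M
      using that by (auto simp: S_def subset.chain_def)
    have two: "\<exists>M\<in>C. x \<in> M \<and> y \<in> M" if "x \<in> \<Union>C" "y \<in> \<Union>C" for x y
      using that subset_chain_def[of S C] C(2) by (meson UnionE in_mono)
    have "x \<oplus>\<^bsub>V\<^esub> y \<in> \<Union>C" if "x \<in> \<Union>C" "y \<in> \<Union>C" for x y
      using two[OF that] sub unfolding vector_subspace_def by blast
    then have "vector_subspace K V (\<Union>C)"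
      unfolding vector_subspace_def
    proof (intro conjI ballI)
      obtain M where "M \<in> C" using C(1) by blast
      then show "\<zero>\<^bsub>V\<^esub> \<in> \<Union>C" using sub(1) unfolding vector_subspace_def by blast
      show "\<Union>C \<subseteq> carrier V" using sub(1) unfolding vector_subspace_def by blast
    next
      fix c x assume "c \<in> carrier K" "x \<in> \<Union>C"
      then show "c \<odot>\<^bsub>V\<^esub> x \<in> \<Union>C" using sub(1) unfolding vector_subspace_def by blast
    qed
    then show "\<Union>C \<in> S" using sub C(1) unfolding S_def by blast
  qed
  then obtain M where M: "vector_subspace K V M" "W \<subseteq> M" "v \<notin> M"
    and max: "\<And>Y. vector_subspace K V Y \<Longrightarrow> M \<subseteq> Y \<Longrightarrow> v \<notin> Y \<Longrightarrow> Y = M"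
    by (auto simp: S_def)
  have Mc: "x \<in> carrier V" if "x \<in> M" for x using M(1) that by (auto simp: vector_subspace_def)
  have M0: "\<zero>\<^bsub>V\<^esub> \<in> M" and Madd: "x \<in> M \<Longrightarrow> y \<in> M \<Longrightarrow> x \<oplus>\<^bsub>V\<^esub> y \<in> M"
    and Msm: "c \<in> carrier K \<Longrightarrow> x \<in> M \<Longrightarrow> c \<odot>\<^bsub>V\<^esub> x \<in> M" for x y c
    using M(1) by (auto simp: vector_subspace_def)
  have ex: "\<exists>c\<in>carrier K. \<exists>m\<in>M. u = m \<oplus>\<^bsub>V\<^esub> c \<odot>\<^bsub>V\<^esub> v" if u: "u \<in> carrier V" for u
  proof (cases "u \<in> M")
    case True
    then show ?thesis using v by (intro bexI[of _ "\<zero>\<^bsub>K\<^esub>"] bexI[of _ u]) (auto simp: u)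
  next
    case False
    let ?Y = "{m \<oplus>\<^bsub>V\<^esub> c \<odot>\<^bsub>V\<^esub> u | m c. m \<in> M \<and> c \<in> carrier K}"
    have inX: "m \<oplus>\<^bsub>V\<^esub> c \<odot>\<^bsub>V\<^esub> u \<in> ?Y" if "m \<in> M" "c \<in> carrier K" for m c using that by blast
    have "vector_subspace K V ?Y"
      unfolding vector_subspace_def
    proof (intro conjI ballI)
      show "?Y \<subseteq> carrier V" using u Mc by auto
      show "\<zero>\<^bsub>V\<^esub> \<in> ?Y" using inX[OF M0 K.zero_closed] u by simp
    next
      fix x y assume "x \<in> ?Y" "y \<in> ?Y"
      then obtain m c m' c' where x: "x = m \<oplus>\<^bsub>V\<^esub> c \<odot>\<^bsub>V\<^esub> u" "m \<in> M" "c \<in> carrier K"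
        and y: "y = m' \<oplus>\<^bsub>V\<^esub> c' \<odot>\<^bsub>V\<^esub> u" "m' \<in> M" "c' \<in> carrier K" by blast
      have "x \<oplus>\<^bsub>V\<^esub> y = (m \<oplus>\<^bsub>V\<^esub> m') \<oplus>\<^bsub>V\<^esub> (c \<oplus>\<^bsub>K\<^esub> c') \<odot>\<^bsub>V\<^esub> u"
        using x y u Mc by (simp add: V.smult_l_distr V.M.a_ac)
      then show "x \<oplus>\<^bsub>V\<^esub> y \<in> ?Y" using inX[of "m \<oplus>\<^bsub>V\<^esub> m'" "c \<oplus>\<^bsub>K\<^esub> c'"] Madd x y by simp
    next
      fix d x assume d: "d \<in> carrier K" and "x \<in> ?Y"
      then obtain m c where x: "x = m \<oplus>\<^bsub>V\<^esub> c \<odot>\<^bsub>V\<^esub> u" "m \<in> M" "c \<in> carrier K" by blast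
      have "d \<odot>\<^bsub>V\<^esub> x = d \<odot>\<^bsub>V\<^esub> m \<oplus>\<^bsub>V\<^esub> (d \<otimes>\<^bsub>K\<^esub> c) \<odot>\<^bsub>V\<^esub> u"
        using x d u Mc by (simp add: V.smult_r_distr V.smult_assoc1)
      then show "d \<odot>\<^bsub>V\<^esub> x \<in> ?Y" using inX[of "d \<odot>\<^bsub>V\<^esub> m" "d \<otimes>\<^bsub>K\<^esub> c"] Msm x d by simp
    qed
    moreover have "M \<subseteq> ?Y"
    proof
      fix m assume m: "m \<in> M"
      show "m \<in> ?Y" using inX[OF m K.zero_closed] u Mc[OF m] by simp
    qed
    moreover have "u \<in> ?Y" using inX[OF M0 K.one_closed] u by simp
    ultimately have "v \<in> ?Y" using max[of ?Y] False by blast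
    then obtain m c where mc: "v = m \<oplus>\<^bsub>V\<^esub> c \<odot>\<^bsub>V\<^esub> u" "m \<in> M" "c \<in> carrier K" by blast
    have "c \<noteq> \<zero>\<^bsub>K\<^esub>" using mc M(3) Mc u by auto
    then have i: "inv\<^bsub>K\<^esub> c \<in> carrier K" "inv\<^bsub>K\<^esub> c \<otimes>\<^bsub>K\<^esub> c = \<one>\<^bsub>K\<^esub>"
      using mc K.field_Units by auto
    have "inv\<^bsub>K\<^esub> c \<odot>\<^bsub>V\<^esub> v = inv\<^bsub>K\<^esub> c \<odot>\<^bsub>V\<^esub> m \<oplus>\<^bsub>V\<^esub> u"
      using i mc u Mc by (simp add: V.smult_r_distr flip: V.smult_assoc1)
    then have "u = (\<ominus>\<^bsub>K\<^esub> (inv\<^bsub>K\<^esub> c)) \<odot>\<^bsub>V\<^esub> m \<oplus>\<^bsub>V\<^esub> inv\<^bsub>K\<^esub> c \<odot>\<^bsub>V\<^esub> v"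
      using i mc u Mc by (simp add: V.smult_l_minus V.M.r_neg1)
    then show ?thesis using i Msm[of "\<ominus>\<^bsub>K\<^esub> (inv\<^bsub>K\<^esub> c)" m] mc by blast
  qed
  have uniq: "c = d"
    if "c \<in> carrier K" "d \<in> carrier K" "m \<in> M" "n \<in> M" "m \<oplus>\<^bsub>V\<^esub> c \<odot>\<^bsub>V\<^esub> v = n \<oplus>\<^bsub>V\<^esub> d \<odot>\<^bsub>V\<^esub> v" for c d m n
  proof (rule ccontr)
    assume "c \<noteq> d"
    then have "c \<ominus>\<^bsub>K\<^esub> d \<noteq> \<zero>\<^bsub>K\<^esub>" using that by simp
    then have i: "inv\<^bsub>K\<^esub> (c \<ominus>\<^bsub>K\<^esub> d) \<in> carrier K" "inv\<^bsub>K\<^esub> (c \<ominus>\<^bsub>K\<^esub> d) \<otimes>\<^bsub>K\<^esub> (c \<ominus>\<^bsub>K\<^esub> d) = \<one>\<^bsub>K\<^esub>"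
      using that K.field_Units by auto
    have cl: "c \<odot>\<^bsub>V\<^esub> v \<in> carrier V" "d \<odot>\<^bsub>V\<^esub> v \<in> carrier V" "m \<in> carrier V" "n \<in> carrier V"
      using that v Mc by auto
    have "(c \<ominus>\<^bsub>K\<^esub> d) \<odot>\<^bsub>V\<^esub> v = c \<odot>\<^bsub>V\<^esub> v \<ominus>\<^bsub>V\<^esub> d \<odot>\<^bsub>V\<^esub> v"
      using that v by (simp add: K.minus_eq V.M.minus_eq V.smult_l_distr V.smult_l_minus)
    also have "c \<odot>\<^bsub>V\<^esub> v = \<ominus>\<^bsub>V\<^esub> m \<oplus>\<^bsub>V\<^esub> (m \<oplus>\<^bsub>V\<^esub> c \<odot>\<^bsub>V\<^esub> v)"
      using cl by (simp add: V.M.r_neg1)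
    also have "\<dots> = (\<ominus>\<^bsub>V\<^esub> m \<oplus>\<^bsub>V\<^esub> n) \<oplus>\<^bsub>V\<^esub> d \<odot>\<^bsub>V\<^esub> v"
      using cl that(5) by (simp add: V.M.a_assoc)
    also have "\<dots> \<ominus>\<^bsub>V\<^esub> d \<odot>\<^bsub>V\<^esub> v = \<ominus>\<^bsub>V\<^esub> m \<oplus>\<^bsub>V\<^esub> n"
      using cl by (simp add: V.M.minus_eq V.M.a_assoc V.M.r_neg)
    also have "\<ominus>\<^bsub>V\<^esub> m = (\<ominus>\<^bsub>K\<^esub> \<one>\<^bsub>K\<^esub>) \<odot>\<^bsub>V\<^esub> m"
      using cl by (simp add: V.smult_l_minus)
    finally have "(c \<ominus>\<^bsub>K\<^esub> d) \<odot>\<^bsub>V\<^esub> v \<in> M"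
      using Madd Msm that by simp
    then have "inv\<^bsub>K\<^esub> (c \<ominus>\<^bsub>K\<^esub> d) \<odot>\<^bsub>V\<^esub> ((c \<ominus>\<^bsub>K\<^esub> d) \<odot>\<^bsub>V\<^esub> v) \<in> M" using Msm i by simp
    moreover have "inv\<^bsub>K\<^esub> (c \<ominus>\<^bsub>K\<^esub> d) \<odot>\<^bsub>V\<^esub> ((c \<ominus>\<^bsub>K\<^esub> d) \<odot>\<^bsub>V\<^esub> v) = v"
      using i that v by (simp flip: V.smult_assoc1)
    ultimately show False using M(3) by simp
  qed
  define l where "l u = (THE c. c \<in> carrier K \<and> (\<exists>m\<in>M. u = m \<oplus>\<^bsub>V\<^esub> c \<odot>\<^bsub>V\<^esub> v))" for u
  have l: "l (m \<oplus>\<^bsub>V\<^esub> c \<odot>\<^bsub>V\<^esub> v) = c" if "m \<in> M" "c \<in> carrier K" for m c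
    unfolding l_def using that uniq by (intro the_equality) (auto; blast)+
  have "l \<in> linear_forms K V"
    unfolding linear_forms_def
  proof (intro CollectI conjI ballI)
    fix x assume x: "x \<in> carrier V"
    obtain m c where x: "x = m \<oplus>\<^bsub>V\<^esub> c \<odot>\<^bsub>V\<^esub> v" "m \<in> M" "c \<in> carrier K" using ex[OF x] by blast
    then show "l x \<in> carrier K" by (simp add: l)
    {
      fix y assume y: "y \<in> carrier V"
      obtain n d where y: "y = n \<oplus>\<^bsub>V\<^esub> d \<odot>\<^bsub>V\<^esub> v" "n \<in> M" "d \<in> carrier K" using ex[OF y] by blast
      have "x \<oplus>\<^bsub>V\<^esub> y = (m \<oplus>\<^bsub>V\<^esub> n) \<oplus>\<^bsub>V\<^esub> (c \<oplus>\<^bsub>K\<^esub> d) \<odot>\<^bsub>V\<^esub> v"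
        using x y v Mc by (simp add: V.smult_l_distr V.M.a_ac)
      then show "l (x \<oplus>\<^bsub>V\<^esub> y) = l x \<oplus>\<^bsub>K\<^esub> l y" using x y by (simp add: l Madd)
    }
    fix d assume d: "d \<in> carrier K"
    have "d \<odot>\<^bsub>V\<^esub> x = d \<odot>\<^bsub>V\<^esub> m \<oplus>\<^bsub>V\<^esub> (d \<otimes>\<^bsub>K\<^esub> c) \<odot>\<^bsub>V\<^esub> v"
      using x d v Mc by (simp add: V.smult_r_distr V.smult_assoc1)
    then show "l (d \<odot>\<^bsub>V\<^esub> x) = d \<otimes>\<^bsub>K\<^esub> l x" using x d by (simp add: l Msm)
  qed
  moreover have "l v = \<one>\<^bsub>K\<^esub>" using l[OF M0 K.one_closed] v by simp
  moreover have "l w = \<zero>\<^bsub>K\<^esub>" if "w \<in> W" for w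
    using l[of w "\<zero>\<^bsub>K\<^esub>"] that M(2) Mc v by auto
  ultimately show thesis using that by blast
qed

text \<open>
  The map \<open>id \<otimes> l : A \<otimes> B \<rightarrow> A \<otimes> K = A\<close>.
\<close>

definition contraction :: "('k, 'a) module \<Rightarrow> ('b \<Rightarrow> 'k) \<Rightarrow> ('a \<times> 'b) list set \<Rightarrow> 'a"
  where "contraction A l U = bilinear_sum A (\<lambda>a b. l b \<odot>\<^bsub>A\<^esub> a) (SOME xs. xs \<in> U)"

context tensor_pair
begin

interpretation T: algebra K T by (rule T_algebra)

lemma balanced_contraction: "l \<in> linear_forms K B \<Longrightarrow> balanced A (\<lambda>a b. l b \<odot>\<^bsub>A\<^esub> a)"
  by (simp add: balanced_def linear_forms_def A.smult_r_distr A.smult_l_distr A.R.m_comm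
      flip: A.smult_assoc1)

lemma contraction_cls:
  assumes l: "l \<in> linear_forms K B" and xs: "xs \<in> formal"
  shows "contraction A l (cls xs) = bilinear_sum A (\<lambda>a b. l b \<odot>\<^bsub>A\<^esub> a) xs"
proof -
  have "(xs, SOME us. us \<in> cls xs) \<in> rel"
    using cls_memI[OF xs] by (intro cls_memD someI)
  then show ?thesis
    using rel_bilinear_sum[OF A.M.abelian_group_axioms balanced_contraction[OF l]]
    by (simp add: contraction_def)
qed

lemma contraction_closed:
  assumes "l \<in> linear_forms K B" "x \<in> carrier T"
  shows "contraction A l x \<in> carrier A"
proof -
  obtain xs where xs: "xs \<in> formal" "x = cls xs" using assms by (metis carrierE)
  then show ?thesis using assms
    by (auto simp: contraction_cls linear_forms_def dest: formalD intro!: A.M.bilinear_sum_closed)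
qed

lemma absorb_term:
  assumes "zs \<in> formal" "a \<in> carrier A" "b \<in> set (map snd zs)"
  obtains zs' where "zs' \<in> formal" "map snd zs' = map snd zs" "cls zs' = cls zs \<oplus>\<^bsub>T\<^esub> pure a b"
proof -
  obtain a' where "(a', b) \<in> set zs" using assms(3) by auto
  then obtain us vs where zs: "zs = us @ (a', b) # vs" by (meson split_list)
  with assms have f: "us \<in> formal" "vs \<in> formal" "a' \<in> carrier A" "b \<in> carrier B" by auto
  have app: "cls (us @ (c, b) # vs) = cls us \<oplus>\<^bsub>T\<^esub> (pure c b \<oplus>\<^bsub>T\<^esub> cls vs)" if "c \<in> carrier A" for c
    using f that by (simp add: T_add)
  have "cls (us @ (a' \<oplus>\<^bsub>A\<^esub> a, b) # vs) = cls zs \<oplus>\<^bsub>T\<^esub> pure a b"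
    using f assms(2) unfolding zs app[OF f(3)] app[OF A.M.a_closed[OF f(3) assms(2)]]
    by (simp add: pure_add_left T.M.a_ac)
  then show thesis using f assms(2) zs by (intro that[of "us @ (a' \<oplus>\<^bsub>A\<^esub> a, b) # vs"]) auto
qed

text \<open>
  Terms whose right components already occur in \<open>zs\<close> can be absorbed by changing the left
  components only.  Hence the right components of \<open>zs\<close> span a space of elements \<open>w\<close> for which all
  \<open>a \<otimes> w\<close> have representations no longer than \<open>zs\<close>.
\<close>

lemma absorb_terms:
  assumes "us \<in> formal" "zs \<in> formal" "set (map snd us) \<subseteq> set (map snd zs)"
  shows "\<exists>zs'\<in>formal. map snd zs' = map snd zs \<and> cls zs' = cls zs \<oplus>\<^bsub>T\<^esub> cls us"
  using assms
proof (induction us)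
  case Nil
  then show ?case by (intro bexI[of _ zs]) (auto simp: T_add)
next
  case (Cons p us)
  obtain a b where p: "p = (a, b)" by (cases p)
  from Cons p obtain ws where ws: "ws \<in> formal" "map snd ws = map snd zs" "cls ws = cls zs \<oplus>\<^bsub>T\<^esub> cls us"
    by auto
  have "b \<in> set (map snd ws)" using ws Cons.prems p by auto
  then obtain vs where vs: "vs \<in> formal" "map snd vs = map snd ws" "cls vs = cls ws \<oplus>\<^bsub>T\<^esub> pure a b"
    using absorb_term[OF ws(1), of a b] Cons.prems p by auto
  have "cls (p # us) = pure a b \<oplus>\<^bsub>T\<^esub> cls us" using Cons.prems p by (simp add: T_add)
  then have "cls vs = cls zs \<oplus>\<^bsub>T\<^esub> cls (p # us)"
    using vs ws Cons.prems p by (simp add: T.M.a_ac)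
  then show ?case using vs ws by auto
qed

text \<open>
  A shortest representation of an element of \<open>A \<otimes> B\<close> has linearly independent right components.
  Hence an element is zero as soon as all linear forms on \<open>B\<close> contract it to zero: either the first
  right component is a combination of the others, and the representation can be shortened, or
  a linear form takes the value one on it and vanishes on the others, and its coefficient is zero.
\<close>

lemma zero_if_contractions_zero:
  assumes K: "field K" and x: "x \<in> carrier T"
    and zero: "\<And>l. l \<in> linear_forms K B \<Longrightarrow> contraction A l x = \<zero>\<^bsub>A\<^esub>"
  shows "x = \<zero>\<^bsub>T\<^esub>"
proof -
  obtain xs where xs: "xs \<in> formal" "x = cls xs" using x by (metis carrierE)
  have "cls xs = \<zero>\<^bsub>T\<^esub>" if "xs \<in> formal"
    "\<And>l. l \<in> linear_forms K B \<Longrightarrow> contraction A l (cls xs) = \<zero>\<^bsub>A\<^esub>" for xs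
    using that
  proof (induction "length xs" arbitrary: xs)
    case 0
    then show ?case by (simp add: T_zero)
  next
    case (Suc n)
    then obtain a b ys where x: "xs = (a, b) # ys" by (metis length_Suc_conv surj_pair)
    with Suc.prems have f: "a \<in> carrier A" "b \<in> carrier B" "ys \<in> formal" by auto
    have x_sum: "cls xs = pure a b \<oplus>\<^bsub>T\<^esub> cls ys" using f x by (simp add: T_add)
    define zeros where "zeros = map (\<lambda>(a, b). (\<zero>\<^bsub>A\<^esub>, b)) ys"
    have zeros: "zeros \<in> formal" "map snd zeros = map snd ys"
      using f(3) unfolding zeros_def by (auto intro: formal_map)
    have "cls (map (\<lambda>(a, b). (\<zero>\<^bsub>A\<^esub>, b)) us) = \<zero>\<^bsub>T\<^esub>" if "us \<in> formal" for us
      using that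
    proof (induction us)
      case (Cons p us)
      obtain a b where p: "p = (a, b)" by (cases p)
      have m: "map (\<lambda>(a, b). (\<zero>\<^bsub>A\<^esub>, b)) us \<in> formal"
        using Cons.prems p by (intro formal_map) auto
      have "cls (map (\<lambda>(a, b). (\<zero>\<^bsub>A\<^esub>, b)) (p # us)) = pure \<zero>\<^bsub>A\<^esub> b \<oplus>\<^bsub>T\<^esub> cls (map (\<lambda>(a, b). (\<zero>\<^bsub>A\<^esub>, b)) us)"
        using Cons.prems p m by (simp add: T_add)
      then show ?case using Cons p by (simp add: pure_zero_left)
    qed (simp add: T_zero)
    then have zeros_0: "cls zeros = \<zero>\<^bsub>T\<^esub>" using f by (simp add: zeros_def)
    \<comment> \<open>This contains the span of the right components of \<open>ys\<close>, and a combination of them can be eliminated.\<close>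
    define W where "W = {w \<in> carrier B. \<forall>a\<in>carrier A. \<exists>zs\<in>formal. map snd zs = map snd ys \<and> cls zs = pure a w}"
    have "vector_subspace K B W"
      unfolding vector_subspace_def
    proof (intro conjI ballI)
      show "W \<subseteq> carrier B" by (auto simp: W_def)
      have "pure a \<zero>\<^bsub>B\<^esub> = \<zero>\<^bsub>T\<^esub>" if "a \<in> carrier A" for a
        using pure_scalar[of "\<zero>\<^bsub>K\<^esub>" a "\<zero>\<^bsub>B\<^esub>"] that by (simp add: pure_zero_left)
      then show "\<zero>\<^bsub>B\<^esub> \<in> W" using zeros zeros_0 by (auto simp: W_def)
    next
      fix v w assume vw: "v \<in> W" "w \<in> W"
      show "v \<oplus>\<^bsub>B\<^esub> w \<in> W"
        unfolding W_def
      proof (intro CollectI conjI ballI)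
        show "v \<oplus>\<^bsub>B\<^esub> w \<in> carrier B" using vw by (auto simp: W_def)
        fix a assume a: "a \<in> carrier A"
        obtain vs ws where v: "vs \<in> formal" "map snd vs = map snd ys" "cls vs = pure a v"
          and w: "ws \<in> formal" "map snd ws = map snd ys" "cls ws = pure a w"
          using vw a unfolding W_def by blast
        have "set (map snd ws) \<subseteq> set (map snd vs)" unfolding v w by simp
        from absorb_terms[OF w(1) v(1) this] obtain zs
          where "zs \<in> formal" "map snd zs = map snd vs" "cls zs = cls vs \<oplus>\<^bsub>T\<^esub> cls ws" by blast
        then show "\<exists>zs\<in>formal. map snd zs = map snd ys \<and> cls zs = pure a (v \<oplus>\<^bsub>B\<^esub> w)"
          using v w vw a by (auto simp: W_def pure_add_right)
      qed
    next
      fix c w assume c: "c \<in> carrier K" and w: "w \<in> W"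
      then have "pure a (c \<odot>\<^bsub>B\<^esub> w) = pure (c \<odot>\<^bsub>A\<^esub> a) w" if "a \<in> carrier A" for a
        using that by (auto simp: W_def pure_scalar)
      then show "c \<odot>\<^bsub>B\<^esub> w \<in> W" using c w unfolding W_def by simp
    qed
    moreover have right: "b' \<in> W" if "b' \<in> set (map snd ys)" for b'
      unfolding W_def
    proof (intro CollectI conjI ballI)
      show b': "b' \<in> carrier B" using that f formalD by fastforce
      fix a assume a: "a \<in> carrier A"
      have bz: "b' \<in> set (map snd zeros)" using that zeros(2) by simp
      obtain zs where "zs \<in> formal" "map snd zs = map snd zeros" "cls zs = cls zeros \<oplus>\<^bsub>T\<^esub> pure a b'"
        using absorb_term[OF zeros(1) a bz] by blast
      then show "\<exists>zs\<in>formal. map snd zs = map snd ys \<and> cls zs = pure a b'"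
        using zeros zeros_0 a b' by auto
    qed
    ultimately consider "b \<in> W" | l where "l \<in> linear_forms K B" "l b = \<one>\<^bsub>K\<^esub>" "\<And>w. w \<in> W \<Longrightarrow> l w = \<zero>\<^bsub>K\<^esub>"
      using exists_separating_linear_form[OF K B.module] f(2) by metis
    then show ?case
    proof cases
      case 1
      then obtain zs where zs: "zs \<in> formal" "map snd zs = map snd ys" "cls zs = pure a b"
        using f by (auto simp: W_def)
      have "set (map snd zs) \<subseteq> set (map snd ys)" unfolding zs by simp
      from absorb_terms[OF zs(1) f(3) this] obtain us
        where us: "us \<in> formal" "map snd us = map snd ys" "cls us = cls ys \<oplus>\<^bsub>T\<^esub> cls zs" by blast
      have eq: "cls xs = cls us" using x_sum us zs f by (simp add: T.M.a_comm)
      have "n = length us" using Suc.hyps(2) x us(2) by (metis length_Cons length_map nat.inject)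
      then show ?thesis using Suc.hyps(1)[OF _ us(1)] Suc.prems(2) eq by simp
    next
      case 2
      have "bilinear_sum A (\<lambda>a b. l b \<odot>\<^bsub>A\<^esub> a) us = \<zero>\<^bsub>A\<^esub>" if "us \<in> formal" "set (map snd us) \<subseteq> W" for us
        using that
      proof (induction us)
        case (Cons p us)
        then show ?case using 2(3) by (cases p) auto
      qed simp
      then have "contraction A l (cls xs) = a"
        using right f 2 Suc.prems(1) x by (simp add: contraction_cls subset_iff)
      then have "a = \<zero>\<^bsub>A\<^esub>" using Suc.prems(2) 2(1) by simp
      then have eq: "cls xs = cls ys" using x_sum f by (simp add: pure_zero_left)
      have "n = length ys" using Suc.hyps(2) x by simp
      then show ?thesis using Suc.hyps(1)[OF _ f(3)] Suc.prems(2) eq by simp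
    qed
  qed
  then show ?thesis using xs zero by simp
qed

end

lemma tensor_map_class:
  assumes A: "algebra K A" and B: "algebra K B" and C: "algebra K C" and D: "algebra K D"
    and f: "f \<in> alg_hom K A C" and g: "g \<in> alg_hom K B D" and xs: "xs \<in> formal_sums A B"
  shows "map (\<lambda>(a, b). (f a, g b)) xs \<in> formal_sums C D"
    and "tensor_map K C D f g (tensor_class K A B xs) = tensor_class K C D (map (\<lambda>(a, b). (f a, g b)) xs)"
proof -
  interpret AB: tensor_pair K A B by (intro tensor_pair.intro A B)
  interpret CD: tensor_pair K C D by (intro tensor_pair.intro C D)
  note h = alg_hom_comp[OF f CD.tensor_inl_hom] alg_hom_comp[OF g CD.tensor_inr_hom]
  show m: "map (\<lambda>(a, b). (f a, g b)) xs \<in> formal_sums C D"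
    using xs by (auto simp: formal_sums_def alg_hom_closed[OF f] alg_hom_closed[OF g] in_lists_conv_set)
  have "tensor_map K C D f g (tensor_class K A B xs)
    = bilinear_sum (tensor K C D) (\<lambda>a b. tensor_inl K C D (f a) \<otimes>\<^bsub>tensor K C D\<^esub> tensor_inr K C D (g b)) xs"
    unfolding tensor_map_def AB.tensor_lift_cls[OF CD.T_algebra h xs] by simp
  also have "\<dots> = bilinear_sum (tensor K C D) (\<lambda>a b. tensor_class K C D [(f a, g b)]) xs"
    using AB.formalD[OF xs] by (intro bilinear_sum_cong CD.inl_inr_pure)
      (auto simp: alg_hom_closed[OF f] alg_hom_closed[OF g])
  also have "\<dots> = tensor_class K C D (map (\<lambda>(a, b). (f a, g b)) xs)"
    using m by (simp add: CD.cls_eq_bilinear_sum bilinear_sum_map)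
  finally show "tensor_map K C D f g (tensor_class K A B xs) = tensor_class K C D (map (\<lambda>(a, b). (f a, g b)) xs)" .
qed

text \<open>
  Contraction acts on the second factor and \<open>f\<close> on the first, so that they commute.
\<close>

lemma contraction_tensor_map:
  assumes A: "algebra K A" and B: "algebra K B" and C: "algebra K C"
    and f: "f \<in> alg_hom K A C" and l: "l \<in> linear_forms K B" and x: "x \<in> carrier (tensor K A B)"
  shows "contraction C l (tensor_map K C B f (\<lambda>b. b) x) = f (contraction A l x)"
proof -
  interpret AB: tensor_pair K A B by (intro tensor_pair.intro A B)
  interpret CB: tensor_pair K C B by (intro tensor_pair.intro C B)
  obtain xs where xs: "xs \<in> AB.formal" "x = AB.cls xs" using x by (metis AB.carrierE)
  note m = tensor_map_class[OF A B C B f alg_hom_id xs(1)]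
  have lc: "l b \<in> carrier K" if "b \<in> carrier B" for b using l that by (auto simp: linear_forms_def)
  have "contraction C l (tensor_map K C B f (\<lambda>b. b) x) = bilinear_sum C (\<lambda>a b. l b \<odot>\<^bsub>C\<^esub> f a) xs"
    unfolding xs(2) m(2) using m(1) l by (simp add: CB.contraction_cls bilinear_sum_map)
  also have "\<dots> = bilinear_sum C (\<lambda>a b. f (l b \<odot>\<^bsub>A\<^esub> a)) xs"
    using AB.formalD[OF xs(1)] lc by (intro bilinear_sum_cong) (auto simp: alg_hom_smult[OF f])
  also have "\<dots> = f (bilinear_sum A (\<lambda>a b. l b \<odot>\<^bsub>A\<^esub> a) xs)"
    using AB.formalD[OF xs(1)] lc by (intro alg_hom_bilinear_sum[OF A C f, symmetric]) auto
  finally show ?thesis using xs l by (simp add: AB.contraction_cls)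
qed

text \<open>
  Flatness over a field: tensoring preserves injectivity.  Contractions with linear forms on \<open>B\<close>
  reduce this to the injectivity of \<open>f\<close>.
\<close>

lemma tensor_map_eq_zeroD:
  assumes "field K" and A: "algebra K A" and B: "algebra K B" and C: "algebra K C"
    and f: "f \<in> alg_hom K A C" and ker: "\<And>a. a \<in> carrier A \<Longrightarrow> f a = \<zero>\<^bsub>C\<^esub> \<Longrightarrow> a = \<zero>\<^bsub>A\<^esub>"
    and x: "x \<in> carrier (tensor K A B)" and zero: "tensor_map K C B f (\<lambda>b. b) x = \<zero>\<^bsub>tensor K C B\<^esub>"
  shows "x = \<zero>\<^bsub>tensor K A B\<^esub>"
proof -
  interpret AB: tensor_pair K A B by (intro tensor_pair.intro A B)
  interpret CB: tensor_pair K C B by (intro tensor_pair.intro C B)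
  show ?thesis
  proof (rule AB.zero_if_contractions_zero[OF \<open>field K\<close> x])
    fix l assume l: "l \<in> linear_forms K B"
    have "contraction C l \<zero>\<^bsub>tensor K C B\<^esub> = \<zero>\<^bsub>C\<^esub>"
      using l by (simp add: CB.T_zero CB.contraction_cls)
    then show "contraction A l x = \<zero>\<^bsub>A\<^esub>"
      using contraction_tensor_map[OF A B C f l x] zero ker AB.contraction_closed[OF l x] by simp
  qed
qed

section \<open>Points of finitely generated reduced algebras\<close>

lemma ring_hom_cring_from_hom:
  "cring R \<Longrightarrow> cring S \<Longrightarrow> h \<in> ring_hom R S \<Longrightarrow> ring_hom_cring R S h"
  by (simp add: ring_hom_cring_def ring_hom_cring_axioms_def)

lemma (in "domain") nat_pow_nonzero:
  "x \<in> carrier R \<Longrightarrow> x \<noteq> \<zero> \<Longrightarrow> x [^] (n::nat) \<noteq> \<zero>"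
  by (induction n) (auto simp: integral_iff)

text \<open>
  An ideal that is maximal among those containing no power of \<open>s\<close> is prime.
\<close>

lemma exists_prime_avoiding_powers:
  assumes "cring R" and s: "s \<in> carrier R" and np: "\<And>n::nat. s [^]\<^bsub>R\<^esub> n \<noteq> \<zero>\<^bsub>R\<^esub>"
  obtains P where "primeideal P R" "s \<notin> P"
proof -
  interpret cring R by fact
  define S where "S = {I. ideal I R \<and> (\<forall>n::nat. s [^]\<^bsub>R\<^esub> n \<notin> I)}"
  have "\<exists>M\<in>S. \<forall>Y\<in>S. M \<subseteq> Y \<longrightarrow> Y = M"
  proof (rule subset_Zorn_nonempty)
    show "S \<noteq> {}" using zeroideal np by (auto simp: S_def)
    fix C assume C: "C \<noteq> {}" "subset.chain S C"
    then have "subset.chain {I. ideal I R} C" by (auto simp: subset.chain_def S_def)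
    then have "ideal (\<Union>C) R" using chain_Union_is_ideal[of C] C(1) by simp
    then show "\<Union>C \<in> S" using C by (auto simp: subset.chain_def S_def)
  qed
  then obtain P where P: "ideal P R" "\<And>n::nat. s [^]\<^bsub>R\<^esub> n \<notin> P"
    and max: "\<And>Y. ideal Y R \<Longrightarrow> P \<subseteq> Y \<Longrightarrow> (\<forall>n::nat. s [^]\<^bsub>R\<^esub> n \<notin> Y) \<Longrightarrow> Y = P"
    by (auto simp: S_def)
  interpret P: ideal P R by fact
  have ex: "\<exists>n::nat. \<exists>p\<in>P. \<exists>r\<in>carrier R. s [^]\<^bsub>R\<^esub> n = p \<oplus>\<^bsub>R\<^esub> r \<otimes>\<^bsub>R\<^esub> a" if a: "a \<in> carrier R" "a \<notin> P" for a
  proof -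
    let ?Y = "P <+>\<^bsub>R\<^esub> PIdl\<^bsub>R\<^esub> a"
    have Y: "ideal ?Y R" using add_ideals[OF P(1) cgenideal_ideal[OF a(1)]] .
    have sum: "p \<oplus>\<^bsub>R\<^esub> b \<in> ?Y" if "p \<in> P" "b \<in> PIdl\<^bsub>R\<^esub> a" for p b
      unfolding set_add_def' using that by blast
    have "\<zero>\<^bsub>R\<^esub> \<in> PIdl\<^bsub>R\<^esub> a"
      using cgenideal_ideal[OF a(1)] by (simp add: additive_subgroup.zero_closed ideal.axioms(1))
    then have "P \<subseteq> ?Y" using sum[of _ "\<zero>\<^bsub>R\<^esub>"] P.a_Hcarr by fastforce
    have "a \<in> ?Y" using sum[OF P.zero_closed cgenideal_self[OF a(1)]] a by simp
    then have "?Y \<noteq> P" using a by auto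
    then obtain n :: nat where "s [^]\<^bsub>R\<^esub> n \<in> ?Y" using max[OF Y \<open>P \<subseteq> ?Y\<close>] by blast
    then show ?thesis unfolding set_add_def' cgenideal_def by blast
  qed
  have "primeideal P R"
  proof (rule primeidealI[OF P(1) is_cring])
    show "carrier R \<noteq> P" using P(2)[of 0] by auto
    fix a b assume ab: "a \<in> carrier R" "b \<in> carrier R" "a \<otimes>\<^bsub>R\<^esub> b \<in> P"
    show "a \<in> P \<or> b \<in> P"
    proof (rule ccontr)
      assume "\<not> (a \<in> P \<or> b \<in> P)"
      then obtain m n :: nat and p q r u where
        1: "p \<in> P" "r \<in> carrier R" "s [^]\<^bsub>R\<^esub> m = p \<oplus>\<^bsub>R\<^esub> r \<otimes>\<^bsub>R\<^esub> a" and
        2: "q \<in> P" "u \<in> carrier R" "s [^]\<^bsub>R\<^esub> n = q \<oplus>\<^bsub>R\<^esub> u \<otimes>\<^bsub>R\<^esub> b"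
        using ex ab by metis
      have c: "p \<in> carrier R" "q \<in> carrier R" using 1 2 by auto
      have "s [^]\<^bsub>R\<^esub> (m + n) = (p \<oplus>\<^bsub>R\<^esub> r \<otimes>\<^bsub>R\<^esub> a) \<otimes>\<^bsub>R\<^esub> (q \<oplus>\<^bsub>R\<^esub> u \<otimes>\<^bsub>R\<^esub> b)"
        using 1 2 s by (simp flip: nat_pow_mult)
      also have "\<dots> = p \<otimes>\<^bsub>R\<^esub> (q \<oplus>\<^bsub>R\<^esub> u \<otimes>\<^bsub>R\<^esub> b) \<oplus>\<^bsub>R\<^esub> (r \<otimes>\<^bsub>R\<^esub> a \<otimes>\<^bsub>R\<^esub> q \<oplus>\<^bsub>R\<^esub> (r \<otimes>\<^bsub>R\<^esub> u) \<otimes>\<^bsub>R\<^esub> (a \<otimes>\<^bsub>R\<^esub> b))"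
        using 1 2 ab c by (simp add: l_distr r_distr m_ac a_ac)
      also have "\<dots> \<in> P"
        using P.I_r_closed[of p "q \<oplus>\<^bsub>R\<^esub> u \<otimes>\<^bsub>R\<^esub> b"] P.I_l_closed[of q "r \<otimes>\<^bsub>R\<^esub> a"]
          P.I_l_closed[of "a \<otimes>\<^bsub>R\<^esub> b" "r \<otimes>\<^bsub>R\<^esub> u"] 1 2 ab c
        by (intro P.a_closed) auto
      finally show False using P(2) by blast
    qed
  qed
  then show thesis using P(2)[of 1] s that by auto
qed

lemma
  assumes "cring M" "cring S" "h \<in> ring_hom M S" "t \<in> carrier S"
  shows eval_UP_hom: "UnivPoly.eval M S h t \<in> ring_hom (UP M) S"
    and eval_UP_const: "a \<in> carrier M \<Longrightarrow> UnivPoly.eval M S h t (up_ring.monom (UP M) a 0) = h a"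
    and eval_UP_smult: "a \<in> carrier M \<Longrightarrow> p \<in> carrier (UP M) \<Longrightarrow>
      UnivPoly.eval M S h t (a \<odot>\<^bsub>UP M\<^esub> p) = h a \<otimes>\<^bsub>S\<^esub> UnivPoly.eval M S h t p"
    and eval_UP_var: "UnivPoly.eval M S h t (up_ring.monom (UP M) \<one>\<^bsub>M\<^esub> 1) = t"
proof -
  interpret h: ring_hom_cring M S h using assms ring_hom_cring_from_hom by blast
  interpret UP_pre_univ_prop M S h "UP M" by unfold_locales simp
  show 1: "UnivPoly.eval M S h t \<in> ring_hom (UP M) S" using eval_ring_hom assms(4) .
  show 2: "UnivPoly.eval M S h t (up_ring.monom (UP M) a 0) = h a" if "a \<in> carrier M" for a
    using eval_const assms(4) that .
  show "UnivPoly.eval M S h t (a \<odot>\<^bsub>UP M\<^esub> p) = h a \<otimes>\<^bsub>S\<^esub> UnivPoly.eval M S h t p"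
    if "a \<in> carrier M" "p \<in> carrier (UP M)" for a p
    using that by (simp add: 2 ring_hom_memE(2)[OF 1] flip: monom_mult_is_smult)
  show "UnivPoly.eval M S h t (up_ring.monom (UP M) \<one>\<^bsub>M\<^esub> 1) = t"
    using eval_monom1 assms(4) .
qed

lemma (in ring) eval_map_coeffs:
  fixes c :: "nat \<Rightarrow> 'a"
  assumes "\<And>i. i \<le> n \<Longrightarrow> c i \<in> carrier R" "x \<in> carrier R"
  shows "eval (map c (rev [0..<Suc n])) x = (\<Oplus>i\<in>{..n}. c i \<otimes> x [^] i)"
  using assms
proof (induction n)
  case (Suc n)
  have "eval (map c (rev [0..<Suc (Suc n)])) x = c (Suc n) \<otimes> x [^] Suc n \<oplus> eval (map c (rev [0..<Suc n])) x"
    by simp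
  then show ?case using Suc by (simp add: finsum_Suc Pi_def del: upt_Suc)
qed simp

text \<open>
  Two descriptions of polynomials meet here: algebraic closedness speaks of lists of coefficients
  with the leading one first, while evaluation on the ring \<open>UP\<close> is a finite sum.
\<close>

lemma (in algebraically_closed) exists_root_of_sum:
  fixes c :: "nat \<Rightarrow> 'a"
  assumes "\<And>i. i \<le> n \<Longrightarrow> c i \<in> carrier L" "c n \<noteq> \<zero>" "n \<ge> 1"
  obtains x where "x \<in> carrier L" "(\<Oplus>i\<in>{..n}. c i \<otimes> x [^] i) = \<zero>"
proof -
  define p where "p = map c (rev [0..<Suc n])"
  have "set p \<subseteq> carrier L" "lead_coeff p \<noteq> \<zero>" "degree p = n"
    using assms by (auto simp: p_def)
  then have p: "p \<in> carrier (poly_ring L)"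
    unfolding univ_poly_carrier[symmetric] by auto
  then have "size (roots p) = n"
    using roots_over_carrier[OF p] \<open>degree p = n\<close> by (simp add: splitted_def)
  then obtain x where "x \<in># roots p"
    using assms(3) by (metis not_one_le_zero multiset_nonemptyE size_empty)
  then have "is_root p x" using roots_mem_iff_is_root[OF p] by simp
  then show thesis
    using that[of x] eval_map_coeffs[of n c x] assms(1) by (auto simp: is_root_def p_def)
qed

lemma (in algebraically_closed) exists_nonroot_of_sum:
  fixes c :: "nat \<Rightarrow> 'a"
  assumes c: "\<And>i. i \<le> n \<Longrightarrow> c i \<in> carrier L" and "c n \<noteq> \<zero>"
  obtains x where "x \<in> carrier L" "(\<Oplus>i\<in>{..n}. c i \<otimes> x [^] i) \<noteq> \<zero>"
proof (cases n)
  case 0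
  then show ?thesis using that[of \<one>] assms by simp
next
  case (Suc m)
  \<comment> \<open>At a root of the polynomial decreased by one, the polynomial has the value one.\<close>
  define d where "d = c(0 := c 0 \<ominus> \<one>)"
  have d: "d i \<in> carrier L" if "i \<le> n" for i using that c by (auto simp: d_def)
  obtain x where x: "x \<in> carrier L" "(\<Oplus>i\<in>{..n}. d i \<otimes> x [^] i) = \<zero>"
    using exists_root_of_sum[of n d] d assms Suc by (auto simp: d_def)
  have split: "(\<Oplus>i\<in>{..n}. e i \<otimes> x [^] i) = (\<Oplus>i\<in>{..m}. e (Suc i) \<otimes> x [^] Suc i) \<oplus> e 0"
    if "\<And>i. i \<le> n \<Longrightarrow> e i \<in> carrier L" for e
    unfolding Suc using that x Suc by (subst finsum_Suc2) (auto simp: Pi_def)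
  define s where "s = (\<Oplus>i\<in>{..m}. c (Suc i) \<otimes> x [^] Suc i)"
  have s: "s \<in> carrier L" unfolding s_def using c x Suc by (intro finsum_closed) auto
  have "s \<oplus> (c 0 \<ominus> \<one>) = \<zero>"
    using split[of d] d x(2) by (simp add: d_def s_def)
  then have "(s \<oplus> c 0) \<ominus> \<one> = \<zero>" using s c by (simp add: minus_eq a_assoc)
  then have "s \<oplus> c 0 = \<one>" using s c by simp
  then have "(\<Oplus>i\<in>{..n}. c i \<otimes> x [^] i) = \<one>" using split[of c] c by (simp add: s_def)
  then show ?thesis using that[of x] x by simp
qed

text \<open>
  The inductive step of the Nullstellensatz.  Let \<open>D\<close> be a domain over the domain \<open>M\<close> and
  \<open>t \<in> D\<close>.  If \<open>t\<close> is transcendental, a point of \<open>M\<close> at which the leading coefficient of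
  \<open>g\<close> does not vanish may be extended by almost any value of \<open>t\<close>.  If \<open>t\<close> is a root of \<open>p\<close> of
  minimal degree, some nonzero multiple \<open>c\<close> of \<open>g(t)\<close> lies in \<open>M\<close>, and a point at which
  \<open>c\<close> and the leading coefficient of \<open>p\<close> do not vanish extends by any root of the image of \<open>p\<close>.
\<close>

lemma extend_point:
  assumes "domain M" "domain D" "algebraically_closed L" and h: "h \<in> ring_hom M D"
    and inj: "\<And>a. a \<in> carrier M \<Longrightarrow> h a = \<zero>\<^bsub>D\<^esub> \<Longrightarrow> a = \<zero>\<^bsub>M\<^esub>"
    and t: "t \<in> carrier D" and g: "g \<in> carrier (UP M)" and g0: "UnivPoly.eval M D h t g \<noteq> \<zero>\<^bsub>D\<^esub>"
  obtains a where "a \<in> carrier M" "a \<noteq> \<zero>\<^bsub>M\<^esub>"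
    "\<And>\<phi>. \<phi> \<in> ring_hom M L \<Longrightarrow> \<phi> a \<noteq> \<zero>\<^bsub>L\<^esub> \<Longrightarrow> \<exists>x\<in>carrier L. UnivPoly.eval M L \<phi> x g \<noteq> \<zero>\<^bsub>L\<^esub> \<and>
      (\<forall>p\<in>carrier (UP M). UnivPoly.eval M D h t p = \<zero>\<^bsub>D\<^esub> \<longrightarrow> UnivPoly.eval M L \<phi> x p = \<zero>\<^bsub>L\<^esub>)"
proof -
  interpret M: "domain" M by fact
  interpret D: "domain" D by fact
  interpret L: algebraically_closed L by fact
  interpret P: UP_domain M "UP M" by unfold_locales simp
  let ?P = "UP M"
  define e where "e = UnivPoly.eval M D h t"
  note eh = eval_UP_hom[OF M.is_cring D.is_cring h t, folded e_def]
  interpret e: ring_hom_cring ?P D e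
    by (rule ring_hom_cring_from_hom[OF P.P.is_cring D.is_cring eh])
  have e_const: "e (up_ring.monom ?P a 0) = h a" if "a \<in> carrier M" for a
    using eval_UP_const[OF M.is_cring D.is_cring h t that] by (simp add: e_def)
  have e_smult: "e (a \<odot>\<^bsub>?P\<^esub> p) = h a \<otimes>\<^bsub>D\<^esub> e p" if "a \<in> carrier M" "p \<in> carrier ?P" for a p
    using eval_UP_smult[OF M.is_cring D.is_cring h t that] by (simp add: e_def)
  have h_pow: "h (a [^]\<^bsub>M\<^esub> (k::nat)) \<in> carrier D \<and> h (a [^]\<^bsub>M\<^esub> k) \<noteq> \<zero>\<^bsub>D\<^esub>" if "a \<in> carrier M" "a \<noteq> \<zero>\<^bsub>M\<^esub>" for a k
    using that inj[of "a [^]\<^bsub>M\<^esub> k"] ring_hom_memE(1)[OF h] M.nat_pow_nonzero by auto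
  have e_smult_0: "e (a [^]\<^bsub>M\<^esub> (k::nat) \<odot>\<^bsub>?P\<^esub> p) = \<zero>\<^bsub>D\<^esub> \<longleftrightarrow> e p = \<zero>\<^bsub>D\<^esub>" if "a \<in> carrier M" "a \<noteq> \<zero>\<^bsub>M\<^esub>" "p \<in> carrier ?P" for a k p
    using that h_pow[of a k] by (auto simp: e_smult D.integral_iff)
  have lc: "up_ring.coeff ?P p (deg M p) \<in> carrier M \<and> up_ring.coeff ?P p (deg M p) \<noteq> \<zero>\<^bsub>M\<^esub>" if "p \<in> carrier ?P" "p \<noteq> \<zero>\<^bsub>?P\<^esub>" for p
    using that P.lcoeff_nonzero2 by simp
  have eL_sum: "UnivPoly.eval M L \<phi> x p = (\<Oplus>\<^bsub>L\<^esub>i\<in>{..deg M p}. \<phi> (up_ring.coeff ?P p i) \<otimes>\<^bsub>L\<^esub> x [^]\<^bsub>L\<^esub> i)"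
    if "p \<in> carrier ?P" for \<phi> x p
    using that by (simp add: UnivPoly.eval_def)
  have e0: "e \<zero>\<^bsub>?P\<^esub> = \<zero>\<^bsub>D\<^esub>" by simp
  have g_ne: "g \<noteq> \<zero>\<^bsub>?P\<^esub>" using g0 e0 by (auto simp: e_def)
  show thesis
  proof (cases "\<exists>p\<in>carrier ?P. p \<noteq> \<zero>\<^bsub>?P\<^esub> \<and> e p = \<zero>\<^bsub>D\<^esub>")
    case False
    let ?a = "up_ring.coeff ?P g (deg M g)"
    show thesis
    proof (rule that[of ?a])
      show "?a \<in> carrier M" "?a \<noteq> \<zero>\<^bsub>M\<^esub>" using lc[OF g g_ne] by auto
      fix \<phi> assume \<phi>: "\<phi> \<in> ring_hom M L" "\<phi> ?a \<noteq> \<zero>\<^bsub>L\<^esub>"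
      interpret \<phi>: ring_hom_cring M L \<phi>
        by (rule ring_hom_cring_from_hom[OF M.is_cring L.is_cring \<phi>(1)])
      obtain x where x: "x \<in> carrier L" "(\<Oplus>\<^bsub>L\<^esub>i\<in>{..deg M g}. \<phi> (up_ring.coeff ?P g i) \<otimes>\<^bsub>L\<^esub> x [^]\<^bsub>L\<^esub> i) \<noteq> \<zero>\<^bsub>L\<^esub>"
        using L.exists_nonroot_of_sum[of "deg M g" "\<lambda>i. \<phi> (up_ring.coeff ?P g i)"] \<phi>(2) g by auto
      have "UnivPoly.eval M L \<phi> x \<zero>\<^bsub>?P\<^esub> = \<zero>\<^bsub>L\<^esub>"
        using eL_sum[of "\<zero>\<^bsub>?P\<^esub>" \<phi> x] x(1) by simp
      then show "\<exists>x\<in>carrier L. UnivPoly.eval M L \<phi> x g \<noteq> \<zero>\<^bsub>L\<^esub> \<and>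
        (\<forall>p\<in>carrier (UP M). UnivPoly.eval M D h t p = \<zero>\<^bsub>D\<^esub> \<longrightarrow> UnivPoly.eval M L \<phi> x p = \<zero>\<^bsub>L\<^esub>)"
        using x False g by (intro bexI[of _ x]) (auto simp: eL_sum e_def[symmetric])
    qed
  next
    case True
    \<comment> \<open>The polynomial \<open>p\<close> replaces the minimal polynomial of \<open>t\<close>; its leading coefficient need not be invertible.\<close>
    define A where "A = (\<lambda>p. p \<in> carrier ?P \<and> p \<noteq> \<zero>\<^bsub>?P\<^esub> \<and> e p = \<zero>\<^bsub>D\<^esub>)"
    define p where "p = arg_min (deg M) A"
    have "\<exists>p. A p" using True by (auto simp: A_def)
    then have "A p" and p_min: "\<And>q. A q \<Longrightarrow> deg M p \<le> deg M q"
      unfolding p_def by (metis arg_min_natI, metis arg_min_nat_le)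
    then have p: "p \<in> carrier ?P" "p \<noteq> \<zero>\<^bsub>?P\<^esub>" "e p = \<zero>\<^bsub>D\<^esub>" by (auto simp: A_def)
    have small: "r = \<zero>\<^bsub>?P\<^esub>" if "r \<in> carrier ?P" "e r = \<zero>\<^bsub>D\<^esub>" "deg M r < deg M p" for r
      using p_min[of r] that by (auto simp: A_def)
    let ?l = "up_ring.coeff ?P p (deg M p)"
    have l: "?l \<in> carrier M" "?l \<noteq> \<zero>\<^bsub>M\<^esub>" using lc[OF p(1,2)] by auto
    have dp: "deg M p \<ge> 1"
    proof (rule ccontr)
      assume "\<not> deg M p \<ge> 1"
      then have d0: "deg M p = 0" by simp
      have "e p = h ?l"
        using P.deg_zero_impl_monom[OF p(1) d0] e_const[OF l(1)] d0 by simp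
      then show False using p(3) inj l by auto
    qed
    \<comment> \<open>A multiple of \<open>g(t)\<close> that is the value of a polynomial \<open>q\<close> of smallest possible degree; it will turn out to be constant.\<close>
    define B where "B = (\<lambda>q. q \<in> carrier ?P \<and> e q \<noteq> \<zero>\<^bsub>D\<^esub> \<and> (\<exists>v\<in>carrier ?P. e q = e g \<otimes>\<^bsub>D\<^esub> e v))"
    define q where "q = arg_min (deg M) B"
    have "B g" using g g0 e.hom_one unfolding B_def e_def[symmetric]
      by (intro conjI bexI[of _ "\<one>\<^bsub>?P\<^esub>"]) (auto simp: e_def[symmetric])
    then have "B q" and q_min: "\<And>r. B r \<Longrightarrow> deg M q \<le> deg M r"
      unfolding q_def by (metis arg_min_natI, metis arg_min_nat_le)
    then obtain v where q: "q \<in> carrier ?P" "e q \<noteq> \<zero>\<^bsub>D\<^esub>" and v: "v \<in> carrier ?P" "e q = e g \<otimes>\<^bsub>D\<^esub> e v"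
      by (auto simp: B_def)
    have q_ne: "q \<noteq> \<zero>\<^bsub>?P\<^esub>" using q e0 by auto
    let ?m = "up_ring.coeff ?P q (deg M q)"
    have m: "?m \<in> carrier M" "?m \<noteq> \<zero>\<^bsub>M\<^esub>" using lc[OF q(1) q_ne] by auto
    have dq_less: "deg M q < deg M p"
    proof -
      obtain u r and k :: nat where ur: "u \<in> carrier ?P" "r \<in> carrier ?P"
        "?l [^]\<^bsub>M\<^esub> k \<odot>\<^bsub>?P\<^esub> q = p \<otimes>\<^bsub>?P\<^esub> u \<oplus>\<^bsub>?P\<^esub> r" "r = \<zero>\<^bsub>?P\<^esub> \<or> deg M r < deg M p"
        using P.long_div_theorem[OF p(1) q(1) p(2)] by blast
      have "e (?l [^]\<^bsub>M\<^esub> k \<odot>\<^bsub>?P\<^esub> q) = e r" using ur p by simp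
      moreover have "e (?l [^]\<^bsub>M\<^esub> k \<odot>\<^bsub>?P\<^esub> q) \<noteq> \<zero>\<^bsub>D\<^esub>" using e_smult_0[OF l q(1)] q(2) by simp
      ultimately have er: "e r \<noteq> \<zero>\<^bsub>D\<^esub>" by simp
      have "e r = e g \<otimes>\<^bsub>D\<^esub> e (?l [^]\<^bsub>M\<^esub> k \<odot>\<^bsub>?P\<^esub> v)"
        using \<open>e (?l [^]\<^bsub>M\<^esub> k \<odot>\<^bsub>?P\<^esub> q) = e r\<close>[symmetric] q v g l h_pow[OF l, of k]
        by (simp add: e_smult D.m_lcomm)
      then have "B r" using ur er v l unfolding B_def by blast
      then have "deg M q \<le> deg M r" by (rule q_min)
      moreover have "r \<noteq> \<zero>\<^bsub>?P\<^esub>" using er e0 by auto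
      ultimately show ?thesis using ur(4) by simp
    qed
    have dq: "deg M q = 0"
    proof -
      obtain u r and k :: nat where ur: "u \<in> carrier ?P" "r \<in> carrier ?P"
        "?m [^]\<^bsub>M\<^esub> k \<odot>\<^bsub>?P\<^esub> p = q \<otimes>\<^bsub>?P\<^esub> u \<oplus>\<^bsub>?P\<^esub> r" "r = \<zero>\<^bsub>?P\<^esub> \<or> deg M r < deg M q"
        using P.long_div_theorem[OF q(1) p(1) q_ne] by blast
      have mk: "?m [^]\<^bsub>M\<^esub> k \<in> carrier M" "?m [^]\<^bsub>M\<^esub> k \<noteq> \<zero>\<^bsub>M\<^esub>" using m M.nat_pow_nonzero by auto
      have "e (?m [^]\<^bsub>M\<^esub> k \<odot>\<^bsub>?P\<^esub> p) = \<zero>\<^bsub>D\<^esub>" using e_smult_0[OF m p(1)] p(3) by simp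
      then have sum0: "e q \<otimes>\<^bsub>D\<^esub> e u \<oplus>\<^bsub>D\<^esub> e r = \<zero>\<^bsub>D\<^esub>" using ur q by simp
      have er: "e r = \<zero>\<^bsub>D\<^esub>"
      proof (rule ccontr)
        assume er: "e r \<noteq> \<zero>\<^bsub>D\<^esub>"
        have "e r = \<ominus>\<^bsub>D\<^esub> (e q \<otimes>\<^bsub>D\<^esub> e u)"
          using sum0 ur q by (simp add: D.sum_zero_eq_neg D.a_comm)
        also have "\<dots> = e g \<otimes>\<^bsub>D\<^esub> e (\<ominus>\<^bsub>?P\<^esub> (v \<otimes>\<^bsub>?P\<^esub> u))"
          using ur q v g by (simp add: D.m_assoc D.r_minus)
        finally have "B r" using ur er v unfolding B_def by blast
        then have "deg M q \<le> deg M r" by (rule q_min)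
        moreover have "r \<noteq> \<zero>\<^bsub>?P\<^esub>" using er e0 by auto
        ultimately show False using ur(4) by simp
      qed
      then have "e u = \<zero>\<^bsub>D\<^esub>" using sum0 q ur by (simp add: D.integral_iff)
      moreover have "r = \<zero>\<^bsub>?P\<^esub>" using small[OF ur(2) er] ur(4) dq_less by auto
      ultimately have eq: "?m [^]\<^bsub>M\<^esub> k \<odot>\<^bsub>?P\<^esub> p = q \<otimes>\<^bsub>?P\<^esub> u" "e u = \<zero>\<^bsub>D\<^esub>" using ur q by auto
      have dmp: "deg M (?m [^]\<^bsub>M\<^esub> k \<odot>\<^bsub>?P\<^esub> p) = deg M p"
        using mk p by simp
      have "u \<noteq> \<zero>\<^bsub>?P\<^esub>"
      proof
        assume "u = \<zero>\<^bsub>?P\<^esub>"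
        then have "deg M (?m [^]\<^bsub>M\<^esub> k \<odot>\<^bsub>?P\<^esub> p) = 0" using eq q by simp
        then show False using dmp dp by simp
      qed
      then have "deg M p = deg M q + deg M u" using eq dmp q_ne q ur by simp
      moreover have "deg M p \<le> deg M u" using p_min[of u] ur eq \<open>u \<noteq> \<zero>\<^bsub>?P\<^esub>\<close> by (simp add: A_def)
      ultimately show ?thesis by simp
    qed
    define c where "c = up_ring.coeff ?P q 0"
    have c: "c \<in> carrier M" "q = up_ring.monom ?P c 0" using q P.deg_zero_impl_monom[OF q(1) dq] by (auto simp: c_def)
    then have c0: "c \<noteq> \<zero>\<^bsub>M\<^esub>" using q_ne by auto
    show thesis
    proof (rule that[of "?l \<otimes>\<^bsub>M\<^esub> c"])
      show "?l \<otimes>\<^bsub>M\<^esub> c \<in> carrier M" using l c by simp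
      show "?l \<otimes>\<^bsub>M\<^esub> c \<noteq> \<zero>\<^bsub>M\<^esub>" using l c c0 by (simp add: M.integral_iff)
      fix \<phi> assume \<phi>: "\<phi> \<in> ring_hom M L" "\<phi> (?l \<otimes>\<^bsub>M\<^esub> c) \<noteq> \<zero>\<^bsub>L\<^esub>"
      interpret \<phi>: ring_hom_cring M L \<phi>
        by (rule ring_hom_cring_from_hom[OF M.is_cring L.is_cring \<phi>(1)])
      have \<phi>l: "\<phi> ?l \<noteq> \<zero>\<^bsub>L\<^esub>" "\<phi> c \<noteq> \<zero>\<^bsub>L\<^esub>" using \<phi>(2) l c by auto
      obtain x where x: "x \<in> carrier L" "(\<Oplus>\<^bsub>L\<^esub>i\<in>{..deg M p}. \<phi> (up_ring.coeff ?P p i) \<otimes>\<^bsub>L\<^esub> x [^]\<^bsub>L\<^esub> i) = \<zero>\<^bsub>L\<^esub>"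
        using L.exists_root_of_sum[of "deg M p" "\<lambda>i. \<phi> (up_ring.coeff ?P p i)"] \<phi>l p dp by auto
      define f where "f = UnivPoly.eval M L \<phi> x"
      interpret f: ring_hom_cring ?P L f
        unfolding f_def
        by (rule ring_hom_cring_from_hom[OF P.P.is_cring L.is_cring eval_UP_hom[OF M.is_cring L.is_cring \<phi>(1) x(1)]])
      have fp: "f p = \<zero>\<^bsub>L\<^esub>" using x p by (simp add: f_def eL_sum)
      \<comment> \<open>Up to a power of the leading coefficient, \<open>p\<close> divides every relation satisfied by \<open>t\<close>.\<close>
      have ker: "f r = \<zero>\<^bsub>L\<^esub>" if r: "r \<in> carrier ?P" "e r = \<zero>\<^bsub>D\<^esub>" for r
      proof -
        obtain u s and k :: nat where us: "u \<in> carrier ?P" "s \<in> carrier ?P"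
          "?l [^]\<^bsub>M\<^esub> k \<odot>\<^bsub>?P\<^esub> r = p \<otimes>\<^bsub>?P\<^esub> u \<oplus>\<^bsub>?P\<^esub> s" "s = \<zero>\<^bsub>?P\<^esub> \<or> deg M s < deg M p"
          using P.long_div_theorem[OF p(1) r(1) p(2)] by blast
        have "e (?l [^]\<^bsub>M\<^esub> k \<odot>\<^bsub>?P\<^esub> r) = e s" using us p by simp
        then have "e s = \<zero>\<^bsub>D\<^esub>" using e_smult_0[OF l r(1)] r(2) by simp
        then have "s = \<zero>\<^bsub>?P\<^esub>" using small us by blast
        then have "f (?l [^]\<^bsub>M\<^esub> k \<odot>\<^bsub>?P\<^esub> r) = \<zero>\<^bsub>L\<^esub>" using us p fp by simp
        moreover have "f (?l [^]\<^bsub>M\<^esub> k \<odot>\<^bsub>?P\<^esub> r) = \<phi> ?l [^]\<^bsub>L\<^esub> k \<otimes>\<^bsub>L\<^esub> f r"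
          using eval_UP_smult[OF M.is_cring L.is_cring \<phi>(1) x(1) _ r(1), of "?l [^]\<^bsub>M\<^esub> k"] l by (simp add: f_def)
        moreover have "\<phi> ?l [^]\<^bsub>L\<^esub> k \<noteq> \<zero>\<^bsub>L\<^esub>" using L.nat_pow_nonzero \<phi>l l by simp
        ultimately show ?thesis using r l by (simp add: L.integral_iff)
      qed
      have "f (g \<otimes>\<^bsub>?P\<^esub> v \<ominus>\<^bsub>?P\<^esub> q) = \<zero>\<^bsub>L\<^esub>"
        using g v q by (intro ker) (auto simp: P.P.minus_eq D.r_neg)
      then have "f g \<otimes>\<^bsub>L\<^esub> f v = f q" using g v q by (simp add: P.P.minus_eq L.minus_eq[symmetric])
      also have "f q = \<phi> c"
        using eval_UP_const[OF M.is_cring L.is_cring \<phi>(1) x(1) c(1)] by (simp add: c(2) f_def)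
      finally have "f g \<noteq> \<zero>\<^bsub>L\<^esub>" using \<phi>l v g by auto
      then show "\<exists>x\<in>carrier L. UnivPoly.eval M L \<phi> x g \<noteq> \<zero>\<^bsub>L\<^esub> \<and>
        (\<forall>p\<in>carrier (UP M). UnivPoly.eval M D h t p = \<zero>\<^bsub>D\<^esub> \<longrightarrow> UnivPoly.eval M L \<phi> x p = \<zero>\<^bsub>L\<^esub>)"
        using x(1) ker by (intro bexI[of _ x]) (auto simp: f_def e_def)
    qed
  qed
qed

lemma hom_from_field_inj:
  assumes "field L" "domain D" "h \<in> ring_hom L D" "c \<in> carrier L" "h c = \<zero>\<^bsub>D\<^esub>"
  shows "c = \<zero>\<^bsub>L\<^esub>"
proof (rule ccontr)
  interpret L: field L by fact
  interpret D: "domain" D by fact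
  assume "c \<noteq> \<zero>\<^bsub>L\<^esub>"
  then have i: "inv\<^bsub>L\<^esub> c \<in> carrier L" "c \<otimes>\<^bsub>L\<^esub> inv\<^bsub>L\<^esub> c = \<one>\<^bsub>L\<^esub>"
    using assms(4) L.field_Units by auto
  then have "\<one>\<^bsub>D\<^esub> = h c \<otimes>\<^bsub>D\<^esub> h (inv\<^bsub>L\<^esub> c)"
    using ring_hom_memE[OF assms(3)] assms(4) by metis
  then show False using assms(5) i ring_hom_memE(1)[OF assms(3)] by simp
qed

text \<open>
  Density of the \<open>L\<close>-valued points of \<open>B\<close>, stated for subalgebras \<open>B\<close> of \<open>D\<close> so that it can be
  propagated by adjoining one element at a time.
\<close>

definition has_points :: "('l, 'n) ring_scheme \<Rightarrow> ('d, 'm) ring_scheme \<Rightarrow> ('l \<Rightarrow> 'd) \<Rightarrow> 'd set \<Rightarrow> bool"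
  where "has_points L D i B \<longleftrightarrow> subring B D \<and> i ` carrier L \<subseteq> B \<and>
    (\<forall>b\<in>B. b \<noteq> \<zero>\<^bsub>D\<^esub> \<longrightarrow>
      (\<exists>\<psi>\<in>ring_hom (D\<lparr>carrier := B\<rparr>) L. (\<forall>c\<in>carrier L. \<psi> (i c) = c) \<and> \<psi> b \<noteq> \<zero>\<^bsub>L\<^esub>))"

text \<open>
  The extended algebra is \<open>B[t]\<close>, the image of the evaluation of polynomials over \<open>B\<close> at \<open>t\<close>.  A point
  of \<open>B\<close> and a compatible value of \<open>t\<close> define a point of \<open>B[t]\<close>, and \<open>extend_point\<close> provides them.
\<close>

lemma has_points_adjoin:
  assumes D: "domain D" and L: "algebraically_closed L" and i: "i \<in> ring_hom L D"
    and B: "has_points L D i B" and t: "t \<in> carrier D"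
  obtains B' where "has_points L D i B'" "B \<subseteq> B'" "t \<in> B'"
proof -
  interpret D: "domain" D by fact
  interpret L: algebraically_closed L by fact
  have sub: "subring B D" and iB: "i ` carrier L \<subseteq> B" using B by (auto simp: has_points_def)
  have BD: "B \<subseteq> carrier D" using subringE(1)[OF sub] .
  define M where "M = D\<lparr>carrier := B\<rparr>"
  have Ms: "carrier M = B" "\<zero>\<^bsub>M\<^esub> = \<zero>\<^bsub>D\<^esub>" "\<one>\<^bsub>M\<^esub> = \<one>\<^bsub>D\<^esub>" "(\<oplus>\<^bsub>M\<^esub>) = (\<oplus>\<^bsub>D\<^esub>)" "(\<otimes>\<^bsub>M\<^esub>) = (\<otimes>\<^bsub>D\<^esub>)"
    by (simp_all add: M_def)
  have Mdom: "domain M" unfolding M_def by (rule D.subring_is_domain[OF sub])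
  then interpret M: "domain" M .
  interpret P: UP_domain M "UP M" by unfold_locales simp
  have h: "(\<lambda>x. x) \<in> ring_hom M D" using BD by (intro ring_hom_memI) (auto simp: Ms)
  define e where "e = UnivPoly.eval M D (\<lambda>x. x) t"
  note eh = eval_UP_hom[OF M.is_cring D.is_cring h t, folded e_def]
  interpret e: ring_hom_cring "UP M" D e
    by (rule ring_hom_cring_from_hom[OF P.P.is_cring D.is_cring eh])
  have e_const: "e (up_ring.monom (UP M) a 0) = a" if "a \<in> B" for a
    using eval_UP_const[OF M.is_cring D.is_cring h t] that by (simp add: e_def Ms)
  have e_var: "e (up_ring.monom (UP M) \<one>\<^bsub>M\<^esub> 1) = t"
    using eval_UP_var[OF M.is_cring D.is_cring h t] by (simp add: e_def)
  define B' where "B' = e ` carrier (UP M)"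
  have mem: "e p \<in> B'" if "p \<in> carrier (UP M)" for p using that by (auto simp: B'_def)
  have BB': "B \<subseteq> B'"
  proof
    fix a assume "a \<in> B"
    then show "a \<in> B'" using mem[of "up_ring.monom (UP M) a 0"] e_const by (simp add: Ms)
  qed
  have "t \<in> B'" using mem[of "up_ring.monom (UP M) \<one>\<^bsub>M\<^esub> 1"] e_var by simp
  have "subring B' D"
    unfolding B'_def
  proof (rule ring_hom_ring.img_is_subring)
    show "ring_hom_ring (UP M) D e" by (rule ring_hom_ringI2[OF P.P.ring_axioms D.ring_axioms eh])
    show "subring (carrier (UP M)) (UP M)" by (rule P.P.carrier_is_subring)
  qed
  moreover have "\<exists>\<psi>\<in>ring_hom (D\<lparr>carrier := B'\<rparr>) L. (\<forall>c\<in>carrier L. \<psi> (i c) = c) \<and> \<psi> b \<noteq> \<zero>\<^bsub>L\<^esub>"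
    if b: "b \<in> B'" "b \<noteq> \<zero>\<^bsub>D\<^esub>" for b
  proof -
    obtain g where g: "g \<in> carrier (UP M)" "b = e g" using b by (auto simp: B'_def)
    obtain a where a: "a \<in> B" "a \<noteq> \<zero>\<^bsub>D\<^esub>"
      and ext: "\<And>\<phi>. \<phi> \<in> ring_hom M L \<Longrightarrow> \<phi> a \<noteq> \<zero>\<^bsub>L\<^esub> \<Longrightarrow> \<exists>x\<in>carrier L. UnivPoly.eval M L \<phi> x g \<noteq> \<zero>\<^bsub>L\<^esub> \<and>
        (\<forall>p\<in>carrier (UP M). e p = \<zero>\<^bsub>D\<^esub> \<longrightarrow> UnivPoly.eval M L \<phi> x p = \<zero>\<^bsub>L\<^esub>)"
      using extend_point[OF Mdom D L h _ t g(1)] b(2) g(2) unfolding e_def[symmetric] Ms by metis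
    obtain \<phi> where \<phi>: "\<phi> \<in> ring_hom M L" "\<And>c. c \<in> carrier L \<Longrightarrow> \<phi> (i c) = c" "\<phi> a \<noteq> \<zero>\<^bsub>L\<^esub>"
      using B a by (auto simp: has_points_def M_def)
    obtain x where x: "x \<in> carrier L" "UnivPoly.eval M L \<phi> x g \<noteq> \<zero>\<^bsub>L\<^esub>"
      and ker: "\<And>p. p \<in> carrier (UP M) \<Longrightarrow> e p = \<zero>\<^bsub>D\<^esub> \<Longrightarrow> UnivPoly.eval M L \<phi> x p = \<zero>\<^bsub>L\<^esub>"
      using ext[OF \<phi>(1,3)] by blast
    define f where "f = UnivPoly.eval M L \<phi> x"
    interpret f: ring_hom_cring "UP M" L f
      unfolding f_def
      by (rule ring_hom_cring_from_hom[OF P.P.is_cring L.is_cring eval_UP_hom[OF M.is_cring L.is_cring \<phi>(1) x(1)]])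
    have f_eq: "f p = f q" if pq: "p \<in> carrier (UP M)" "q \<in> carrier (UP M)" "e p = e q" for p q
    proof -
      have "e (p \<ominus>\<^bsub>UP M\<^esub> q) = \<zero>\<^bsub>D\<^esub>" using pq by (simp add: P.P.minus_eq D.r_neg)
      then have "f (p \<ominus>\<^bsub>UP M\<^esub> q) = \<zero>\<^bsub>L\<^esub>" using ker pq by (simp add: f_def)
      then show ?thesis using pq by (simp add: P.P.minus_eq L.minus_eq[symmetric])
    qed
    define \<psi> where "\<psi> y = f (SOME p. p \<in> carrier (UP M) \<and> e p = y)" for y
    have \<psi>: "\<psi> (e p) = f p" if "p \<in> carrier (UP M)" for p
    proof -
      have "(SOME q. q \<in> carrier (UP M) \<and> e q = e p) \<in> carrier (UP M) \<and> e (SOME q. q \<in> carrier (UP M) \<and> e q = e p) = e p"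
        by (rule someI[of _ p]) (use that in simp)
      then show ?thesis unfolding \<psi>_def using f_eq that by blast
    qed
    have "\<psi> \<in> ring_hom (D\<lparr>carrier := B'\<rparr>) L"
    proof (rule ring_hom_memI)
      fix y z assume "y \<in> carrier (D\<lparr>carrier := B'\<rparr>)"
      then obtain p where p: "p \<in> carrier (UP M)" "y = e p" by (auto simp: B'_def)
      then show "\<psi> y \<in> carrier L" by (simp add: \<psi>)
      assume "z \<in> carrier (D\<lparr>carrier := B'\<rparr>)"
      then obtain q where q: "q \<in> carrier (UP M)" "z = e q" by (auto simp: B'_def)
      show "\<psi> (y \<otimes>\<^bsub>D\<lparr>carrier := B'\<rparr>\<^esub> z) = \<psi> y \<otimes>\<^bsub>L\<^esub> \<psi> z"
        using \<psi>[of "p \<otimes>\<^bsub>UP M\<^esub> q"] p q by (simp add: \<psi>)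
      show "\<psi> (y \<oplus>\<^bsub>D\<lparr>carrier := B'\<rparr>\<^esub> z) = \<psi> y \<oplus>\<^bsub>L\<^esub> \<psi> z"
        using \<psi>[of "p \<oplus>\<^bsub>UP M\<^esub> q"] p q by (simp add: \<psi>)
    next
      show "\<psi> \<one>\<^bsub>D\<lparr>carrier := B'\<rparr>\<^esub> = \<one>\<^bsub>L\<^esub>" using \<psi>[of "\<one>\<^bsub>UP M\<^esub>"] by simp
    qed
    moreover have "\<psi> (i c) = c" if c: "c \<in> carrier L" for c
    proof -
      have "i c \<in> B" using c iB by auto
      then have "\<psi> (i c) = \<phi> (i c)"
        using \<psi>[of "up_ring.monom (UP M) (i c) 0"] e_const eval_UP_const[OF M.is_cring L.is_cring \<phi>(1) x(1)]
        by (simp add: Ms f_def)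
      then show ?thesis using \<phi>(2) c by simp
    qed
    moreover have "\<psi> b \<noteq> \<zero>\<^bsub>L\<^esub>" using g \<psi> x by (simp add: f_def)
    ultimately show ?thesis by blast
  qed
  ultimately have "has_points L D i B'" using iB BB' by (auto simp: has_points_def)
  then show thesis using that BB' \<open>t \<in> B'\<close> by blast
qed

lemma domain_has_points:
  assumes D: "domain D" and L: "algebraically_closed L" and i: "i \<in> ring_hom L D"
    and F: "finite F" "F \<subseteq> carrier D"
  shows "\<exists>B. has_points L D i B \<and> F \<subseteq> B"
  using F
proof (induction F)
  case empty
  interpret D: "domain" D by fact
  interpret L: algebraically_closed L by fact
  have inj: "c = d" if cd: "c \<in> carrier L" "d \<in> carrier L" "i c = i d" for c d
  proof -
    interpret i: ring_hom_cring L D i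
      by (rule ring_hom_cring_from_hom[OF L.is_cring D.is_cring i])
    have "i (c \<ominus>\<^bsub>L\<^esub> d) = \<zero>\<^bsub>D\<^esub>" using cd by (simp add: L.minus_eq D.r_neg)
    then show ?thesis
      using hom_from_field_inj[OF L.field_axioms D i, of "c \<ominus>\<^bsub>L\<^esub> d"] cd by simp
  qed
  define \<psi> where "\<psi> = inv_into (carrier L) i"
  have \<psi>: "\<psi> (i c) = c" if "c \<in> carrier L" for c
    unfolding \<psi>_def using that inj by (intro inv_into_f_f inj_onI)
  have "subring (i ` carrier L) D"
    using ring_hom_ring.img_is_subring[OF ring_hom_ringI2[OF L.ring_axioms D.ring_axioms i] L.carrier_is_subring] .
  moreover have \<psi>_hom: "\<psi> \<in> ring_hom (D\<lparr>carrier := i ` carrier L\<rparr>) L"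
    using \<psi> ring_hom_memE(2-4)[OF i, symmetric] by (intro ring_hom_memI) auto
  moreover have "\<psi> b \<noteq> \<zero>\<^bsub>L\<^esub>" if "b \<in> i ` carrier L" "b \<noteq> \<zero>\<^bsub>D\<^esub>" for b
    using that \<psi> ring_hom_zero[OF i L.ring_axioms D.ring_axioms] by auto
  ultimately have "has_points L D i (i ` carrier L)"
    using \<psi> unfolding has_points_def by (intro conjI ballI impI bexI[OF _ \<psi>_hom]) simp_all
  then show ?case by blast
next
  case (insert t F)
  then obtain B where "has_points L D i B" "F \<subseteq> B" by auto
  then show ?case using has_points_adjoin[OF D L i, of B t] insert.prems by (metis insert_subset order_trans)
qed

text \<open>
  The Nullstellensatz for reduced algebras over an algebraically closed field.  A prime ideal that
  does not contain \<open>s\<close> reduces it to domains; \<open>B\<close> is the preimage of an algebra of finite type in the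
  quotient by this prime ideal.
\<close>

lemma reduced_ring_point:
  assumes R: "cring R" "reduced_ring R" and L: "algebraically_closed L" and i: "i \<in> ring_hom L R"
    and F: "finite F" "F \<subseteq> carrier R" and s: "s \<in> F" "s \<noteq> \<zero>\<^bsub>R\<^esub>"
  obtains B \<psi> where "subring B R" "i ` carrier L \<subseteq> B" "F \<subseteq> B" "\<psi> \<in> ring_hom (R\<lparr>carrier := B\<rparr>) L"
    "\<And>c. c \<in> carrier L \<Longrightarrow> \<psi> (i c) = c" "\<psi> s \<noteq> \<zero>\<^bsub>L\<^esub>"
proof -
  interpret R: cring R by fact
  have sR: "s \<in> carrier R" using F s by auto
  have "s [^]\<^bsub>R\<^esub> n \<noteq> \<zero>\<^bsub>R\<^esub>" for n :: nat using R(2) sR s(2) by (auto simp: reduced_ring_def)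
  then obtain P where P: "primeideal P R" "s \<notin> P"
    using exists_prime_avoiding_powers[OF R(1) sR] by blast
  interpret P: primeideal P R by fact
  define D where "D = R Quot P"
  define \<pi> where "\<pi> = (\<lambda>x. P +>\<^bsub>R\<^esub> x)"
  have D: "domain D" unfolding D_def by (rule P.quotient_is_domain)
  interpret D: "domain" D by fact
  have \<pi>: "\<pi> \<in> ring_hom R D" unfolding \<pi>_def D_def by (rule P.rcos_ring_hom)
  interpret \<pi>: ring_hom_cring R D \<pi> by (rule ring_hom_cring_from_hom[OF R(1) D.is_cring \<pi>])
  have \<pi>s: "\<pi> s \<noteq> \<zero>\<^bsub>D\<^esub>"
    using P.rcos_const_imp_mem[OF sR] P(2) by (auto simp: \<pi>_def D_def FactRing_def)
  have iD: "\<pi> \<circ> i \<in> ring_hom L D" using i \<pi> by (rule ring_hom_trans)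
  obtain B where B: "has_points L D (\<pi> \<circ> i) B" "\<pi> ` F \<subseteq> B"
    using domain_has_points[OF D L iD, of "\<pi> ` F"] F by auto
  then have subB: "subring B D" and iB: "(\<pi> \<circ> i) ` carrier L \<subseteq> B" by (auto simp: has_points_def)
  obtain \<psi> where \<psi>: "\<psi> \<in> ring_hom (D\<lparr>carrier := B\<rparr>) L" "\<And>c. c \<in> carrier L \<Longrightarrow> \<psi> (\<pi> (i c)) = c" "\<psi> (\<pi> s) \<noteq> \<zero>\<^bsub>L\<^esub>"
    using B s(1) \<pi>s unfolding has_points_def comp_def by (metis image_subset_iff)
  define B' where "B' = {r \<in> carrier R. \<pi> r \<in> B}"
  have "subring B' R"
    using subringE[OF subB] by (intro R.subringI) (auto simp: B'_def)
  moreover have "i ` carrier L \<subseteq> B'" using iB ring_hom_memE(1)[OF i] by (auto simp: B'_def)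
  moreover have "F \<subseteq> B'" using F B(2) by (auto simp: B'_def)
  moreover have "\<psi> \<circ> \<pi> \<in> ring_hom (R\<lparr>carrier := B'\<rparr>) L"
    using ring_hom_memE[OF \<psi>(1)] by (intro ring_hom_memI) (auto simp: B'_def)
  ultimately show thesis using that \<psi> by auto
qed

section \<open>Geometric reducedness\<close>

definition geom_reduced_alg :: "'k ring \<Rightarrow> ('k, 'a) module \<Rightarrow> bool"
  where "geom_reduced_alg K A \<longleftrightarrow> reduced_ring (tensor K A (alg_closure_alg K))"

lemma alg_via_simps [simp]:
  "carrier (alg_via h L) = carrier L" "(\<otimes>\<^bsub>alg_via h L\<^esub>) = (\<otimes>\<^bsub>L\<^esub>)" "\<one>\<^bsub>alg_via h L\<^esub> = \<one>\<^bsub>L\<^esub>"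
  "(\<oplus>\<^bsub>alg_via h L\<^esub>) = (\<oplus>\<^bsub>L\<^esub>)" "\<zero>\<^bsub>alg_via h L\<^esub> = \<zero>\<^bsub>L\<^esub>" "c \<odot>\<^bsub>alg_via h L\<^esub> x = h c \<otimes>\<^bsub>L\<^esub> x"
  by (simp_all add: alg_via_def)

lemma alg_via_algebra:
  assumes "cring K" "cring L" and h: "h \<in> ring_hom K L"
  shows "algebra K (alg_via h L)"
proof -
  interpret K: cring K by fact
  interpret L: cring L by fact
  note hs = ring_hom_memE[OF h]
  have "cring (alg_via h L)"
    by (intro cringI abelian_groupI comm_monoidI)
      (auto simp: L.m_ac L.a_ac L.l_distr L.r_distr intro: L.a_inv_closed L.l_neg bexI[of _ "\<ominus>\<^bsub>L\<^esub> x" for x])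
  then show ?thesis
    using hs by (intro algebraI) (auto simp: K.is_cring L.l_distr L.r_distr L.m_assoc)
qed

context
  fixes K :: "'k ring"
  assumes K: "field K"
begin

interpretation K: field K by (rule K)

lemma closure_closed: "algebraically_closed (field.alg_closure K)"
proof -
  interpret algebraic_closure "field.alg_closure K" "ring.indexed_const K ` carrier K"
    by (rule K.alg_closureE(1))
  show ?thesis by (rule algebraically_closed_axioms)
qed

lemma closure_algebra: "algebra K (alg_closure_alg K)"
proof -
  interpret algebraically_closed "field.alg_closure K" by (rule closure_closed)
  show ?thesis by (rule alg_via_algebra[OF K.is_cring is_cring K.alg_closureE(2)])
qed

lemma base_algebra: "algebra K (base_alg K)"
  by (rule alg_via_algebra[OF K.is_cring K.is_cring]) (auto intro: ring_hom_memI)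

end

lemma reduced_ring_inj:
  assumes "algebra K A" "algebra K B" "f \<in> alg_hom K A B"
    and inj: "\<And>a. a \<in> carrier A \<Longrightarrow> f a = \<zero>\<^bsub>B\<^esub> \<Longrightarrow> a = \<zero>\<^bsub>A\<^esub>" and "reduced_ring B"
  shows "reduced_ring A"
  unfolding reduced_ring_def
proof (intro ballI allI impI)
  fix x and n :: nat assume x: "x \<in> carrier A" "x [^]\<^bsub>A\<^esub> n = \<zero>\<^bsub>A\<^esub>"
  then have "f x [^]\<^bsub>B\<^esub> n = \<zero>\<^bsub>B\<^esub>"
    using alg_hom_pow[OF assms(1-3) x(1), of n] alg_hom_zero[OF assms(1-3)] by simp
  then show "x = \<zero>\<^bsub>A\<^esub>"
    using assms(5) alg_hom_closed[OF assms(3) x(1)] inj x(1) unfolding reduced_ring_def by blast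
qed

lemma reduced_ring_retract:
  assumes A: "algebra K A" and B: "algebra K B" and f: "f \<in> alg_hom K A B" and g: "g \<in> alg_hom K B A"
    and "\<And>a. a \<in> carrier A \<Longrightarrow> g (f a) = a" and "reduced_ring B"
  shows "reduced_ring A"
proof (rule reduced_ring_inj[OF A B f _ assms(6)])
  fix a assume "a \<in> carrier A" "f a = \<zero>\<^bsub>B\<^esub>"
  then show "a = \<zero>\<^bsub>A\<^esub>" using assms(5)[of a] alg_hom_zero[OF B A g] by simp
qed

lemma geom_reduced_alg_inj:
  assumes K: "field K" and A: "algebra K A" and B: "algebra K B" and f: "f \<in> alg_hom K A B"
    and inj: "\<And>a. a \<in> carrier A \<Longrightarrow> f a = \<zero>\<^bsub>B\<^esub> \<Longrightarrow> a = \<zero>\<^bsub>A\<^esub>" and "geom_reduced_alg K B"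
  shows "geom_reduced_alg K A"
proof -
  note L = closure_algebra[OF K]
  show ?thesis
    unfolding geom_reduced_alg_def
  proof (rule reduced_ring_inj[OF tensor_algebra[OF A L] tensor_algebra[OF B L]])
    show "tensor_map K B (alg_closure_alg K) f (\<lambda>y. y)
      \<in> alg_hom K (tensor K A (alg_closure_alg K)) (tensor K B (alg_closure_alg K))"
      by (rule tensor_map_hom[OF A L B L f alg_hom_id])
    show "reduced_ring (tensor K B (alg_closure_alg K))"
      using assms(6) by (simp add: geom_reduced_alg_def)
  qed (use tensor_map_eq_zeroD[OF K A L B f inj] in blast)
qed

text \<open>The universal property of the tensor product, for use with several tensor products at once.\<close>

lemma
  assumes "algebra K A" "algebra K B"
  shows inl_hom: "tensor_inl K A B \<in> alg_hom K A (tensor K A B)"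
    and inr_hom: "tensor_inr K A B \<in> alg_hom K B (tensor K A B)"
  using tensor_pair.tensor_inl_hom tensor_pair.tensor_inr_hom tensor_pair.intro assms by blast+

lemma
  assumes "algebra K A" "algebra K B" "algebra K R" "f \<in> alg_hom K A R" "g \<in> alg_hom K B R"
  shows lift_hom: "tensor_lift R f g \<in> alg_hom K (tensor K A B) R"
    and lift_inl: "a \<in> carrier A \<Longrightarrow> tensor_lift R f g (tensor_inl K A B a) = f a"
    and lift_inr: "b \<in> carrier B \<Longrightarrow> tensor_lift R f g (tensor_inr K A B b) = g b"
  using tensor_pair.tensor_lift_hom tensor_pair.tensor_lift_inl tensor_pair.tensor_lift_inr
    tensor_pair.intro assms by metis+

lemma hom_ext:
  assumes "algebra K A" "algebra K B" "algebra K R"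
    and "F \<in> alg_hom K (tensor K A B) R" "G \<in> alg_hom K (tensor K A B) R"
    and "\<And>a. a \<in> carrier A \<Longrightarrow> F (tensor_inl K A B a) = G (tensor_inl K A B a)"
    and "\<And>b. b \<in> carrier B \<Longrightarrow> F (tensor_inr K A B b) = G (tensor_inr K A B b)"
    and "x \<in> carrier (tensor K A B)"
  shows "F x = G x"
proof -
  interpret tensor_pair K A B by (intro tensor_pair.intro assms)
  show ?thesis by (rule tensor_hom_ext) (use assms in auto)
qed

lemma reduced_tensor_swap:
  assumes A: "algebra K A" and B: "algebra K B" and "reduced_ring (tensor K A B)"
  shows "reduced_ring (tensor K B A)"
proof -
  note AB = tensor_algebra[OF A B] and BA = tensor_algebra[OF B A]
  define f where "f = tensor_lift (tensor K A B) (tensor_inr K A B) (tensor_inl K A B)"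
  define g where "g = tensor_lift (tensor K B A) (tensor_inr K B A) (tensor_inl K B A)"
  note f = lift_hom[OF B A AB inr_hom[OF A B] inl_hom[OF A B], folded f_def]
    lift_inl[OF B A AB inr_hom[OF A B] inl_hom[OF A B], folded f_def]
    lift_inr[OF B A AB inr_hom[OF A B] inl_hom[OF A B], folded f_def]
  note g = lift_hom[OF A B BA inr_hom[OF B A] inl_hom[OF B A], folded g_def]
    lift_inl[OF A B BA inr_hom[OF B A] inl_hom[OF B A], folded g_def]
    lift_inr[OF A B BA inr_hom[OF B A] inl_hom[OF B A], folded g_def]
  have "(\<lambda>x. g (f x)) x = x" if "x \<in> carrier (tensor K B A)" for x
    by (rule hom_ext[OF B A BA alg_hom_comp'[OF f(1) g(1)] alg_hom_id _ _ that]) (simp_all add: f g)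
  then show ?thesis using reduced_ring_retract[OF BA AB f(1) g(1)] assms(3) by simp
qed

text \<open>
  The isomorphism \<open>(A \<otimes> B) \<otimes> C \<rightarrow> (A \<otimes> C) \<otimes> B\<close> brings the base change next to one of the factors.
\<close>

lemma reduced_tensor_assoc_swap:
  assumes A: "algebra K A" and B: "algebra K B" and C: "algebra K C"
    and red: "reduced_ring (tensor K (tensor K A C) B)"
  shows "reduced_ring (tensor K (tensor K A B) C)"
proof -
  note AB = tensor_algebra[OF A B] and AC = tensor_algebra[OF A C]
  let ?U = "tensor K (tensor K A B) C" and ?V = "tensor K (tensor K A C) B"
  have U: "algebra K ?U" and V: "algebra K ?V" using AB AC B C tensor_algebra by blast+
  define f0 where "f0 = tensor_lift ?V (tensor_inl K (tensor K A C) B \<circ> tensor_inl K A C) (tensor_inr K (tensor K A C) B)"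
  define f where "f = tensor_lift ?V f0 (tensor_inl K (tensor K A C) B \<circ> tensor_inr K A C)"
  define g0 where "g0 = tensor_lift ?U (tensor_inl K (tensor K A B) C \<circ> tensor_inl K A B) (tensor_inr K (tensor K A B) C)"
  define g where "g = tensor_lift ?U g0 (tensor_inl K (tensor K A B) C \<circ> tensor_inr K A B)"
  note f1 = alg_hom_comp[OF inl_hom[OF A C] inl_hom[OF AC B]] inr_hom[OF AC B]
  note f0 = lift_hom[OF A B V f1, folded f0_def] lift_inl[OF A B V f1, folded f0_def] lift_inr[OF A B V f1, folded f0_def]
  note f2 = f0(1) alg_hom_comp[OF inr_hom[OF A C] inl_hom[OF AC B]]
  note f = lift_hom[OF AB C V f2, folded f_def] lift_inl[OF AB C V f2, folded f_def] lift_inr[OF AB C V f2, folded f_def]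
  note g1 = alg_hom_comp[OF inl_hom[OF A B] inl_hom[OF AB C]] inr_hom[OF AB C]
  note g0 = lift_hom[OF A C U g1, folded g0_def] lift_inl[OF A C U g1, folded g0_def] lift_inr[OF A C U g1, folded g0_def]
  note g2 = g0(1) alg_hom_comp[OF inr_hom[OF A B] inl_hom[OF AB C]]
  note g = lift_hom[OF AC B U g2, folded g_def] lift_inl[OF AC B U g2, folded g_def] lift_inr[OF AC B U g2, folded g_def]
  note cl = alg_hom_closed[OF inl_hom[OF A B]] alg_hom_closed[OF inr_hom[OF A B]]
    alg_hom_closed[OF inl_hom[OF A C]] alg_hom_closed[OF inr_hom[OF A C]]
  have 1: "g (f (tensor_inl K (tensor K A B) C u)) = tensor_inl K (tensor K A B) C u"
    if "u \<in> carrier (tensor K A B)" for u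
    by (rule hom_ext[OF A B U alg_hom_comp'[OF inl_hom[OF AB C] alg_hom_comp'[OF f(1) g(1)]] inl_hom[OF AB C] _ _ that])
      (simp_all add: f f0 g g0 cl)
  have "(\<lambda>x. g (f x)) x = x" if "x \<in> carrier ?U" for x
    by (rule hom_ext[OF AB C U alg_hom_comp'[OF f(1) g(1)] alg_hom_id _ _ that])
      (simp_all add: 1, simp add: f f0 g g0 cl)
  then show ?thesis using reduced_ring_retract[OF U V f(1) g(1)] red by simp
qed

lemma subalgebra_algebra:
  assumes A: "algebra K A" and "subring B A" and "\<And>c x. c \<in> carrier K \<Longrightarrow> x \<in> B \<Longrightarrow> c \<odot>\<^bsub>A\<^esub> x \<in> B"
  shows "algebra K (A\<lparr>carrier := B\<rparr>)"
proof -
  interpret A: algebra K A by (rule A)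
  have "subcring B A" using assms(2) A.subcringI' by blast
  then have "cring (A\<lparr>carrier := B\<rparr>)"
    using A.subcring_iff[of B] subringE(1)[OF assms(2)] by blast
  then show ?thesis
    using assms(3) subringE(1)[OF assms(2)]
    by (intro algebraI) (auto simp: A.R.is_cring A.smult_l_distr A.smult_r_distr A.smult_assoc1 A.smult_assoc2 subset_iff)
qed

text \<open>
  Suppose that a contraction \<open>s\<close> of the nilpotent element \<open>x\<close> is nonzero.  Some subalgebra \<open>B\<close> of
  \<open>R\<close> over which \<open>x\<close> is defined has a point \<open>\<psi>\<close> with values in \<open>L\<close> at which \<open>s\<close> does not vanish.  The
  image of \<open>x\<close> in \<open>L \<otimes> C\<close> is nilpotent, hence zero, whereas its contraction is \<open>\<psi> s\<close>.
\<close>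

lemma reduced_tensor_over_closure:
  assumes K: "field K" and R: "algebra K R" "reduced_ring R" and j: "j \<in> alg_hom K (alg_closure_alg K) R"
    and C: "algebra K C" "geom_reduced_alg K C"
  shows "reduced_ring (tensor K R C)"
  unfolding reduced_ring_def
proof (intro ballI allI impI)
  fix x and n :: nat
  assume x: "x \<in> carrier (tensor K R C)" and xn: "x [^]\<^bsub>tensor K R C\<^esub> n = \<zero>\<^bsub>tensor K R C\<^esub>"
  let ?L = "alg_closure_alg K"
  let ?E = "field.alg_closure K"
  note L = closure_algebra[OF K]
  interpret R: algebra K R by fact
  interpret L: algebra K ?L by (rule L)
  interpret RC: tensor_pair K R C by (intro tensor_pair.intro R C)
  interpret LC: tensor_pair K ?L C by (intro tensor_pair.intro L C)
  show "x = \<zero>\<^bsub>tensor K R C\<^esub>"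
  proof (rule RC.zero_if_contractions_zero[OF K x], rule ccontr)
    fix l assume l: "l \<in> linear_forms K C" and "contraction R l x \<noteq> \<zero>\<^bsub>R\<^esub>"
    moreover define s where "s = contraction R l x"
    ultimately have s: "s \<noteq> \<zero>\<^bsub>R\<^esub>" "s \<in> carrier R" using RC.contraction_closed[OF l x] by auto
    obtain xs where xs: "xs \<in> formal_sums R C" "x = tensor_class K R C xs" using x by (metis RC.carrierE)
    have jr: "j \<in> ring_hom ?E R" using j by (auto simp: alg_hom_def ring_hom_def)
    have F: "finite (insert s (fst ` set xs))" "insert s (fst ` set xs) \<subseteq> carrier R"
      using RC.formalD[OF xs(1)] s by auto
    obtain B \<psi> where B: "subring B R" "j ` carrier ?E \<subseteq> B" "insert s (fst ` set xs) \<subseteq> B"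
      and \<psi>: "\<psi> \<in> ring_hom (R\<lparr>carrier := B\<rparr>) ?E" "\<And>c. c \<in> carrier ?E \<Longrightarrow> \<psi> (j c) = c" "\<psi> s \<noteq> \<zero>\<^bsub>?E\<^esub>"
      using reduced_ring_point[OF R.M_cring R(2) closure_closed[OF K] jr F _ s(1)] by blast
    have BR: "B \<subseteq> carrier R" using subringE(1)[OF B(1)] .
    have sc: "c \<odot>\<^bsub>?L\<^esub> \<one>\<^bsub>?L\<^esub> \<in> carrier ?L" "j (c \<odot>\<^bsub>?L\<^esub> \<one>\<^bsub>?L\<^esub>) = c \<odot>\<^bsub>R\<^esub> \<one>\<^bsub>R\<^esub>" if "c \<in> carrier K" for c
      using that L.smult_closed[OF that L.one_closed] alg_hom_smult[OF j that L.one_closed] alg_hom_one[OF j]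
      by metis+
    have c1: "c \<odot>\<^bsub>R\<^esub> \<one>\<^bsub>R\<^esub> \<in> B" "\<psi> (c \<odot>\<^bsub>R\<^esub> \<one>\<^bsub>R\<^esub>) = c \<odot>\<^bsub>?L\<^esub> \<one>\<^bsub>?L\<^esub>" if "c \<in> carrier K" for c
      using sc[OF that] B(2) \<psi>(2) by (metis alg_via_simps(1) image_subset_iff)+
    have cr: "c \<odot>\<^bsub>R\<^esub> r = (c \<odot>\<^bsub>R\<^esub> \<one>\<^bsub>R\<^esub>) \<otimes>\<^bsub>R\<^esub> r" if "c \<in> carrier K" "r \<in> B" for c r
      using that BR R.smult_assoc2[of c "\<one>\<^bsub>R\<^esub>" r] by auto
    let ?R = "R\<lparr>carrier := B\<rparr>"
    have R': "algebra K ?R"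
      using subringE(6)[OF B(1)] c1 cr by (intro subalgebra_algebra[OF R(1) B(1)]) auto
    have \<psi>': "\<psi> \<in> alg_hom K ?R ?L"
    proof (rule alg_homI)
      fix c r assume cr': "c \<in> carrier K" "r \<in> carrier ?R"
      have "\<psi> (c \<odot>\<^bsub>R\<^esub> r) = \<psi> (c \<odot>\<^bsub>R\<^esub> \<one>\<^bsub>R\<^esub>) \<otimes>\<^bsub>?L\<^esub> \<psi> r"
        using cr cr' c1 ring_hom_memE(2)[OF \<psi>(1), of "c \<odot>\<^bsub>R\<^esub> \<one>\<^bsub>R\<^esub>" r] by simp
      then show "\<psi> (c \<odot>\<^bsub>?R\<^esub> r) = c \<odot>\<^bsub>?L\<^esub> \<psi> r"
        using cr' c1 L.smult_assoc2[of c "\<one>\<^bsub>?L\<^esub>" "\<psi> r"] L.l_one L.one_closed ring_hom_memE(1)[OF \<psi>(1), of r] by simp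
    qed (use ring_hom_memE[OF \<psi>(1)] in auto)
    have inc: "(\<lambda>r. r) \<in> alg_hom K ?R R" using BR by (intro alg_homI) auto
    interpret R'C: tensor_pair K ?R C by (intro tensor_pair.intro R' C)
    have xs': "xs \<in> formal_sums ?R C"
      using B(3) RC.formalD[OF xs(1)] by (auto simp: formal_sums_def in_lists_conv_set)
    define x' where "x' = tensor_class K ?R C xs"
    have x': "x' \<in> carrier (tensor K ?R C)" using xs' by (simp add: x'_def)
    let ?i = "tensor_map K R C (\<lambda>r. r) (\<lambda>c. c)"
    have ix: "?i x' = x"
      using tensor_map_class(2)[OF R' C(1) R(1) C(1) inc alg_hom_id xs'] by (simp add: x'_def xs(2))
    have i_hom: "?i \<in> alg_hom K (tensor K ?R C) (tensor K R C)"
      by (rule tensor_map_hom[OF R' C(1) R(1) C(1) inc alg_hom_id])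
    have "?i (x' [^]\<^bsub>tensor K ?R C\<^esub> n) = \<zero>\<^bsub>tensor K R C\<^esub>"
      using alg_hom_pow[OF R'C.T_algebra RC.T_algebra i_hom x', of n] ix xn by simp
    moreover have "x' [^]\<^bsub>tensor K ?R C\<^esub> n \<in> carrier (tensor K ?R C)"
    proof -
      interpret T: algebra K "tensor K ?R C" by (rule R'C.T_algebra)
      show ?thesis using x' by simp
    qed
    ultimately have x'n: "x' [^]\<^bsub>tensor K ?R C\<^esub> n = \<zero>\<^bsub>tensor K ?R C\<^esub>"
      by (intro tensor_map_eq_zeroD[OF K R' C(1) R(1) inc]) auto
    let ?p = "tensor_map K ?L C \<psi> (\<lambda>c. c)"
    have p_hom: "?p \<in> alg_hom K (tensor K ?R C) (tensor K ?L C)"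
      by (rule tensor_map_hom[OF R' C(1) L C(1) \<psi>' alg_hom_id])
    have "?p x' [^]\<^bsub>tensor K ?L C\<^esub> n = \<zero>\<^bsub>tensor K ?L C\<^esub>"
      using alg_hom_pow[OF R'C.T_algebra LC.T_algebra p_hom x', of n] x'n
        alg_hom_zero[OF R'C.T_algebra LC.T_algebra p_hom] by simp
    moreover have "reduced_ring (tensor K ?L C)"
      using reduced_tensor_swap[OF C(1) L] C(2) by (simp add: geom_reduced_alg_def)
    ultimately have "?p x' = \<zero>\<^bsub>tensor K ?L C\<^esub>"
      using alg_hom_closed[OF p_hom x'] unfolding reduced_ring_def by blast
    moreover have "contraction ?L l \<zero>\<^bsub>tensor K ?L C\<^esub> = \<zero>\<^bsub>?L\<^esub>"
      using l by (simp add: LC.T_zero LC.contraction_cls)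
    ultimately have "\<psi> (contraction ?R l x') = \<zero>\<^bsub>?L\<^esub>"
      using contraction_tensor_map[OF R' C(1) L \<psi>' l x'] by simp
    moreover have "contraction ?R l x' = s"
      using contraction_tensor_map[OF R' C(1) R(1) inc l x'] ix by (simp add: s_def)
    ultimately show False using \<psi>(3) by simp
  qed
qed

lemma geom_reduced_tensor:
  assumes K: "field K" and A: "algebra K A" "geom_reduced_alg K A" and B: "algebra K B" "geom_reduced_alg K B"
  shows "geom_reduced_alg K (tensor K A B)"
proof -
  note L = closure_algebra[OF K]
  have "reduced_ring (tensor K (tensor K A (alg_closure_alg K)) B)"
    using reduced_tensor_over_closure[OF K tensor_algebra[OF A(1) L] _ inr_hom[OF A(1) L] B] A(2)
    by (simp add: geom_reduced_alg_def)
  then show ?thesis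
    unfolding geom_reduced_alg_def by (rule reduced_tensor_assoc_swap[OF A(1) B(1) L])
qed

text \<open>
  The algebra \<open>K \<otimes> L\<close> is the field \<open>L\<close>.
\<close>

lemma geom_reduced_base:
  assumes K: "field K"
  shows "geom_reduced_alg K (base_alg K)"
proof -
  let ?L = "alg_closure_alg K"
  note L = closure_algebra[OF K] and B = base_algebra[OF K]
  interpret K: field K by fact
  interpret L0: algebraically_closed "field.alg_closure K" by (rule closure_closed[OF K])
  interpret L: algebra K ?L by (rule L)
  note h = ring_hom_memE[OF K.alg_closureE(2)]
  have s: "ring.indexed_const K \<in> alg_hom K (base_alg K) ?L"
    by (intro alg_homI) (use h in auto)
  define f where "f = tensor_lift ?L (ring.indexed_const K) (\<lambda>y. y)"
  note f = lift_hom[OF B L L s alg_hom_id, folded f_def] lift_inl[OF B L L s alg_hom_id, folded f_def]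
    lift_inr[OF B L L s alg_hom_id, folded f_def]
  let ?T = "tensor K (base_alg K) ?L"
  note T = tensor_algebra[OF B L]
  have "tensor_inr K (base_alg K) ?L (ring.indexed_const K c) = tensor_inl K (base_alg K) ?L c"
    if c: "c \<in> carrier K" for c
  proof -
    have "ring.indexed_const K c = c \<odot>\<^bsub>?L\<^esub> \<one>\<^bsub>?L\<^esub>" using c h(1) by simp
    then have "tensor_inr K (base_alg K) ?L (ring.indexed_const K c) = c \<odot>\<^bsub>?T\<^esub> \<one>\<^bsub>?T\<^esub>"
      using alg_hom_smult[OF inr_hom[OF B L] c L.one_closed] alg_hom_one[OF inr_hom[OF B L]] by simp
    also have "\<dots> = tensor_inl K (base_alg K) ?L (c \<odot>\<^bsub>base_alg K\<^esub> \<one>\<^bsub>base_alg K\<^esub>)"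
      using alg_hom_smult[OF inl_hom[OF B L] c, of "\<one>\<^bsub>base_alg K\<^esub>"] alg_hom_one[OF inl_hom[OF B L]] by simp
    finally show ?thesis using c by simp
  qed
  then have "(\<lambda>x. tensor_inr K (base_alg K) ?L (f x)) x = x" if "x \<in> carrier ?T" for x
    by (intro hom_ext[OF B L T alg_hom_comp'[OF f(1) inr_hom[OF B L]] alg_hom_id _ _ that]) (simp_all add: f)
  moreover have "reduced_ring ?L"
    unfolding reduced_ring_def
  proof (intro ballI allI impI)
    fix x and n :: nat assume x: "x \<in> carrier ?L" "x [^]\<^bsub>?L\<^esub> n = \<zero>\<^bsub>?L\<^esub>"
    have "(\<lambda>x. x) \<in> ring_hom ?L (field.alg_closure K)" by (intro ring_hom_memI) auto
    then have "x [^]\<^bsub>field.alg_closure K\<^esub> n = \<zero>\<^bsub>field.alg_closure K\<^esub>"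
      using ring_hom_pow[OF L.M_cring L0.is_cring _ x(1), of "\<lambda>x. x" n] x(2) by simp
    then show "x = \<zero>\<^bsub>?L\<^esub>" using L0.nat_pow_nonzero[of x n] x(1) by auto
  qed
  ultimately show ?thesis
    unfolding geom_reduced_alg_def using reduced_ring_retract[OF T L f(1) inr_hom[OF B L]] by simp
qed

section \<open>Quotients and the largest geometrically reduced quotient\<close>

text \<open>
  The universal property of the push-out only concerns groups whose coordinate rings are carried by
  the type of the given ones.  Quotients are therefore formed on a set of representatives
  instead of the set of cosets.
\<close>

definition representative :: "('k, 'a) module \<Rightarrow> 'a set \<Rightarrow> 'a \<Rightarrow> 'a"
  where "representative A J a = (SOME b. b \<in> carrier A \<and> a \<ominus>\<^bsub>A\<^esub> b \<in> J)"

definition quotient_alg :: "('k, 'a) module \<Rightarrow> 'a set \<Rightarrow> ('k, 'a) module"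
  where "quotient_alg A J =
    \<lparr>carrier = representative A J ` carrier A,
     monoid.mult = (\<lambda>x y. representative A J (x \<otimes>\<^bsub>A\<^esub> y)), one = representative A J \<one>\<^bsub>A\<^esub>,
     zero = representative A J \<zero>\<^bsub>A\<^esub>, add = (\<lambda>x y. representative A J (x \<oplus>\<^bsub>A\<^esub> y)),
     smult = (\<lambda>c x. representative A J (c \<odot>\<^bsub>A\<^esub> x))\<rparr>"

locale algebra_ideal = A: algebra K A + J: ideal J A
  for K :: "'k ring" and A :: "('k, 'a) module" and J
begin

abbreviation rep where "rep \<equiv> representative A J"
abbreviation Q where "Q \<equiv> quotient_alg A J"

lemma rep_props:
  assumes "a \<in> carrier A"
  shows rep_closed: "rep a \<in> carrier A" and rep_diff: "a \<ominus>\<^bsub>A\<^esub> rep a \<in> J"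
proof -
  have "a \<in> carrier A \<and> a \<ominus>\<^bsub>A\<^esub> a \<in> J" using assms by (simp add: A.minus_eq A.M.r_neg)
  from someI[of "\<lambda>b. b \<in> carrier A \<and> a \<ominus>\<^bsub>A\<^esub> b \<in> J", OF this]
  show "rep a \<in> carrier A" "a \<ominus>\<^bsub>A\<^esub> rep a \<in> J" by (simp_all add: representative_def)
qed

lemma diff_sym: "a \<in> carrier A \<Longrightarrow> b \<in> carrier A \<Longrightarrow> a \<ominus>\<^bsub>A\<^esub> b \<in> J \<Longrightarrow> b \<ominus>\<^bsub>A\<^esub> a \<in> J"
  using J.a_inv_closed[of "a \<ominus>\<^bsub>A\<^esub> b"] by (simp add: A.minus_eq A.minus_add A.M.a_comm)

lemma diff_trans:
  assumes "a \<in> carrier A" "b \<in> carrier A" "c \<in> carrier A" "a \<ominus>\<^bsub>A\<^esub> b \<in> J" "b \<ominus>\<^bsub>A\<^esub> c \<in> J"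
  shows "a \<ominus>\<^bsub>A\<^esub> c \<in> J"
proof -
  have "a \<ominus>\<^bsub>A\<^esub> c = (a \<ominus>\<^bsub>A\<^esub> b) \<oplus>\<^bsub>A\<^esub> (b \<ominus>\<^bsub>A\<^esub> c)"
    using assms(1-3) by (simp add: A.minus_eq A.M.a_assoc A.M.r_neg1)
  then show ?thesis using J.a_closed assms(4,5) by simp
qed

lemma rep_eq_iff:
  assumes "a \<in> carrier A" "b \<in> carrier A"
  shows "rep a = rep b \<longleftrightarrow> a \<ominus>\<^bsub>A\<^esub> b \<in> J"
proof
  assume "rep a = rep b"
  then show "a \<ominus>\<^bsub>A\<^esub> b \<in> J"
    using rep_props[OF assms(1)] rep_props[OF assms(2)] assms diff_trans diff_sym by metis
next
  assume "a \<ominus>\<^bsub>A\<^esub> b \<in> J"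
  then have "(\<lambda>c. c \<in> carrier A \<and> a \<ominus>\<^bsub>A\<^esub> c \<in> J) = (\<lambda>c. c \<in> carrier A \<and> b \<ominus>\<^bsub>A\<^esub> c \<in> J)"
    using assms diff_trans diff_sym by blast
  then show "rep a = rep b" by (simp add: representative_def)
qed

lemma rep_rep: "a \<in> carrier A \<Longrightarrow> rep (rep a) = rep a"
  using rep_eq_iff[of "rep a" a] rep_props[of a] diff_sym by blast

lemma rep_add:
  assumes "a \<in> carrier A" "b \<in> carrier A"
  shows "rep (a \<oplus>\<^bsub>A\<^esub> b) = rep (rep a \<oplus>\<^bsub>A\<^esub> rep b)"
proof -
  have "(a \<oplus>\<^bsub>A\<^esub> b) \<ominus>\<^bsub>A\<^esub> (rep a \<oplus>\<^bsub>A\<^esub> rep b) = (a \<ominus>\<^bsub>A\<^esub> rep a) \<oplus>\<^bsub>A\<^esub> (b \<ominus>\<^bsub>A\<^esub> rep b)"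
    using assms rep_closed by (simp add: A.minus_eq A.minus_add A.M.a_ac)
  then show ?thesis using assms rep_props J.a_closed by (subst rep_eq_iff) auto
qed

lemma rep_mult:
  assumes "a \<in> carrier A" "b \<in> carrier A"
  shows "rep (a \<otimes>\<^bsub>A\<^esub> b) = rep (rep a \<otimes>\<^bsub>A\<^esub> rep b)"
proof -
  have "(a \<otimes>\<^bsub>A\<^esub> b) \<ominus>\<^bsub>A\<^esub> (rep a \<otimes>\<^bsub>A\<^esub> rep b)
    = (a \<ominus>\<^bsub>A\<^esub> rep a) \<otimes>\<^bsub>A\<^esub> b \<oplus>\<^bsub>A\<^esub> rep a \<otimes>\<^bsub>A\<^esub> (b \<ominus>\<^bsub>A\<^esub> rep b)"
    using assms rep_closed[of a] rep_closed[of b]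
    by (simp add: A.minus_eq A.l_distr A.r_distr A.l_minus A.r_minus A.M.a_assoc A.M.r_neg1)
  then show ?thesis
    using assms rep_props J.a_closed J.I_l_closed J.I_r_closed by (subst rep_eq_iff) auto
qed

lemma smult_J:
  assumes "c \<in> carrier K" "a \<in> J"
  shows "c \<odot>\<^bsub>A\<^esub> a \<in> J"
proof -
  have "c \<odot>\<^bsub>A\<^esub> a = (c \<odot>\<^bsub>A\<^esub> \<one>\<^bsub>A\<^esub>) \<otimes>\<^bsub>A\<^esub> a"
    using assms J.a_Hcarr A.smult_assoc2[of c "\<one>\<^bsub>A\<^esub>" a] by auto
  then show ?thesis using J.I_l_closed assms by simp
qed

lemma rep_smult:
  assumes c: "c \<in> carrier K" and a: "a \<in> carrier A"
  shows "rep (c \<odot>\<^bsub>A\<^esub> a) = rep (c \<odot>\<^bsub>A\<^esub> rep a)"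
proof -
  have "(c \<odot>\<^bsub>A\<^esub> a) \<ominus>\<^bsub>A\<^esub> (c \<odot>\<^bsub>A\<^esub> rep a) = c \<odot>\<^bsub>A\<^esub> (a \<ominus>\<^bsub>A\<^esub> rep a)"
    using c a rep_closed by (simp add: A.minus_eq A.smult_r_distr A.smult_r_minus)
  then show ?thesis using c a rep_props smult_J by (subst rep_eq_iff) auto
qed

lemma Q_simps:
  "carrier Q = rep ` carrier A" "x \<otimes>\<^bsub>Q\<^esub> y = rep (x \<otimes>\<^bsub>A\<^esub> y)" "\<one>\<^bsub>Q\<^esub> = rep \<one>\<^bsub>A\<^esub>"
  "\<zero>\<^bsub>Q\<^esub> = rep \<zero>\<^bsub>A\<^esub>" "x \<oplus>\<^bsub>Q\<^esub> y = rep (x \<oplus>\<^bsub>A\<^esub> y)" "c \<odot>\<^bsub>Q\<^esub> x = rep (c \<odot>\<^bsub>A\<^esub> x)"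
  by (simp_all add: quotient_alg_def)

lemma Q_carrierE:
  assumes "x \<in> carrier Q"
  obtains a where "a \<in> carrier A" "x = rep a"
  using assms by (auto simp: Q_simps)

lemma Q_carrier_sub: "x \<in> carrier Q \<Longrightarrow> x \<in> carrier A"
  using rep_closed by (auto simp: Q_simps)

lemma rep_hom: "rep \<in> alg_hom K A Q"
  by (rule alg_homI) (simp_all add: Q_simps rep_add[symmetric] rep_mult[symmetric] rep_smult[symmetric])

lemmas hom_simps = alg_hom_closed[OF rep_hom] alg_hom_add[OF rep_hom, symmetric]
  alg_hom_mult[OF rep_hom, symmetric] alg_hom_one[OF rep_hom, symmetric] alg_hom_smult[OF rep_hom, symmetric]

lemma Q_algebra: "algebra K Q"
proof (rule algebraI)
  show "cring K" by (rule A.R.is_cring)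
  show "cring Q"
  proof (intro cringI abelian_groupI comm_monoidI)
    fix x assume "x \<in> carrier Q"
    then obtain a where a: "a \<in> carrier A" "x = rep a" by (rule Q_carrierE)
    then show "\<exists>y\<in>carrier Q. y \<oplus>\<^bsub>Q\<^esub> x = \<zero>\<^bsub>Q\<^esub>"
      by (intro bexI[of _ "rep (\<ominus>\<^bsub>A\<^esub> a)"]) (simp_all add: hom_simps A.M.l_neg, simp add: Q_simps)
  qed (auto elim!: Q_carrierE simp: hom_simps Q_simps(4) A.M.a_ac A.m_ac A.l_distr A.r_distr)
qed (auto elim!: Q_carrierE simp: hom_simps A.smult_l_distr A.smult_r_distr A.smult_assoc1 A.smult_assoc2)

lemma rep_zero_iff: "a \<in> carrier A \<Longrightarrow> rep a = \<zero>\<^bsub>Q\<^esub> \<longleftrightarrow> a \<in> J"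
  by (simp add: Q_simps rep_eq_iff A.minus_eq)

lemma rep_on_Q: "x \<in> carrier Q \<Longrightarrow> rep x = x"
  by (auto elim!: Q_carrierE simp: rep_rep)

text \<open>
  As the quotient consists of elements of \<open>A\<close>, a homomorphism that kills the ideal is itself the
  homomorphism that it induces.
\<close>

lemma induced_hom:
  assumes C: "algebra K C" and f: "f \<in> alg_hom K A C" and 0: "\<And>a. a \<in> J \<Longrightarrow> f a = \<zero>\<^bsub>C\<^esub>"
  shows induced_rep: "a \<in> carrier A \<Longrightarrow> f (rep a) = f a" and "f \<in> alg_hom K Q C"
proof -
  interpret C: algebra K C by (rule C)
  show *: "f (rep a) = f a" if a: "a \<in> carrier A" for a
  proof -
    have "a = (a \<ominus>\<^bsub>A\<^esub> rep a) \<oplus>\<^bsub>A\<^esub> rep a"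
      using a rep_closed by (simp add: A.minus_eq A.M.a_assoc A.M.l_neg)
    then have "f a = f (a \<ominus>\<^bsub>A\<^esub> rep a) \<oplus>\<^bsub>C\<^esub> f (rep a)"
      using a rep_closed alg_hom_add[OF f] by (metis A.minus_closed)
    then show ?thesis using 0[OF rep_diff[OF a]] alg_hom_closed[OF f] rep_closed[OF a] by simp
  qed
  show "f \<in> alg_hom K Q C"
    by (rule alg_homI)
      (auto simp: Q_simps * rep_closed alg_hom_closed[OF f] alg_hom_add[OF f] alg_hom_mult[OF f]
        alg_hom_one[OF f] alg_hom_smult[OF f])
qed

end

lemma kernel_ideal:
  assumes A: "algebra K A" and B: "algebra K B" and f: "f \<in> alg_hom K A B"
  shows "ideal {a \<in> carrier A. f a = \<zero>\<^bsub>B\<^esub>} A"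
proof -
  interpret A: algebra K A by (rule A)
  interpret B: algebra K B by (rule B)
  have "ring A" "ring B" using algebra_cring A B cring.axioms(1) by blast+
  moreover have "f \<in> ring_hom A B" using f by (simp add: alg_hom_def)
  ultimately have "ring_hom_ring A B f" by (rule ring_hom_ringI2)
  from ring_hom_ring.kernel_is_ideal[OF this] show ?thesis unfolding a_kernel_def' .
qed

text \<open>
  The unit ideal has a geometrically reduced quotient, namely the zero ring; listing it separately
  makes it evident that the intersection is not that of an empty family.
\<close>

definition geom_radical :: "'k ring \<Rightarrow> ('k, 'a) module \<Rightarrow> 'a set"
  where "geom_radical K A =
    \<Inter>(insert (carrier A) {J. ideal J A \<and> geom_reduced_alg K (quotient_alg A J)})"

context
  fixes K :: "'k ring" and A :: "('k, 'a) module"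
  assumes K: "field K" and A: "algebra K A"
begin

interpretation A: algebra K A by (rule A)

lemma geom_radical_ideal: "ideal (geom_radical K A) A"
  unfolding geom_radical_def by (rule A.i_Intersect) (auto intro: A.oneideal)

lemma geom_radical_memI:
  "a \<in> carrier A \<Longrightarrow> (\<And>J. ideal J A \<Longrightarrow> geom_reduced_alg K (quotient_alg A J) \<Longrightarrow> a \<in> J) \<Longrightarrow> a \<in> geom_radical K A"
  by (auto simp: geom_radical_def)

lemma geom_radical_sub: "ideal J A \<Longrightarrow> geom_reduced_alg K (quotient_alg A J) \<Longrightarrow> geom_radical K A \<subseteq> J"
  by (auto simp: geom_radical_def)

text \<open>
  The image of \<open>f\<close> is a subalgebra of \<open>C\<close>, and the kernel of \<open>f\<close> is thus one of the ideals in question.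
\<close>

lemma geom_radical_vanish:
  assumes C: "algebra K C" "geom_reduced_alg K C" and f: "f \<in> alg_hom K A C" and a: "a \<in> geom_radical K A"
  shows "f a = \<zero>\<^bsub>C\<^esub>"
proof -
  define J where "J = {a \<in> carrier A. f a = \<zero>\<^bsub>C\<^esub>}"
  have id: "ideal J A" unfolding J_def by (rule kernel_ideal[OF A C(1) f])
  have J_iff: "x \<in> J \<longleftrightarrow> x \<in> carrier A \<and> f x = \<zero>\<^bsub>C\<^esub>" for x by (simp add: J_def)
  interpret J: algebra_ideal K A J by (intro algebra_ideal.intro A id)
  have "geom_reduced_alg K J.Q"
  proof (rule geom_reduced_alg_inj[OF K J.Q_algebra C(1) _ _ C(2)])
    show "f \<in> alg_hom K J.Q C" by (rule J.induced_hom(2)[OF C(1) f]) (simp add: J_iff)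
    fix x assume x: "x \<in> carrier J.Q" "f x = \<zero>\<^bsub>C\<^esub>"
    then have "x \<in> J" using J.Q_carrier_sub J_iff by blast
    then show "x = \<zero>\<^bsub>J.Q\<^esub>" using J.rep_zero_iff[OF J.Q_carrier_sub] J.rep_on_Q x(1) by metis
  qed
  then have "geom_radical K A \<subseteq> J" using geom_radical_sub id by blast
  then show ?thesis using a J_iff by blast
qed

text \<open>
  A nilpotent element of \<open>A/N \<otimes> L\<close> maps to zero in \<open>A/J \<otimes> L\<close> for each ideal \<open>J\<close> of the family.  Its
  contractions with linear forms on \<open>L\<close> thus lie in all these \<open>J\<close>, that is in \<open>N\<close>.
\<close>

lemma geom_radical_quotient: "geom_reduced_alg K (quotient_alg A (geom_radical K A))"
  unfolding geom_reduced_alg_def reduced_ring_def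
proof (intro ballI allI impI)
  let ?L = "alg_closure_alg K"
  let ?N = "geom_radical K A"
  note L = closure_algebra[OF K]
  interpret N: algebra_ideal K A ?N by (intro algebra_ideal.intro A geom_radical_ideal)
  interpret QL: tensor_pair K N.Q ?L by (intro tensor_pair.intro N.Q_algebra L)
  fix x and n :: nat
  assume x: "x \<in> carrier QL.T" and xn: "x [^]\<^bsub>QL.T\<^esub> n = \<zero>\<^bsub>QL.T\<^esub>"
  show "x = \<zero>\<^bsub>QL.T\<^esub>"
  proof (rule QL.zero_if_contractions_zero[OF K x])
    fix l assume l: "l \<in> linear_forms K ?L"
    let ?z = "contraction N.Q l x"
    have z: "?z \<in> carrier N.Q" by (rule QL.contraction_closed[OF l x])
    have "?z \<in> ?N"
    proof (rule geom_radical_memI[OF N.Q_carrier_sub[OF z]])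
      fix J assume J: "ideal J A" "geom_reduced_alg K (quotient_alg A J)"
      interpret J: algebra_ideal K A J by (intro algebra_ideal.intro A J)
      interpret JL: tensor_pair K J.Q ?L by (intro tensor_pair.intro J.Q_algebra L)
      have "J.rep a = \<zero>\<^bsub>J.Q\<^esub>" if "a \<in> ?N" for a
        using that geom_radical_sub[OF J] J.rep_zero_iff N.J.a_Hcarr by blast
      then have r: "J.rep \<in> alg_hom K N.Q J.Q"
        by (rule N.induced_hom(2)[OF J.Q_algebra J.rep_hom])
      let ?p = "tensor_map K J.Q ?L J.rep (\<lambda>c. c)"
      have p_hom: "?p \<in> alg_hom K QL.T JL.T"
        by (rule tensor_map_hom[OF N.Q_algebra L J.Q_algebra L r alg_hom_id])
      have "?p x [^]\<^bsub>JL.T\<^esub> n = \<zero>\<^bsub>JL.T\<^esub>"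
        using alg_hom_pow[OF QL.T_algebra JL.T_algebra p_hom x, of n] xn
          alg_hom_zero[OF QL.T_algebra JL.T_algebra p_hom] by simp
      then have "?p x = \<zero>\<^bsub>JL.T\<^esub>"
        using J(2) alg_hom_closed[OF p_hom x] unfolding geom_reduced_alg_def reduced_ring_def by blast
      moreover have "contraction J.Q l \<zero>\<^bsub>JL.T\<^esub> = \<zero>\<^bsub>J.Q\<^esub>"
        using l by (simp add: JL.T_zero JL.contraction_cls)
      ultimately have "J.rep ?z = \<zero>\<^bsub>J.Q\<^esub>"
        using contraction_tensor_map[OF N.Q_algebra L J.Q_algebra r l x] by simp
      then show "?z \<in> J" using J.rep_zero_iff N.Q_carrier_sub[OF z] by simp
    qed
    then show "?z = \<zero>\<^bsub>N.Q\<^esub>"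
      using N.rep_zero_iff[OF N.Q_carrier_sub[OF z]] N.rep_on_Q[OF z] by simp
  qed
qed

end

section \<open>Quotients of affine group schemes\<close>

lemma structure_map_hom:
  assumes A: "algebra K A"
  shows "structure_map A \<in> alg_hom K (base_alg K) A"
proof -
  interpret A: algebra K A by (rule A)
  have "(c \<odot>\<^bsub>A\<^esub> \<one>\<^bsub>A\<^esub>) \<otimes>\<^bsub>A\<^esub> (d \<odot>\<^bsub>A\<^esub> \<one>\<^bsub>A\<^esub>) = (c \<otimes>\<^bsub>K\<^esub> d) \<odot>\<^bsub>A\<^esub> \<one>\<^bsub>A\<^esub>" if "c \<in> carrier K" "d \<in> carrier K" for c d
    using that by (simp add: A.smult_assoc2 A.smult_assoc1)
  then show ?thesis
    by (intro alg_homI) (auto simp: structure_map_def A.smult_l_distr A.smult_assoc1)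
qed

lemma
  assumes A: "algebra K A" and B: "algebra K B" and C: "algebra K C"
  shows tensor_assoc_hom: "tensor_assoc K A B C
      \<in> alg_hom K (tensor K (tensor K A B) C) (tensor K A (tensor K B C))"
    and tensor_assoc_inl_inl: "a \<in> carrier A \<Longrightarrow>
      tensor_assoc K A B C (tensor_inl K (tensor K A B) C (tensor_inl K A B a)) = tensor_inl K A (tensor K B C) a"
    and tensor_assoc_inl_inr: "b \<in> carrier B \<Longrightarrow>
      tensor_assoc K A B C (tensor_inl K (tensor K A B) C (tensor_inr K A B b))
        = tensor_inr K A (tensor K B C) (tensor_inl K B C b)"
    and tensor_assoc_inr: "c \<in> carrier C \<Longrightarrow>
      tensor_assoc K A B C (tensor_inr K (tensor K A B) C c)
        = tensor_inr K A (tensor K B C) (tensor_inr K B C c)"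
proof -
  note AB = tensor_algebra[OF A B] and BC = tensor_algebra[OF B C]
  note T = tensor_algebra[OF A BC]
  note 1 = inl_hom[OF A BC] alg_hom_comp[OF inl_hom[OF B C] inr_hom[OF A BC]]
  note 2 = lift_hom[OF A B T 1] alg_hom_comp[OF inr_hom[OF B C] inr_hom[OF A BC]]
  note l = lift_inl[OF A B T 1] lift_inr[OF A B T 1] lift_inl[OF AB C T 2] lift_inr[OF AB C T 2]
    alg_hom_closed[OF inl_hom[OF A B]] alg_hom_closed[OF inr_hom[OF A B]]
  show "tensor_assoc K A B C \<in> alg_hom K (tensor K (tensor K A B) C) (tensor K A (tensor K B C))"
    unfolding tensor_assoc_def Let_def by (rule lift_hom[OF AB C T 2])
  show "a \<in> carrier A \<Longrightarrow>
      tensor_assoc K A B C (tensor_inl K (tensor K A B) C (tensor_inl K A B a)) = tensor_inl K A (tensor K B C) a"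
    and "b \<in> carrier B \<Longrightarrow>
      tensor_assoc K A B C (tensor_inl K (tensor K A B) C (tensor_inr K A B b))
        = tensor_inr K A (tensor K B C) (tensor_inl K B C b)"
    and "c \<in> carrier C \<Longrightarrow>
      tensor_assoc K A B C (tensor_inr K (tensor K A B) C c)
        = tensor_inr K A (tensor K B C) (tensor_inr K B C c)"
    unfolding tensor_assoc_def Let_def by (simp_all add: l)
qed

lemma tensor_map_comp:
  assumes A: "algebra K A" and B: "algebra K B" and C: "algebra K C" and D: "algebra K D"
    and E: "algebra K E" and F: "algebra K F"
    and f: "f \<in> alg_hom K A C" "f' \<in> alg_hom K C E" "h \<in> alg_hom K A E" "\<And>a. a \<in> carrier A \<Longrightarrow> f' (f a) = h a"
    and g: "g \<in> alg_hom K B D" "g' \<in> alg_hom K D F" "k \<in> alg_hom K B F" "\<And>b. b \<in> carrier B \<Longrightarrow> g' (g b) = k b"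
    and x: "x \<in> carrier (tensor K A B)"
  shows "tensor_map K E F f' g' (tensor_map K C D f g x) = tensor_map K E F h k x"
proof -
  note m1 = tensor_map_hom[OF A B C D f(1) g(1)] tensor_map_inl[OF A B C D f(1) g(1)] tensor_map_inr[OF A B C D f(1) g(1)]
  note m2 = tensor_map_hom[OF C D E F f(2) g(2)] tensor_map_inl[OF C D E F f(2) g(2)] tensor_map_inr[OF C D E F f(2) g(2)]
  note m3 = tensor_map_hom[OF A B E F f(3) g(3)] tensor_map_inl[OF A B E F f(3) g(3)] tensor_map_inr[OF A B E F f(3) g(3)]
  show ?thesis
    by (rule hom_ext[OF A B tensor_algebra[OF E F] alg_hom_comp'[OF m1(1) m2(1)] m3(1) _ _ x])
      (simp_all add: m1 m2 m3 f(4) g(4) alg_hom_closed[OF f(1)] alg_hom_closed[OF g(1)])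
qed

text \<open>
  This serves to transfer those group axioms that involve the algebra map induced on \<open>A \<otimes> A\<close> by two
  homomorphisms out of \<open>A\<close>, namely the counit and inverse laws.
\<close>

lemma lift_tensor_map:
  assumes A: "algebra K A" and B: "algebra K B" and C: "algebra K C" and D: "algebra K D"
    and R: "algebra K R" and S: "algebra K S" and p: "p \<in> alg_hom K S R"
    and f: "f \<in> alg_hom K A C" "f' \<in> alg_hom K C R" "h \<in> alg_hom K A S" "\<And>a. a \<in> carrier A \<Longrightarrow> f' (f a) = p (h a)"
    and g: "g \<in> alg_hom K B D" "g' \<in> alg_hom K D R" "k \<in> alg_hom K B S" "\<And>b. b \<in> carrier B \<Longrightarrow> g' (g b) = p (k b)"
    and x: "x \<in> carrier (tensor K A B)"
  shows "tensor_lift R f' g' (tensor_map K C D f g x) = p (tensor_lift S h k x)"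
proof -
  note m1 = tensor_map_hom[OF A B C D f(1) g(1)] tensor_map_inl[OF A B C D f(1) g(1)] tensor_map_inr[OF A B C D f(1) g(1)]
  note m2 = lift_hom[OF C D R f(2) g(2)] lift_inl[OF C D R f(2) g(2)] lift_inr[OF C D R f(2) g(2)]
  note m3 = lift_hom[OF A B S f(3) g(3)] lift_inl[OF A B S f(3) g(3)] lift_inr[OF A B S f(3) g(3)]
  show ?thesis
    by (rule hom_ext[OF A B R alg_hom_comp'[OF m1(1) m2(1)] alg_hom_comp'[OF m3(1) p] _ _ x])
      (simp_all add: m1 m2 m3 f(4) g(4) alg_hom_closed[OF f(1)] alg_hom_closed[OF g(1)])
qed

definition quotient_kgroup :: "'k ring \<Rightarrow> ('k, 'a) kgroup \<Rightarrow> 'a set \<Rightarrow> ('k, 'a) kgroup"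
  where "quotient_kgroup K G J =
    (let A = sections G; Q = quotient_alg A J; p = representative A J
     in \<lparr>sections = Q, comult = (\<lambda>x. tensor_map K Q Q p p (comult G x)),
         counit = counit G, antipode = (\<lambda>x. p (antipode G x))\<rparr>)"

text \<open>
  The condition on the comultiplication is \<open>\<Delta>(J) \<subseteq> J \<otimes> A + A \<otimes> J\<close>, where the right-hand side is
  written as the kernel of \<open>A \<otimes> A \<rightarrow> A/J \<otimes> A/J\<close>.
\<close>

locale hopf_ideal = G: k_group K G + J: ideal J "sections G"
  for K :: "'k ring" and G :: "('k, 'a) kgroup" and J +
  assumes comult_ideal: "a \<in> J \<Longrightarrow>
      tensor_map K (quotient_alg (sections G) J) (quotient_alg (sections G) J)
        (representative (sections G) J) (representative (sections G) J) (comult G a)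
      = \<zero>\<^bsub>tensor K (quotient_alg (sections G) J) (quotient_alg (sections G) J)\<^esub>"
    and counit_ideal: "a \<in> J \<Longrightarrow> counit G a = \<zero>\<^bsub>K\<^esub>"
    and antipode_ideal: "a \<in> J \<Longrightarrow> antipode G a \<in> J"
begin

abbreviation A where "A \<equiv> sections G"

sublocale algebra_ideal K A J
  by (intro algebra_ideal.intro G.algebra J.ideal_axioms)

abbreviation QQ where "QQ \<equiv> tensor K Q Q"
abbreviation AA where "AA \<equiv> tensor K A A"
abbreviation rep2 where "rep2 \<equiv> tensor_map K Q Q rep rep"
abbreviation comultQ where "comultQ \<equiv> \<lambda>x. rep2 (comult G x)"
abbreviation antipodeQ where "antipodeQ \<equiv> \<lambda>x. rep (antipode G x)"

lemmas algs = G.algebra Q_algebra tensor_algebra[OF G.algebra G.algebra] tensor_algebra[OF Q_algebra Q_algebra]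
  tensor_algebra[OF tensor_algebra[OF G.algebra G.algebra] G.algebra]
  tensor_algebra[OF G.algebra tensor_algebra[OF G.algebra G.algebra]]
  tensor_algebra[OF tensor_algebra[OF Q_algebra Q_algebra] Q_algebra]
  tensor_algebra[OF Q_algebra tensor_algebra[OF Q_algebra Q_algebra]]

lemma rep2_hom: "rep2 \<in> alg_hom K AA QQ"
  by (rule tensor_map_hom) (use algs rep_hom in auto)

lemma comultQ_A: "comultQ \<in> alg_hom K A QQ"
  by (rule alg_hom_comp'[OF G.comult_hom rep2_hom])

lemma comultQ_hom: "comultQ \<in> alg_hom K Q QQ"
  and comultQ_rep: "a \<in> carrier A \<Longrightarrow> comultQ (rep a) = comultQ a"
  using induced_hom[OF algs(4) comultQ_A] comult_ideal by auto

lemma counit_Q: "counit G \<in> alg_hom K Q (base_alg K)"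
  and counit_rep: "a \<in> carrier A \<Longrightarrow> counit G (rep a) = counit G a"
  using induced_hom[OF base_algebra[OF G.field] G.counit_hom] counit_ideal by auto

lemma antipodeQ_A: "antipodeQ \<in> alg_hom K A Q"
  by (rule alg_hom_comp'[OF G.antipode_hom rep_hom])

lemma antipodeQ_hom: "antipodeQ \<in> alg_hom K Q Q"
  and antipodeQ_rep: "a \<in> carrier A \<Longrightarrow> antipodeQ (rep a) = antipodeQ a"
  using induced_hom[OF algs(2) antipodeQ_A] antipode_ideal rep_zero_iff J.a_Hcarr by auto

lemma structure_map_rep: "c \<in> carrier K \<Longrightarrow> structure_map Q c = rep (structure_map A c)"
  by (simp add: structure_map_def hom_simps)

lemma unit_counit_A: "structure_map A \<circ> counit G \<in> alg_hom K A A"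
  by (rule alg_hom_comp[OF G.counit_hom structure_map_hom[OF algs(1)]])

lemma unit_counit_Q: "structure_map Q \<circ> counit G \<in> alg_hom K Q Q"
  by (rule alg_hom_comp[OF counit_Q structure_map_hom[OF algs(2)]])

lemma counit_closed: "a \<in> carrier A \<Longrightarrow> counit G a \<in> carrier K"
  using alg_hom_closed[OF G.counit_hom] by simp

lemma unit_counit_rep: "a \<in> carrier A \<Longrightarrow> (structure_map Q \<circ> counit G) (rep a) = rep ((structure_map A \<circ> counit G) a)"
  by (simp add: counit_rep structure_map_rep counit_closed)

lemma tensor_assoc_rep:
  assumes "w \<in> carrier (tensor K AA A)"
  shows "tensor_assoc K Q Q Q (tensor_map K QQ Q rep2 rep w) = tensor_map K Q QQ rep rep2 (tensor_assoc K A A A w)"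
proof -
  note A = algs(1) and Q = algs(2) and AA = algs(3) and QQ = algs(4)
  note m = tensor_map_hom[OF AA A QQ Q rep2_hom rep_hom] tensor_map_inl[OF AA A QQ Q rep2_hom rep_hom]
    tensor_map_inr[OF AA A QQ Q rep2_hom rep_hom] tensor_map_hom[OF A AA Q QQ rep_hom rep2_hom]
    tensor_map_inl[OF A AA Q QQ rep_hom rep2_hom] tensor_map_inr[OF A AA Q QQ rep_hom rep2_hom]
    tensor_map_inl[OF A A Q Q rep_hom rep_hom] tensor_map_inr[OF A A Q Q rep_hom rep_hom]
  note s = tensor_assoc_hom[OF A A A] tensor_assoc_inl_inl[OF A A A] tensor_assoc_inl_inr[OF A A A] tensor_assoc_inr[OF A A A]
    tensor_assoc_hom[OF Q Q Q] tensor_assoc_inl_inl[OF Q Q Q] tensor_assoc_inl_inr[OF Q Q Q] tensor_assoc_inr[OF Q Q Q]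
  note c = alg_hom_closed[OF rep_hom] alg_hom_closed[OF inl_hom[OF A A]] alg_hom_closed[OF inr_hom[OF A A]]
  note F = alg_hom_comp'[OF m(1) s(5)] and H = alg_hom_comp'[OF s(1) m(4)]
  have inl: "tensor_assoc K Q Q Q (tensor_map K QQ Q rep2 rep (tensor_inl K AA A u))
      = tensor_map K Q QQ rep rep2 (tensor_assoc K A A A (tensor_inl K AA A u))" if "u \<in> carrier AA" for u
    by (rule hom_ext[OF A A algs(8) alg_hom_comp'[OF inl_hom[OF AA A] F] alg_hom_comp'[OF inl_hom[OF AA A] H] _ _ that])
      (simp_all add: m s c)
  show ?thesis
    by (rule hom_ext[OF AA A algs(8) F H _ _ assms]) (simp_all add: inl, simp add: m s c)
qed

text \<open>
  Each axiom is the image of the corresponding axiom of \<open>G\<close> under tensor powers of the quotient map.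
\<close>

lemma quotient_k_group: "k_group K (quotient_kgroup K G J)"
proof -
  note A = algs(1) and Q = algs(2) and AA = algs(3) and QQ = algs(4)
  have u: "comult G x \<in> carrier AA" if "x \<in> carrier A" for x
    by (rule alg_hom_closed[OF G.comult_hom that])
  show ?thesis
    unfolding quotient_kgroup_def Let_def
  proof (rule k_group.intro, simp_all only: kgroup.simps)
    show "field K" by (rule G.field)
    show "algebra K Q" by (rule Q)
    show "comultQ \<in> alg_hom K Q QQ" by (rule comultQ_hom)
    show "counit G \<in> alg_hom K Q (base_alg K)" by (rule counit_Q)
    show "antipodeQ \<in> alg_hom K Q Q" by (rule antipodeQ_hom)
    fix x assume xQ: "x \<in> carrier Q"
    then have x: "x \<in> carrier A" and rx: "rep x = x" by (simp_all add: Q_carrier_sub rep_on_Q)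
    let ?w = "tensor_map K AA A (comult G) (\<lambda>y. y) (comult G x)"
    have w: "?w \<in> carrier (tensor K AA A)"
      by (rule alg_hom_closed[OF tensor_map_hom[OF A A AA A G.comult_hom alg_hom_id] u[OF x]])
    have 1: "tensor_map K QQ Q comultQ (\<lambda>y. y) (comultQ x) = tensor_map K QQ Q comultQ rep (comult G x)"
      by (rule tensor_map_comp[OF A A Q Q QQ Q rep_hom comultQ_hom comultQ_A _ rep_hom alg_hom_id rep_hom _ u[OF x]])
        (simp_all add: comultQ_rep)
    have 2: "tensor_map K QQ Q rep2 rep ?w = tensor_map K QQ Q comultQ rep (comult G x)"
      by (rule tensor_map_comp[OF A A AA A QQ Q G.comult_hom rep2_hom comultQ_A _ alg_hom_id rep_hom rep_hom _ u[OF x]]) simp_all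
    have 3: "tensor_map K Q QQ rep rep2 (tensor_map K A AA (\<lambda>y. y) (comult G) (comult G x))
        = tensor_map K Q QQ rep comultQ (comult G x)"
      by (rule tensor_map_comp[OF A A A AA Q QQ alg_hom_id rep_hom rep_hom _ G.comult_hom rep2_hom comultQ_A _ u[OF x]]) simp_all
    have 4: "tensor_map K Q QQ (\<lambda>y. y) comultQ (comultQ x) = tensor_map K Q QQ rep comultQ (comult G x)"
      by (rule tensor_map_comp[OF A A Q Q Q QQ rep_hom alg_hom_id rep_hom _ rep_hom comultQ_hom comultQ_A _ u[OF x]])
        (simp_all add: comultQ_rep)
    show "tensor_assoc K Q Q Q (tensor_map K QQ Q comultQ (\<lambda>y. y) (comultQ x))
      = tensor_map K Q QQ (\<lambda>y. y) comultQ (comultQ x)"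
      unfolding 1 2[symmetric] tensor_assoc_rep[OF w] G.coassoc[OF x] 3 4 by (rule refl)
    have "tensor_lift Q (structure_map Q \<circ> counit G) (\<lambda>y. y) (comultQ x)
        = rep (tensor_lift A (structure_map A \<circ> counit G) (\<lambda>y. y) (comult G x))"
      by (rule lift_tensor_map[OF A A Q Q Q A rep_hom rep_hom unit_counit_Q unit_counit_A unit_counit_rep
            rep_hom alg_hom_id alg_hom_id refl u[OF x]])
    then show "tensor_lift Q (structure_map Q \<circ> counit G) (\<lambda>y. y) (comultQ x) = x"
      using G.counit_left[OF x] rx by simp
    have "tensor_lift Q (\<lambda>y. y) (structure_map Q \<circ> counit G) (comultQ x)
        = rep (tensor_lift A (\<lambda>y. y) (structure_map A \<circ> counit G) (comult G x))"
      by (rule lift_tensor_map[OF A A Q Q Q A rep_hom rep_hom alg_hom_id alg_hom_id refl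
            rep_hom unit_counit_Q unit_counit_A unit_counit_rep u[OF x]])
    then show "tensor_lift Q (\<lambda>y. y) (structure_map Q \<circ> counit G) (comultQ x) = x"
      using G.counit_right[OF x] rx by simp
    have "tensor_lift Q antipodeQ (\<lambda>y. y) (comultQ x) = rep (tensor_lift A (antipode G) (\<lambda>y. y) (comult G x))"
      by (rule lift_tensor_map[OF A A Q Q Q A rep_hom rep_hom antipodeQ_hom G.antipode_hom antipodeQ_rep
            rep_hom alg_hom_id alg_hom_id refl u[OF x]])
    then show "tensor_lift Q antipodeQ (\<lambda>y. y) (comultQ x) = structure_map Q (counit G x)"
      using G.antipode_left[OF x] structure_map_rep counit_closed[OF x] by simp
    have "tensor_lift Q (\<lambda>y. y) antipodeQ (comultQ x) = rep (tensor_lift A (\<lambda>y. y) (antipode G) (comult G x))"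
      by (rule lift_tensor_map[OF A A Q Q Q A rep_hom rep_hom alg_hom_id alg_hom_id refl
            rep_hom antipodeQ_hom G.antipode_hom antipodeQ_rep u[OF x]])
    then show "tensor_lift Q (\<lambda>y. y) antipodeQ (comultQ x) = structure_map Q (counit G x)"
      using G.antipode_right[OF x] structure_map_rep counit_closed[OF x] by simp
  qed
qed

lemma quotient_kgroup_sections: "sections (quotient_kgroup K G J) = Q"
  and quotient_kgroup_comult: "comult (quotient_kgroup K G J) = comultQ"
  by (simp_all add: quotient_kgroup_def Let_def)

lemma rep_kgroup_mor: "rep \<in> kgroup_mor K (quotient_kgroup K G J) G"
  using rep_hom comultQ_rep by (simp add: kgroup_mor_def quotient_kgroup_sections quotient_kgroup_comult)

lemma kgroup_mor_quotient:
  assumes F: "k_group K F" and i: "i \<in> kgroup_mor K F G" and 0: "\<And>a. a \<in> J \<Longrightarrow> i a = \<zero>\<^bsub>sections F\<^esub>"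
  shows "i \<in> kgroup_mor K F (quotient_kgroup K G J)"
proof -
  interpret F: k_group K F by (rule F)
  have ih: "i \<in> alg_hom K A (sections F)" and
    ic: "\<And>x. x \<in> carrier A \<Longrightarrow> comult F (i x) = tensor_map K (sections F) (sections F) i i (comult G x)"
    using i by (auto simp: kgroup_mor_def)
  note ind = induced_hom[OF F.algebra ih 0]
  have "comult F (i x) = tensor_map K (sections F) (sections F) i i (comultQ x)" if "x \<in> carrier Q" for x
    unfolding ic[OF Q_carrier_sub[OF that]]
    by (rule tensor_map_comp[symmetric, OF algs(1) algs(1) algs(2) algs(2) F.algebra F.algebra
          rep_hom ind(2) ih ind(1) rep_hom ind(2) ih ind(1)
          alg_hom_closed[OF G.comult_hom Q_carrier_sub[OF that]]]) auto
  then show ?thesis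
    using ind(2) by (simp add: kgroup_mor_def quotient_kgroup_sections quotient_kgroup_comult)
qed

end

section \<open>The largest geometrically reduced subgroup of a push-out\<close>

lemma kgroup_mor_comp:
  assumes "k_group K F" "k_group K G" "k_group K H"
    and f: "f \<in> kgroup_mor K F G" and g: "g \<in> kgroup_mor K G H"
  shows "f \<circ> g \<in> kgroup_mor K F H"
proof -
  interpret F: k_group K F by fact
  interpret G: k_group K G by fact
  interpret H: k_group K H by fact
  have f: "f \<in> alg_hom K (sections G) (sections F)" "\<And>x. x \<in> carrier (sections G) \<Longrightarrow>
      comult F (f x) = tensor_map K (sections F) (sections F) f f (comult G x)"
    and g: "g \<in> alg_hom K (sections H) (sections G)" "\<And>x. x \<in> carrier (sections H) \<Longrightarrow>
      comult G (g x) = tensor_map K (sections G) (sections G) g g (comult H x)"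
    using f g by (auto simp: kgroup_mor_def)
  note fg = alg_hom_comp[OF g(1) f(1)]
  have "comult F (f (g x)) = tensor_map K (sections F) (sections F) (f \<circ> g) (f \<circ> g) (comult H x)"
    if x: "x \<in> carrier (sections H)" for x
    unfolding f(2)[OF alg_hom_closed[OF g(1) x]] g(2)[OF x]
    by (rule tensor_map_comp[OF H.algebra H.algebra G.algebra G.algebra F.algebra F.algebra
          g(1) f(1) fg _ g(1) f(1) fg _ alg_hom_closed[OF H.comult_hom x]]) simp_all
  then show ?thesis using fg by (simp add: kgroup_mor_def)
qed

lemma kgroup_mor_id:
  assumes "k_group K G"
  shows "(\<lambda>x. x) \<in> kgroup_mor K G G"
proof -
  interpret G: k_group K G by fact
  note A = G.algebra
  have "x = tensor_map K (sections G) (sections G) (\<lambda>x. x) (\<lambda>x. x) x"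
    if x: "x \<in> carrier (tensor K (sections G) (sections G))" for x
    using hom_ext[OF A A tensor_algebra[OF A A] alg_hom_id tensor_map_hom[OF A A A A alg_hom_id alg_hom_id] _ _ x]
      tensor_map_inl[OF A A A A alg_hom_id alg_hom_id] tensor_map_inr[OF A A A A alg_hom_id alg_hom_id] by simp
  then show ?thesis
    using alg_hom_id alg_hom_closed[OF G.comult_hom] by (simp add: kgroup_mor_def)
qed

text \<open>
  Comultiplication, counit and antipode, followed by the projections to the quotient, are
  homomorphisms from the coordinate ring to geometrically reduced algebras.
\<close>

lemma geom_radical_hopf_ideal:
  assumes "k_group K G"
  shows "hopf_ideal K G (geom_radical K (sections G))"
proof -
  interpret G: k_group K G by fact
  define A N where "A = sections G" and "N = geom_radical K A"
  note A = G.algebra[folded A_def] and K = G.field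
  interpret N: algebra_ideal K A N
    unfolding N_def by (intro algebra_ideal.intro A geom_radical_ideal[OF K A])
  have Q: "algebra K N.Q" "geom_reduced_alg K N.Q"
    using N.Q_algebra geom_radical_quotient[OF K A] by (simp_all add: N_def)
  note vanish = geom_radical_vanish[OF K A, folded N_def]
  have QQ: "algebra K (tensor K N.Q N.Q)" "geom_reduced_alg K (tensor K N.Q N.Q)"
    using tensor_algebra geom_reduced_tensor[OF K] Q by blast+
  have ideal: "ideal N A" unfolding N_def by (rule geom_radical_ideal[OF K A])
  have "tensor_map K N.Q N.Q N.rep N.rep (comult G a) = \<zero>\<^bsub>tensor K N.Q N.Q\<^esub>" if "a \<in> N" for a
    using vanish[OF QQ alg_hom_comp'[OF G.comult_hom[folded A_def]
          tensor_map_hom[OF A A Q(1) Q(1) N.rep_hom N.rep_hom]] that] .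
  moreover have "counit G a = \<zero>\<^bsub>K\<^esub>" if "a \<in> N" for a
    using vanish[OF base_algebra[OF K] geom_reduced_base[OF K] G.counit_hom[folded A_def] that] by simp
  moreover have "antipode G a \<in> N" if "a \<in> N" for a
    using vanish[OF Q alg_hom_comp'[OF G.antipode_hom[folded A_def] N.rep_hom] that]
      N.rep_zero_iff alg_hom_closed[OF G.antipode_hom[folded A_def]] N.J.a_Hcarr that by blast
  ultimately show ?thesis
    unfolding A_def[symmetric] N_def[symmetric]
    using assms ideal by (auto simp: hopf_ideal_def hopf_ideal_axioms_def A_def[symmetric])
qed

theorem proposition2p6:
  fixes K :: "'k ring"
    and H G1 G2 P :: "('k, 'u) kgroup"
    and f1 f2 i1 i2 :: "'u \<Rightarrow> 'u"
  assumes "field K"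
    and "k_group K H" and "k_group K G1" and "k_group K G2"
    and "f1 \<in> kgroup_mor K H G1" and "f2 \<in> kgroup_mor K H G2"
    and "is_pushout K H G1 G2 f1 f2 P i1 i2"
    and "geometrically_reduced K G1" and "geometrically_reduced K G2"
  shows "geometrically_reduced K P"
proof -
  have P: "k_group K P" and i1: "i1 \<in> kgroup_mor K G1 P" and i2: "i2 \<in> kgroup_mor K G2 P"
    and comm: "\<And>x. x \<in> carrier (sections P) \<Longrightarrow> f1 (i1 x) = f2 (i2 x)"
    using assms(7) unfolding is_pushout_def by blast+
  note univ = assms(7)[unfolded is_pushout_def, THEN conjunct2, THEN conjunct2, THEN conjunct2,
      THEN conjunct2, THEN spec, THEN mp, THEN bspec, THEN bspec, THEN mp]
  interpret G1: k_group K G1 by fact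
  interpret G2: k_group K G2 by fact
  define J where "J = geom_radical K (sections P)"
  interpret J: hopf_ideal K P J
    unfolding J_def by (rule geom_radical_hopf_ideal[OF P])
  define R where "R = quotient_kgroup K P J"
  have R: "k_group K R" unfolding R_def by (rule J.quotient_k_group)
  have sR: "sections R = J.Q" unfolding R_def by (rule J.quotient_kgroup_sections)
  have h1: "i1 \<in> alg_hom K (sections P) (sections G1)" and h2: "i2 \<in> alg_hom K (sections P) (sections G2)"
    using i1 i2 by (auto simp: kgroup_mor_def)
  have 1: "i1 a = \<zero>\<^bsub>sections G1\<^esub>" if "a \<in> J" for a
    using geom_radical_vanish[OF assms(1) J.G.algebra G1.algebra _ h1] assms(8) that
    by (simp add: J_def geometrically_reduced_def geom_reduced_alg_def)
  have 2: "i2 a = \<zero>\<^bsub>sections G2\<^esub>" if "a \<in> J" for a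
    using geom_radical_vanish[OF assms(1) J.G.algebra G2.algebra _ h2] assms(9) that
    by (simp add: J_def geometrically_reduced_def geom_reduced_alg_def)
  have "i1 \<in> kgroup_mor K G1 R" "i2 \<in> kgroup_mor K G2 R"
    unfolding R_def using J.kgroup_mor_quotient 1 2 i1 i2 assms(3,4) by blast+
  moreover have "\<forall>x\<in>carrier (sections R). f1 (i1 x) = f2 (i2 x)"
    using comm J.Q_carrier_sub by (simp add: sR)
  ultimately obtain u where u: "u \<in> kgroup_mor K P R"
    and u12: "\<And>x. x \<in> carrier J.Q \<Longrightarrow> i1 (u x) = i1 x \<and> i2 (u x) = i2 x"
    using univ[OF R] sR by metis
  have v: "u \<circ> J.rep \<in> kgroup_mor K P P"
    by (rule kgroup_mor_comp[OF P R P u J.rep_kgroup_mor[folded R_def]])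
  have "i1 ((u \<circ> J.rep) x) = i1 x \<and> i2 ((u \<circ> J.rep) x) = i2 x" if "x \<in> carrier (sections P)" for x
    using that u12[of "J.rep x"] alg_hom_closed[OF J.rep_hom that]
      J.induced_hom(1)[OF G1.algebra h1 1 that] J.induced_hom(1)[OF G2.algebra h2 2 that] by simp
  \<comment> \<open>The endomorphism of \<open>P\<close> through the subgroup restricts to \<open>i1\<close> and \<open>i2\<close>, as the identity does.\<close>
  note v12 = this
  have "\<forall>x\<in>carrier (sections P). f1 (i1 x) = f2 (i2 x)" using comm by blast
  from univ[OF P i1 i2 this] obtain w where w: "\<And>t. t \<in> kgroup_mor K P P \<Longrightarrow>
      \<forall>x\<in>carrier (sections P). i1 (t x) = i1 x \<and> i2 (t x) = i2 x \<Longrightarrow> \<forall>x\<in>carrier (sections P). t x = w x"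
  proof (elim bexE conjE)
    fix w assume "\<forall>t\<in>kgroup_mor K P P. (\<forall>x\<in>carrier (sections P). i1 (t x) = i1 x \<and> i2 (t x) = i2 x) \<longrightarrow>
      (\<forall>x\<in>carrier (sections P). t x = w x)"
    from this[THEN bspec, THEN mp] show thesis by (rule that)
  qed
  have split: "u (J.rep x) = x" if "x \<in> carrier (sections P)" for x
  proof -
    have "(u \<circ> J.rep) x = w x" using w[OF v] v12 that by blast
    moreover have "x = w x" using w[OF kgroup_mor_id[OF P]] that by blast
    ultimately show ?thesis by simp
  qed
  have uh: "u \<in> alg_hom K J.Q (sections P)" using u by (simp add: kgroup_mor_def sR)
  have "geom_reduced_alg K (sections P)"
  proof (rule geom_reduced_alg_inj[OF assms(1) J.G.algebra J.Q_algebra J.rep_hom])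
    fix a assume a: "a \<in> carrier (sections P)" "J.rep a = \<zero>\<^bsub>J.Q\<^esub>"
    then show "a = \<zero>\<^bsub>sections P\<^esub>"
      using split[OF a(1)] alg_hom_zero[OF J.Q_algebra J.G.algebra uh] by simp
  next
    show "geom_reduced_alg K J.Q"
      unfolding J_def by (rule geom_radical_quotient[OF assms(1) J.G.algebra])
  qed
  then show ?thesis by (simp add: geometrically_reduced_def geom_reduced_alg_def)
qed

end
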